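(* Write $B:=B^{\nu,\mu}_\tau$. For $k=0,1,2,\dots$ let $E_k=B(2k+1)$ and let $A^{\nu,\mu}_{\tau;k}(\mathbb{C})=\{F\in L^2(\mathbb{C};d\lambda):\ \mathfrak{L}^{\nu,\mu}_\tau F=E_kF\}$ be the $L^2$-eigenspace of $\mathfrak{L}^{\nu,\mu}_\tau$ associated with the eigenvalue $E_k$. Then: (i) There is the orthogonal decomposition $L^2(\mathbb{C};d\lambda)=\bigoplus_{k=0}^\infty A^{\nu,\mu}_{\tau;k}$. (ii) Let $\psi^{\nu,\mu}_\tau(z,w):=\varphi^{\nu,\mu}_\tau(z)-\varphi^{\nu,\mu}_\tau(w)$. The eigenprojector kernel $K^{\nu,\mu}_{\tau;k}(z,w)$ of $A^{\nu,\mu}_{\tau;k}$ satisfies, for $g\in G$ and $z,w\in\mathbb{C}$, the invariance property $$K^{\nu,\mu}_{\tau;k}(z,w)=e^{-i(\psi^{\nu,\mu}_\tau(z,w)-\psi^{\nu,\mu}_\tau(g\cdot z,g\cdot w))}\,e^{2iB\,\Im\langle z-w,\,g^{-1}\cdot 0\rangle}\,K^{\nu,\mu}_{\tau;k}(g\cdot z,g\cdot w),$$ and is given explicitly by $$K^{\nu,\mu}_{\tau;k}(z,w)=\frac{2B}{\pi}\,e^{-i\psi^{\nu,\mu}_\tau(z,w)}\,e^{2iB\,\Im\langle z,w\rangle}\,e^{-B|z-w|^2}\,L_k\big(2B|z-w|^2\big),$$ where $L_k=L_k^0$ is the usual Laguerre polynomial.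
   Context: Let $\mathbf{T}=\{\lambda\in\mathbb{C}:|\lambda|=1\}$ and let $G=\mathbf{T}\rtimes\mathbb{C}$ be the group of matrices $[a,b]:=\begin{pmatrix}a&b\\0&1\end{pmatrix}$, $a\in\mathbf{T}$, $b\in\mathbb{C}$, acting on $\mathbb{C}$ by $g\cdot z=az+b$ for $g=[a,b]$. Write $\langle z,w\rangle=z\bar w$; $d\lambda$ is Lebesgue measure on $\mathbb{C}$. Let $(\rho,\tau)$ be an equivariant pair: $\rho:G\to G$ is a group endomorphism and $\tau:\mathbb{C}\to\mathbb{C}$ is a smooth map with $\tau(g\cdot z)=\rho(g)\cdot\tau(z)$ for all $g\in G$, $z\in\mathbb{C}$. Let $\nu,\mu>0$ be real numbers. Set $S^{\nu,\mu}_\tau(z)=\nu z+\mu\big(\tau\frac{\partial\bar\tau}{\partial\bar z}-\bar\tau\frac{\partial\tau}{\partial\bar z}\big)$. The function $B^{\nu,\mu}_\tau=\nu+\mu\big(|\frac{\partial\tau}{\partial z}|^2-|\frac{\partial\tau}{\partial\bar z}|^2\big)$ is a real constant on $\mathbb{C}$. The function $\varphi^{\nu,\mu}_\tau:\mathbb{C}\to\mathbb{R}$ is the real-valued smooth function with $\varphi^{\nu,\mu}_\tau(0)=0$ and $\frac{\partial\varphi^{\nu,\mu}_\tau}{\partial\bar z}=-i\big(S^{\nu,\mu}_\tau-B^{\nu,\mu}_\tau z\big)$. The magnetic Schrödinger operator is, with $\Delta=4\frac{\partial^2}{\partial z\partial\bar z}$, $$\mathfrak{L}^{\nu,\mu}_\tau=-\frac{\partial^2}{\partial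 z\partial\bar z}-\Big(S^{\nu,\mu}_\tau\frac{\partial}{\partial z}-\overline{S^{\nu,\mu}_\tau}\frac{\partial}{\partial\bar z}\Big)+|S^{\nu,\mu}_\tau|^2-\frac{\mu}{4}(\tau\Delta\bar\tau-\bar\tau\Delta\tau).$$ The eigenprojector kernel of $A^{\nu,\mu}_{\tau;k}$ is the integral kernel $K$ of the orthogonal projection $P$ of $L^2(\mathbb{C};d\lambda)$ onto $A^{\nu,\mu}_{\tau;k}$, i.e. $(Pf)(z)=\int_{\mathbb{C}}K(z,w)f(w)\,d\lambda(w)$.
   Formalization: The formal theorem additionally assumes B > 0; for B ≤ 0 (e.g. τ(z) = c·z̄ with μ|c|² ≥ ν) every eigenspace A_k with E_k = B(2k+1) is zero, so the decomposition (i) and the explicit kernel in (ii) fail. *)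

theory Defs
  imports "HOL-Analysis.Analysis" "HOL-Algebra.Group"
begin

section \<open>The group of rigid motions and equivariant pairs\<close>

text \<open>The matrix \<open>[a, b]\<close>, with rows \<open>(a, b)\<close> and \<open>(0, 1)\<close>, is represented by the pair \<open>(a, b)\<close>;
  the multiplication below is that of the matrices.\<close>

definition motion_group :: "(complex \<times> complex) monoid"
  where "motion_group =
    \<lparr>carrier = {g. norm (fst g) = 1},
     mult = (\<lambda>g h. (fst g * fst h, fst g * snd h + snd g)),
     one = (1, 0)\<rparr>"

definition act :: "complex \<times> complex \<Rightarrow> complex \<Rightarrow> complex"
  where "act g z = fst g * z + snd g"

lemma group_motion_group: "group motion_group"
proof (rule groupI)
  fix g assume g: "g \<in> carrier motion_group"
  have "cnj (fst g) * fst g = 1"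
    using g by (simp add: motion_group_def complex_norm_square[symmetric] mult.commute)
  then show "\<exists>h\<in>carrier motion_group. h \<otimes>\<^bsub>motion_group\<^esub> g = \<one>\<^bsub>motion_group\<^esub>"
    using g by (intro bexI[of _ "(cnj (fst g), - cnj (fst g) * snd g)"])
      (auto simp: motion_group_def)
qed (auto simp: motion_group_def norm_mult algebra_simps)

text \<open>\<open>C\<^sup>k\<close> regularity in the sense of real differentiability, on the whole space.
  The domain is meant to be finite dimensional.\<close>

primrec C_diff :: "nat \<Rightarrow> ('a::real_normed_vector \<Rightarrow> 'b::real_normed_vector) \<Rightarrow> bool"
  where
    "C_diff 0 f \<longleftrightarrow> continuous_on UNIV f"
  | "C_diff (Suc n) f \<longleftrightarrow> (\<forall>x. f differentiable (at x)) \<and>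
       (\<forall>v. C_diff n (\<lambda>x. frechet_derivative f (at x) v))"

definition smooth :: "('a::real_normed_vector \<Rightarrow> 'b::real_normed_vector) \<Rightarrow> bool"
  where "smooth f \<longleftrightarrow> (\<forall>n. C_diff n f)"

definition equivariant_pair ::
    "(complex \<times> complex \<Rightarrow> complex \<times> complex) \<Rightarrow> (complex \<Rightarrow> complex) \<Rightarrow> bool"
  where "equivariant_pair \<rho> \<tau> \<longleftrightarrow>
    \<rho> \<in> hom motion_group motion_group \<and> smooth \<tau> \<and>
    (\<forall>g\<in>carrier motion_group. \<forall>z. \<tau> (act g z) = act (\<rho> g) (\<tau> z))"


section \<open>The magnetic Schroedinger operator\<close>

text \<open>The Wirtinger operators \<open>\<partial>/\<partial>z\<close> and \<open>\<partial>/\<partial>\<bar>z\<close>, i.e.\ \<open>(\<partial>\<^sub>x \<mp> i \<partial>\<^sub>y) / 2\<close>.\<close>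

definition dz :: "(complex \<Rightarrow> complex) \<Rightarrow> complex \<Rightarrow> complex"
  where "dz f z = (frechet_derivative f (at z) 1 - \<i> * frechet_derivative f (at z) \<i>) / 2"

definition dzbar :: "(complex \<Rightarrow> complex) \<Rightarrow> complex \<Rightarrow> complex"
  where "dzbar f z = (frechet_derivative f (at z) 1 + \<i> * frechet_derivative f (at z) \<i>) / 2"

definition laplacian :: "(complex \<Rightarrow> complex) \<Rightarrow> complex \<Rightarrow> complex"
  where "laplacian f z = 4 * dz (dzbar f) z"

definition magnetic_S :: "real \<Rightarrow> real \<Rightarrow> (complex \<Rightarrow> complex) \<Rightarrow> complex \<Rightarrow> complex"
  where "magnetic_S \<nu> \<mu> \<tau> z =
    \<nu> * z + \<mu> * (\<tau> z * dzbar (\<lambda>w. cnj (\<tau> w)) z - cnj (\<tau> z) * dzbar \<tau> z)"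

definition magnetic_field :: "real \<Rightarrow> real \<Rightarrow> (complex \<Rightarrow> complex) \<Rightarrow> complex \<Rightarrow> real"
  where "magnetic_field \<nu> \<mu> \<tau> z = \<nu> + \<mu> * ((norm (dz \<tau> z))\<^sup>2 - (norm (dzbar \<tau> z))\<^sup>2)"

text \<open>For an equivariant pair the function above is constant, see
  \<open>magnetic_field_eq\<close> below; this is its value.\<close>

definition magnetic_B :: "real \<Rightarrow> real \<Rightarrow> (complex \<Rightarrow> complex) \<Rightarrow> real"
  where "magnetic_B \<nu> \<mu> \<tau> = magnetic_field \<nu> \<mu> \<tau> 0"

definition is_magnetic_phase ::
    "real \<Rightarrow> real \<Rightarrow> (complex \<Rightarrow> complex) \<Rightarrow> (complex \<Rightarrow> real) \<Rightarrow> bool"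
  where "is_magnetic_phase \<nu> \<mu> \<tau> \<phi> \<longleftrightarrow>
    smooth \<phi> \<and> \<phi> 0 = 0 \<and>
    (\<forall>z::complex. dzbar (\<lambda>w. complex_of_real (\<phi> w)) z = - \<i> * (magnetic_S \<nu> \<mu> \<tau> z - magnetic_B \<nu> \<mu> \<tau> * z))"

text \<open>For an equivariant pair there is exactly one such function, see
  \<open>ex1_magnetic_phase\<close> below.\<close>

definition magnetic_phase :: "real \<Rightarrow> real \<Rightarrow> (complex \<Rightarrow> complex) \<Rightarrow> complex \<Rightarrow> real"
  where "magnetic_phase \<nu> \<mu> \<tau> = (THE \<phi>. is_magnetic_phase \<nu> \<mu> \<tau> \<phi>)"

definition phase_diff :: "real \<Rightarrow> real \<Rightarrow> (complex \<Rightarrow> complex) \<Rightarrow> complex \<Rightarrow> complex \<Rightarrow> real"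
  where "phase_diff \<nu> \<mu> \<tau> z w = magnetic_phase \<nu> \<mu> \<tau> z - magnetic_phase \<nu> \<mu> \<tau> w"

definition magnetic_schroedinger ::
    "real \<Rightarrow> real \<Rightarrow> (complex \<Rightarrow> complex) \<Rightarrow> (complex \<Rightarrow> complex) \<Rightarrow> complex \<Rightarrow> complex"
  where "magnetic_schroedinger \<nu> \<mu> \<tau> F z =
    - dz (dzbar F) z
    - (magnetic_S \<nu> \<mu> \<tau> z * dz F z - cnj (magnetic_S \<nu> \<mu> \<tau> z) * dzbar F z)
    + complex_of_real ((norm (magnetic_S \<nu> \<mu> \<tau> z))\<^sup>2) * F z
    - complex_of_real (\<mu> / 4) * (\<tau> z * laplacian (\<lambda>w. cnj (\<tau> w)) z - cnj (\<tau> z) * laplacian \<tau> z) * F z"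


section \<open>Square integrable functions\<close>

text \<open>The space \<open>L\<^sup>2(\<complex>; d\<lambda>)\<close> is handled through representatives: elements are functions, and two
  functions stand for the same element iff they agree almost everywhere, i.e.\ iff their
  difference has \<open>L\<^sup>2\<close> norm \<open>0\<close>. Every class has a Borel measurable representative.\<close>

definition L2 :: "(complex \<Rightarrow> complex) set"
  where "L2 = {f. f \<in> borel_measurable lborel \<and> integrable lborel (\<lambda>z. (norm (f z))\<^sup>2)}"

definition L2_inner :: "(complex \<Rightarrow> complex) \<Rightarrow> (complex \<Rightarrow> complex) \<Rightarrow> complex"
  where "L2_inner f g = (\<integral>z. f z * cnj (g z) \<partial>lborel)"

definition L2_norm :: "(complex \<Rightarrow> complex) \<Rightarrow> real"
  where "L2_norm f = sqrt (\<integral>z. (norm (f z))\<^sup>2 \<partial>lborel)"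

text \<open>Closedness is closedness of the set of classes: a limit in \<open>L\<^sup>2\<close> of members has a
  representative in the set.\<close>

definition L2_closed_subspace :: "(complex \<Rightarrow> complex) set \<Rightarrow> bool"
  where "L2_closed_subspace A \<longleftrightarrow>
    A \<subseteq> L2 \<and> (\<lambda>z. 0) \<in> A \<and>
    (\<forall>F\<in>A. \<forall>H\<in>A. (\<lambda>z. F z + H z) \<in> A) \<and>
    (\<forall>c. \<forall>F\<in>A. (\<lambda>z. c * F z) \<in> A) \<and>
    (\<forall>F f. (\<forall>n. F n \<in> A) \<and> f \<in> L2 \<and> (\<lambda>n. L2_norm (\<lambda>z. F n z - f z)) \<longlonglongrightarrow> 0
       \<longrightarrow> (\<exists>H\<in>A. AE z in lborel. f z = H z))"

definition L2_orthogonal_decomposition :: "(nat \<Rightarrow> (complex \<Rightarrow> complex) set) \<Rightarrow> bool"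
  where "L2_orthogonal_decomposition A \<longleftrightarrow>
    (\<forall>k. L2_closed_subspace (A k)) \<and>
    (\<forall>j k. j \<noteq> k \<longrightarrow> (\<forall>F\<in>A j. \<forall>H\<in>A k. L2_inner F H = 0)) \<and>
    (\<forall>f\<in>L2. \<exists>F. (\<forall>k. F k \<in> A k) \<and>
       (\<lambda>n. L2_norm (\<lambda>z. f z - (\<Sum>k<n. F k z))) \<longlonglongrightarrow> 0)"

definition is_orthogonal_projection ::
    "(complex \<Rightarrow> complex) set \<Rightarrow> (complex \<Rightarrow> complex) \<Rightarrow> (complex \<Rightarrow> complex) \<Rightarrow> bool"
  where "is_orthogonal_projection A f h \<longleftrightarrow>
    h \<in> A \<and> (\<forall>F\<in>A. L2_inner (\<lambda>z. f z - h z) F = 0)"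

text \<open>An integral kernel is only determined up to null sets; pointwise statements about it refer
  to the continuous kernel.\<close>

definition is_projection_kernel ::
    "(complex \<Rightarrow> complex) set \<Rightarrow> (complex \<Rightarrow> complex \<Rightarrow> complex) \<Rightarrow> bool"
  where "is_projection_kernel A K \<longleftrightarrow>
    continuous_on UNIV (\<lambda>(z, w). K z w) \<and>
    (\<forall>f\<in>L2. (\<forall>z. integrable lborel (\<lambda>w. K z w * f w)) \<and>
       is_orthogonal_projection A f (\<lambda>z. \<integral>w. K z w * f w \<partial>lborel))"


section \<open>Eigenspaces and Laguerre polynomials\<close>

definition eigenvalue :: "real \<Rightarrow> real \<Rightarrow> (complex \<Rightarrow> complex) \<Rightarrow> nat \<Rightarrow> real"
  where "eigenvalue \<nu> \<mu> \<tau> k = magnetic_B \<nu> \<mu> \<tau> * (2 * real k + 1)"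

text \<open>The eigenvalue equation is that of classical, i.e.\ \<open>C\<^sup>2\<close>, functions. The operator being
  elliptic with smooth coefficients, every distributional solution in \<open>L\<^sup>2\<close> has such a (even
  smooth) representative.\<close>

definition eigenspace ::
    "real \<Rightarrow> real \<Rightarrow> (complex \<Rightarrow> complex) \<Rightarrow> nat \<Rightarrow> (complex \<Rightarrow> complex) set"
  where "eigenspace \<nu> \<mu> \<tau> k =
    {F \<in> L2. C_diff 2 F \<and>
       (\<forall>z. magnetic_schroedinger \<nu> \<mu> \<tau> F z = eigenvalue \<nu> \<mu> \<tau> k * F z)}"

definition laguerre :: "nat \<Rightarrow> real \<Rightarrow> real"
  where "laguerre k x = (\<Sum>j\<le>k. (- 1) ^ j * real (k choose j) / fact j * x ^ j)"


section \<open>The magnetic field is constant and the phase function exists\<close>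

lemma C_diff_SucI:
  assumes "\<And>x. (f has_derivative f' x) (at x)" and "\<And>v. C_diff n (\<lambda>x. f' x v)"
  shows "C_diff (Suc n) f"
proof -
  have "frechet_derivative f (at x) = f' x" for x
    using frechet_derivative_at[OF assms(1)] by simp
  then show ?thesis
    using assms by (auto simp: differentiable_def)
qed

lemma C_diff_has_derivative:
  "C_diff (Suc n) f \<Longrightarrow> (f has_derivative frechet_derivative f (at x)) (at x)"
  by (simp add: frechet_derivative_works)

lemma C_diff_Suc_imp: "C_diff (Suc n) f \<Longrightarrow> C_diff n f"
proof (induction n arbitrary: f)
  case 0
  then show ?case
    by (simp add: continuous_on_eq_continuous_at differentiable_imp_continuous_within)
next
  case (Suc n)
  then show ?case by simp
qed

lemma C_diff_const: "C_diff n (\<lambda>x. c)"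
  by (induction n arbitrary: c) (auto simp: differentiable_def)

lemma C_diff_bounded_linear:
  assumes "bounded_linear L"
  shows "C_diff n f \<Longrightarrow> C_diff n (\<lambda>x. L (f x))"
proof (induction n arbitrary: f)
  case 0
  then show ?case using assms by (simp add: bounded_linear.continuous_on)
next
  case (Suc n)
  show ?case
    by (rule C_diff_SucI[OF bounded_linear.has_derivative[OF assms C_diff_has_derivative[OF Suc.prems]]])
      (use Suc in simp)
qed

lemma C_diff_id: "C_diff n (\<lambda>x. x)"
  by (cases n) (auto simp: C_diff_const intro!: C_diff_SucI[where f' = "\<lambda>_ v. v"])

lemma C_diff_add: "C_diff n f \<Longrightarrow> C_diff n g \<Longrightarrow> C_diff n (\<lambda>x. f x + g x)"
proof (induction n arbitrary: f g)
  case 0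
  then show ?case by (simp add: continuous_on_add)
next
  case (Suc n)
  show ?case
    by (rule C_diff_SucI[OF has_derivative_add[OF C_diff_has_derivative C_diff_has_derivative]])
      (use Suc in auto)
qed

lemma C_diff_mult:
  fixes f g :: "_ \<Rightarrow> 'a::real_normed_algebra"
  shows "C_diff n f \<Longrightarrow> C_diff n g \<Longrightarrow> C_diff n (\<lambda>x. f x * g x)"
proof (induction n arbitrary: f g)
  case 0
  then show ?case by (simp add: continuous_on_mult)
next
  case (Suc n)
  note n = Suc.prems[THEN C_diff_Suc_imp]
  show ?case
    by (rule C_diff_SucI[OF has_derivative_mult[OF C_diff_has_derivative C_diff_has_derivative]])
      (use Suc n in \<open>auto intro!: C_diff_add\<close>)
qed

lemma smooth_derivative: "smooth f \<Longrightarrow> smooth (\<lambda>x. frechet_derivative f (at x) v)"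
  unfolding smooth_def by (metis C_diff.simps(2))

lemma smooth_has_derivative: "smooth f \<Longrightarrow> (f has_derivative frechet_derivative f (at x)) (at x)"
  unfolding smooth_def using C_diff_has_derivative by blast

lemma smooth_continuous: "smooth f \<Longrightarrow> continuous_on A f"
  unfolding smooth_def by (metis C_diff.simps(1) continuous_on_subset subset_UNIV)

lemma smooth_intros:
  "smooth (\<lambda>x. c)" "smooth (\<lambda>x. x)" "smooth f \<Longrightarrow> bounded_linear L \<Longrightarrow> smooth (\<lambda>x. L (f x))"
  "smooth f \<Longrightarrow> smooth g \<Longrightarrow> smooth (\<lambda>x. f x + g x)"
  "smooth p \<Longrightarrow> smooth q \<Longrightarrow> smooth (\<lambda>x. p x * q x)" for p q :: "_ \<Rightarrow> 'c::real_normed_algebra"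
  unfolding smooth_def
  using C_diff_const C_diff_id C_diff_bounded_linear C_diff_add C_diff_mult by blast+

lemma smooth_minus: "smooth f \<Longrightarrow> smooth (\<lambda>x. - f x)"
  by (rule smooth_intros(3)[where L = uminus]) (auto intro: bounded_linear_minus[OF bounded_linear_ident])

lemma smooth_diff: "smooth f \<Longrightarrow> smooth g \<Longrightarrow> smooth (\<lambda>x. f x - g x)"
  using smooth_intros(4)[of f "\<lambda>x. - g x"] smooth_minus[of g] by simp

lemma smooth_cnj: "smooth f \<Longrightarrow> smooth (\<lambda>x. cnj (f x))"
  by (rule smooth_intros(3)[where L = cnj]) (auto intro: bounded_linear_cnj)

lemma smooth_dz: assumes "smooth f" shows "smooth (dz f)" "smooth (dzbar f)"
proof -
  have *: "dz f = (\<lambda>z. (1/2) * (frechet_derivative f (at z) 1 - \<i> * frechet_derivative f (at z) \<i>))"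
    "dzbar f = (\<lambda>z. (1/2) * (frechet_derivative f (at z) 1 + \<i> * frechet_derivative f (at z) \<i>))"
    by (auto simp: dz_def dzbar_def)
  show "smooth (dz f)" "smooth (dzbar f)"
    unfolding * by (intro smooth_intros(1,2,4,5) smooth_diff smooth_derivative assms)+
qed

lemma wirtinger_derivative:
  assumes "f differentiable (at z)"
  shows "(f has_derivative (\<lambda>v. dz f z * v + dzbar f z * cnj v)) (at z)"
proof -
  define D where "D = frechet_derivative f (at z)"
  have D: "(f has_derivative D) (at z)" using assms by (simp add: D_def frechet_derivative_works)
  then have lin: "linear D" using has_derivative_linear by blast
  have "D v = dz f z * v + dzbar f z * cnj v" for v
  proof -
    have "D v = D (Re v *\<^sub>R 1 + Im v *\<^sub>R \<i>)"
      by (rule arg_cong[where f = D]) (simp add: complex_eq_iff)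
    also have "\<dots> = Re v *\<^sub>R D 1 + Im v *\<^sub>R D \<i>" 
      using linear_add[OF lin] linear_scale[OF lin] by simp
    also have "\<dots> = dz f z * v + dzbar f z * cnj v"
      unfolding dz_def dzbar_def D_def[symmetric]
      by (simp add: complex_eq_iff field_simps)
    finally show ?thesis .
  qed
  then have "D = (\<lambda>v. dz f z * v + dzbar f z * cnj v)" by blast
  then show ?thesis using D by metis
qed

lemma dz_eqI:
  assumes "(f has_derivative (\<lambda>v. a * v + b * cnj v)) (at z)"
  shows "dz f z = a" "dzbar f z = b"
proof -
  have "frechet_derivative f (at z) = (\<lambda>v. a * v + b * cnj v)"
    using frechet_derivative_at[OF assms] by simp
  then show "dz f z = a" "dzbar f z = b" unfolding dz_def dzbar_def
    by (auto simp: algebra_simps)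
qed

lemma dz_cnj:
  assumes "f differentiable (at z)"
  shows "dz (\<lambda>w. cnj (f w)) z = cnj (dzbar f z)" "dzbar (\<lambda>w. cnj (f w)) z = cnj (dz f z)"
proof -
  have "((\<lambda>w. cnj (f w)) has_derivative (\<lambda>v. cnj (dzbar f z) * v + cnj (dz f z) * cnj v)) (at z)"
    using bounded_linear.has_derivative[OF bounded_linear_cnj wirtinger_derivative[OF assms]]
    by (simp add: add.commute)
  from dz_eqI[OF this] show "dz (\<lambda>w. cnj (f w)) z = cnj (dzbar f z)" "dzbar (\<lambda>w. cnj (f w)) z = cnj (dz f z)" by auto
qed

lemma dz_mult:
  assumes "f differentiable (at z)" "g differentiable (at z)"
  shows "dz (\<lambda>w. f w * g w) z = dz f z * g z + f z * dz g z"
    "dzbar (\<lambda>w. f w * g w) z = dzbar f z * g z + f z * dzbar g z"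
proof -
  have "((\<lambda>w. f w * g w) has_derivative 
    (\<lambda>v. (dz f z * g z + f z * dz g z) * v + (dzbar f z * g z + f z * dzbar g z) * cnj v)) (at z)"
    by (rule has_derivative_eq_rhs[OF has_derivative_mult[OF assms[THEN wirtinger_derivative]]])
      (simp add: fun_eq_iff algebra_simps)
  from dz_eqI[OF this] show "dz (\<lambda>w. f w * g w) z = dz f z * g z + f z * dz g z"
    "dzbar (\<lambda>w. f w * g w) z = dzbar f z * g z + f z * dzbar g z" by auto
qed

lemma dz_diff:
  assumes "f differentiable (at z)" "g differentiable (at z)"
  shows "dz (\<lambda>w. f w - g w) z = dz f z - dz g z"
proof -
  have "((\<lambda>w. f w - g w) has_derivative 
    (\<lambda>v. (dz f z - dz g z) * v + (dzbar f z - dzbar g z) * cnj v)) (at z)"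
    by (rule has_derivative_eq_rhs[OF has_derivative_diff[OF assms[THEN wirtinger_derivative]]])
      (simp add: fun_eq_iff algebra_simps)
  from dz_eqI[OF this] show ?thesis by auto
qed

lemma dz_add:
  assumes "f differentiable (at z)" "g differentiable (at z)"
  shows "dz (\<lambda>w. f w + g w) z = dz f z + dz g z"
proof -
  have "((\<lambda>w. f w + g w) has_derivative 
    (\<lambda>v. (dz f z + dz g z) * v + (dzbar f z + dzbar g z) * cnj v)) (at z)"
    by (rule has_derivative_eq_rhs[OF has_derivative_add[OF assms[THEN wirtinger_derivative]]])
      (simp add: fun_eq_iff algebra_simps)
  from dz_eqI[OF this] show ?thesis by auto
qed

lemma magnetic_field_eq:
  assumes "equivariant_pair \<rho> \<tau>"
  shows "magnetic_field \<nu> \<mu> \<tau> z = magnetic_B \<nu> \<mu> \<tau>"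
proof -
  have diff: "\<tau> differentiable (at w)" for w
    using assms smooth_has_derivative unfolding equivariant_pair_def differentiable_def by blast
  have b: "(1, z) \<in> carrier motion_group" by (simp add: motion_group_def)
  define a d where "a = fst (\<rho> (1, z))" and "d = snd (\<rho> (1, z))"
  have a: "norm a = 1"
    using assms b unfolding equivariant_pair_def a_def by (auto simp: hom_def motion_group_def)
  have eq: "\<tau> (w + z) = a * \<tau> w + d" for w
    using assms b unfolding equivariant_pair_def a_def d_def
    by (fastforce simp: act_def)
  have "((\<lambda>w. \<tau> (w + z)) has_derivative (\<lambda>v. dz \<tau> z * v + dzbar \<tau> z * cnj v)) (at 0)"
    by (rule has_derivative_compose[where g = \<tau> and f = "\<lambda>w. w + z" and f' = "\<lambda>v. v"])
      (use wirtinger_derivative[OF diff[of z]] in \<open>auto intro!: derivative_eq_intros\<close>)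
  moreover have "((\<lambda>w. \<tau> (w + z)) has_derivative (\<lambda>v. (a * dz \<tau> 0) * v + (a * dzbar \<tau> 0) * cnj v)) (at 0)"
    unfolding eq by (rule has_derivative_eq_rhs, (rule derivative_intros wirtinger_derivative diff)+)
      (simp add: algebra_simps)
  ultimately have "dz \<tau> z = a * dz \<tau> 0" "dzbar \<tau> z = a * dzbar \<tau> 0"
    using dz_eqI by metis+
  then show ?thesis using a by (simp add: magnetic_field_def magnetic_B_def norm_mult)
qed

lemma smooth_chain:
  fixes f :: "'a::real_normed_vector \<Rightarrow> 'b::real_normed_vector" and p :: "real \<Rightarrow> 'a"
  assumes "smooth f" "(p has_vector_derivative p') (at t within A)"
  shows "((\<lambda>t. f (p t)) has_vector_derivative frechet_derivative f (at (p t)) p') (at t within A)"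
proof -
  have lin: "linear (frechet_derivative f (at (p t)))"
    using smooth_has_derivative[OF assms(1)] has_derivative_linear by blast
  show ?thesis
    using has_derivative_compose[OF assms(2)[unfolded has_vector_derivative_def] smooth_has_derivative[OF assms(1)]]
    by (simp add: has_vector_derivative_def linear_scale[OF lin])
qed

lemma smooth_mixed_derivatives:
  fixes f :: "'a::real_normed_vector \<Rightarrow> complex"
  assumes f: "smooth f"
  shows "frechet_derivative (\<lambda>w. frechet_derivative f (at w) u) (at z) v =
    frechet_derivative (\<lambda>w. frechet_derivative f (at w) v) (at z) u"
proof -
  define fu fv where "fu = (\<lambda>w. frechet_derivative f (at w) u)"
    and "fv = (\<lambda>w. frechet_derivative f (at w) v)"
  define fuv where "fuv = (\<lambda>w. frechet_derivative fu (at w) v)"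
  have sm: "smooth fu" "smooth fv" "smooth fuv"
    unfolding fu_def fv_def fuv_def by (intro smooth_derivative f)+
  have cont: "continuous_on X fu" "continuous_on X fuv" for X
    using sm smooth_continuous by auto
  have int: "integral {0..s} (\<lambda>\<sigma>. fuv (z + \<sigma> *\<^sub>R u)) = fv (z + s *\<^sub>R u) - fv z" if s: "0 \<le> s" for s
  proof -
    have I: "integral (cbox 0 s) (\<lambda>\<sigma>. fu (z + \<sigma> *\<^sub>R u + y *\<^sub>R v)) = f (z + s *\<^sub>R u + y *\<^sub>R v) - f (z + y *\<^sub>R v)" for y
    proof -
      have "((\<lambda>\<sigma>. fu (z + \<sigma> *\<^sub>R u + y *\<^sub>R v)) has_integral
          (f (z + s *\<^sub>R u + y *\<^sub>R v) - f (z + 0 *\<^sub>R u + y *\<^sub>R v))) {0..s}"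
        unfolding fu_def
        by (rule fundamental_theorem_of_calculus[OF s])
          (auto intro!: smooth_chain[OF f] derivative_eq_intros)
      then show ?thesis by (simp add: integral_unique)
    qed
    have "((\<lambda>y. integral (cbox 0 s) (\<lambda>\<sigma>. fu (z + \<sigma> *\<^sub>R u + y *\<^sub>R v))) has_vector_derivative
        integral (cbox 0 s) (\<lambda>\<sigma>. fuv (z + \<sigma> *\<^sub>R u + 0 *\<^sub>R v))) (at 0 within UNIV)"
    proof (rule leibniz_rule_vector_derivative[where fx = "\<lambda>y \<sigma>. fuv (z + \<sigma> *\<^sub>R u + y *\<^sub>R v)"])
      show "((\<lambda>y. fu (z + t *\<^sub>R u + y *\<^sub>R v)) has_vector_derivative fuv (z + t *\<^sub>R u + y *\<^sub>R v)) (at y within UNIV)" for y t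
        unfolding fuv_def by (rule smooth_chain[OF sm(1)]) (auto intro!: derivative_eq_intros)
      show "(\<lambda>\<sigma>. fu (z + \<sigma> *\<^sub>R u + y *\<^sub>R v)) integrable_on cbox 0 s" for y
        by (intro integrable_continuous continuous_on_compose2[OF cont(1)[of UNIV]] continuous_intros) auto
      show "continuous_on (UNIV \<times> cbox 0 s) (\<lambda>(y, \<sigma>). fuv (z + \<sigma> *\<^sub>R u + y *\<^sub>R v))"
        unfolding split_beta
        by (intro continuous_on_compose2[OF cont(2)[of UNIV]] continuous_intros) auto
    qed auto
    moreover have "((\<lambda>y. f (z + s *\<^sub>R u + y *\<^sub>R v) - f (z + y *\<^sub>R v)) has_vector_derivative
        fv (z + s *\<^sub>R u + 0 *\<^sub>R v) - fv (z + 0 *\<^sub>R v)) (at 0)"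
      unfolding fv_def
      by (intro has_vector_derivative_diff smooth_chain[OF f]) (auto intro!: derivative_eq_intros)
    ultimately show ?thesis
      unfolding I using vector_derivative_unique_at by fastforce
  qed
  have "((\<lambda>s. integral {0..s} (\<lambda>\<sigma>. fuv (z + \<sigma> *\<^sub>R u))) has_vector_derivative fuv (z + 0 *\<^sub>R u)) (at 0 within {0..1})"
    by (rule integral_has_vector_derivative)
      (auto intro!: continuous_on_compose2[OF cont(2)[of UNIV]] continuous_intros)
  then have "((\<lambda>s. integral {0..s} (\<lambda>\<sigma>. fuv (z + \<sigma> *\<^sub>R u))) has_vector_derivative fuv z) (at 0 within {0..1})"
    by simp
  then have 1: "((\<lambda>s. fv (z + s *\<^sub>R u) - fv z) has_vector_derivative fuv z) (at 0 within {0..1})"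
    by (rule has_vector_derivative_transform[rotated 2]) (auto simp: int)
  have 2: "((\<lambda>s. fv (z + s *\<^sub>R u) - fv z) has_vector_derivative
      frechet_derivative fv (at (z + 0 *\<^sub>R u)) u - 0) (at 0 within {0..1})"
    by (intro has_vector_derivative_diff smooth_chain[OF sm(2)]) (auto intro!: derivative_eq_intros)
  have "fuv z = frechet_derivative fv (at z) u"
    using vector_derivative_unique_within_closed_interval[of 0 1 0, unfolded cbox_interval, OF _ _ 1 2] by simp
  then show ?thesis by (simp add: fuv_def fu_def fv_def)
qed

lemma dz_dzbar_commute:
  assumes "smooth f"
  shows "dz (dzbar f) z = dzbar (dz f) z"
proof -
  let ?x = "\<lambda>z. frechet_derivative f (at z) 1" and ?y = "\<lambda>z. frechet_derivative f (at z) \<i>"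
  have x: "(?x has_derivative frechet_derivative ?x (at z)) (at z)"
    and y: "(?y has_derivative frechet_derivative ?y (at z)) (at z)"
    by (intro smooth_has_derivative smooth_derivative assms)+
  have "((\<lambda>z. (?x z - \<i> * ?y z) / 2) has_derivative
      (\<lambda>v. (frechet_derivative ?x (at z) v - \<i> * frechet_derivative ?y (at z) v) / 2)) (at z)"
    by (intro bounded_linear.has_derivative[OF bounded_linear_divide] has_derivative_add
        has_derivative_diff bounded_linear.has_derivative[OF bounded_linear_mult_right] x y)
  from frechet_derivative_at[OF this, symmetric]
  have 1: "frechet_derivative (dz f) (at z) = (\<lambda>v. (frechet_derivative ?x (at z) v - \<i> * frechet_derivative ?y (at z) v) / 2)"
    by (simp add: dz_def[abs_def])
  have "((\<lambda>z. (?x z + \<i> * ?y z) / 2) has_derivative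
      (\<lambda>v. (frechet_derivative ?x (at z) v + \<i> * frechet_derivative ?y (at z) v) / 2)) (at z)"
    by (intro bounded_linear.has_derivative[OF bounded_linear_divide] has_derivative_add
        has_derivative_diff bounded_linear.has_derivative[OF bounded_linear_mult_right] x y)
  from frechet_derivative_at[OF this, symmetric]
  have 2: "frechet_derivative (dzbar f) (at z) = (\<lambda>v. (frechet_derivative ?x (at z) v + \<i> * frechet_derivative ?y (at z) v) / 2)"
    by (simp add: dzbar_def[abs_def])
  show ?thesis
    unfolding dz_def[of "dzbar f"] dzbar_def[of "dz f"] 1 2
    using smooth_mixed_derivatives[OF assms, of 1 z \<i>]
    by (simp add: field_simps)
qed

lemma dzbar_of_real_iff:
  fixes \<phi> :: "complex \<Rightarrow> real"
  assumes "(\<phi> has_derivative D) (at z)"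
  shows "dzbar (\<lambda>w. complex_of_real (\<phi> w)) z = h \<longleftrightarrow> D = (\<lambda>v. 2 * Re (cnj h * v))"
proof -
  have "((\<lambda>w. complex_of_real (\<phi> w)) has_derivative (\<lambda>v. complex_of_real (D v))) (at z)"
    by (rule bounded_linear.has_derivative[OF bounded_linear_of_real assms])
  from frechet_derivative_at[OF this, symmetric]
  have *: "dzbar (\<lambda>w. complex_of_real (\<phi> w)) z = Complex (D 1 / 2) (D \<i> / 2)"
    by (simp add: dzbar_def complex_eq_iff)
  have lin: "linear D" using assms has_derivative_linear by blast
  have D: "D v = Re v * D 1 + Im v * D \<i>" for v
  proof -
    have "D v = D (Re v *\<^sub>R 1 + Im v *\<^sub>R \<i>)"
      by (rule arg_cong[where f = D]) (simp add: complex_eq_iff)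
    then show ?thesis using linear_add[OF lin] linear_scale[OF lin] by simp
  qed
  show ?thesis
  proof
    assume "dzbar (\<lambda>w. complex_of_real (\<phi> w)) z = h"
    then show "D = (\<lambda>v. 2 * Re (cnj h * v))"
      unfolding * by (intro ext, subst D) auto
  next
    assume "D = (\<lambda>v. 2 * Re (cnj h * v))"
    then show "dzbar (\<lambda>w. complex_of_real (\<phi> w)) z = h"
      unfolding * by (simp add: complex_eq_iff)
  qed
qed

lemma smooth_potential:
  assumes h: "smooth h" and closed: "\<And>z. Im (dz h z) = 0"
  shows "\<exists>\<phi>. \<phi> 0 = 0 \<and> (\<forall>z. (\<phi> has_derivative (\<lambda>v. 2 * Re (cnj (h z) * v))) (at z))"
proof -
  define hx hy where "hx = (\<lambda>w. frechet_derivative h (at w) 1)"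
    and "hy = (\<lambda>w. frechet_derivative h (at w) \<i>)"
  have Dh: "frechet_derivative h (at w) v = Re v *\<^sub>R hx w + Im v *\<^sub>R hy w" for w v
  proof -
    have lin: "linear (frechet_derivative h (at w))"
      using smooth_has_derivative[OF h] has_derivative_linear by blast
    have "frechet_derivative h (at w) v = frechet_derivative h (at w) (Re v *\<^sub>R 1 + Im v *\<^sub>R \<i>)"
      by (rule arg_cong[where f = "frechet_derivative h (at w)"]) (simp add: complex_eq_iff)
    then show ?thesis
      using linear_add[OF lin] linear_scale[OF lin] by (simp add: hx_def hy_def)
  qed
  have cl: "Re (hy w) = Im (hx w)" for w
    using closed[of w] by (simp add: dz_def hx_def hy_def)
  have cont: "continuous_on X h" "continuous_on X hx" "continuous_on X hy" for X
    unfolding hx_def hy_def by (intro smooth_continuous smooth_derivative h)+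
  note [continuous_intros] = continuous_on_compose2[OF cont(1)[of UNIV]]
    continuous_on_compose2[OF cont(2)[of UNIV]] continuous_on_compose2[OF cont(3)[of UNIV]]
  define P Q where "P = (\<lambda>(z, t). 2 * Re (h (t *\<^sub>R z) + cnj z * t * hx (t *\<^sub>R z)))"
    and "Q = (\<lambda>(z, t). 2 * Re (- \<i> * h (t *\<^sub>R z) + cnj z * t * hy (t *\<^sub>R z)))"
  have PQ: "continuous_on X P" "continuous_on X Q" for X
    unfolding P_def Q_def split_beta by (intro continuous_intros; auto)+
  define bR bI where "bR = Blinfun Re" and "bI = Blinfun Im"
  have b: "blinfun_apply bR = Re" "blinfun_apply bI = Im"
    unfolding bR_def bI_def by (simp_all add: bounded_linear_Blinfun_apply bounded_linear_Re bounded_linear_Im)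
  define fx where "fx = (\<lambda>z t. P (z, t) *\<^sub>R bR + Q (z, t) *\<^sub>R bI)"
  define \<phi> where "\<phi> = (\<lambda>z. integral (cbox 0 (1::real)) (\<lambda>t. 2 * Re (cnj z * h (t *\<^sub>R z))))"
  have "(\<phi> has_derivative (\<lambda>v. 2 * Re (cnj (h z) * v))) (at z)" for z
  proof -
    have "(\<phi> has_derivative integral (cbox 0 (1::real)) (fx z)) (at z within UNIV)"
      unfolding \<phi>_def
    proof (rule leibniz_rule)
      fix z and t :: real
      have "((\<lambda>z. h (t *\<^sub>R z)) has_derivative (\<lambda>v. frechet_derivative h (at (t *\<^sub>R z)) (t *\<^sub>R v))) (at z)"
        by (rule has_derivative_compose[OF _ smooth_has_derivative[OF h]]) (auto intro!: derivative_eq_intros)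
      then have "((\<lambda>z. 2 * Re (cnj z * h (t *\<^sub>R z))) has_derivative
          (\<lambda>v. 2 * Re (cnj z * frechet_derivative h (at (t *\<^sub>R z)) (t *\<^sub>R v) + cnj v * h (t *\<^sub>R z)))) (at z)"
        by (auto intro!: derivative_eq_intros)
      moreover have "(\<lambda>v. 2 * Re (cnj z * frechet_derivative h (at (t *\<^sub>R z)) (t *\<^sub>R v) + cnj v * h (t *\<^sub>R z))) = blinfun_apply (fx z t)"
        by (intro ext) (simp add: fx_def b P_def Q_def Dh blinfun.bilinear_simps algebra_simps)
      ultimately show "((\<lambda>z. 2 * Re (cnj z * h (t *\<^sub>R z))) has_derivative blinfun_apply (fx z t)) (at z within UNIV)"
        by simp
    next
      show "(\<lambda>t. 2 * Re (cnj z * h (t *\<^sub>R z))) integrable_on cbox 0 1" for z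
        by (intro integrable_continuous continuous_intros) auto
      show "continuous_on (UNIV \<times> cbox 0 1) (\<lambda>(z, t). fx z t)"
        unfolding fx_def split_beta by (intro continuous_intros PQ) (auto simp: PQ)
    qed auto
    moreover have "integral (cbox 0 (1::real)) (fx z) = (2 * Re (h z)) *\<^sub>R bR + (2 * Im (h z)) *\<^sub>R bI"
    proof -
      have ch: "((\<lambda>t. h (t *\<^sub>R z)) has_vector_derivative frechet_derivative h (at (t *\<^sub>R z)) z) (at t within {0..1})" for t
        by (rule smooth_chain[OF h]) (auto intro!: derivative_eq_intros)
      have "((\<lambda>t. t *\<^sub>R h (t *\<^sub>R z)) has_vector_derivative
          t *\<^sub>R frechet_derivative h (at (t *\<^sub>R z)) z + h (t *\<^sub>R z)) (at t within {0..1})" for t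
        using has_vector_derivative_scaleR[OF DERIV_ident ch] by simp
      then have "((\<lambda>t. t *\<^sub>R frechet_derivative h (at (t *\<^sub>R z)) z + h (t *\<^sub>R z)) has_integral
          1 *\<^sub>R h (1 *\<^sub>R z) - 0 *\<^sub>R h (0 *\<^sub>R z)) {0..1}"
        by (intro fundamental_theorem_of_calculus) auto
      then have I: "((\<lambda>t. t *\<^sub>R frechet_derivative h (at (t *\<^sub>R z)) z + h (t *\<^sub>R z)) has_integral h z) (cbox 0 1)"
        by simp
      have "((\<lambda>t. (2 * Re (t *\<^sub>R frechet_derivative h (at (t *\<^sub>R z)) z + h (t *\<^sub>R z))) *\<^sub>R bR +
          (2 * Im (t *\<^sub>R frechet_derivative h (at (t *\<^sub>R z)) z + h (t *\<^sub>R z))) *\<^sub>R bI) has_integral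
          (2 * Re (h z)) *\<^sub>R bR + (2 * Im (h z)) *\<^sub>R bI) (cbox 0 1)"
        by (intro has_integral_add has_integral_scaleR_left has_integral_mult_right
            has_integral_linear[OF I bounded_linear_Re, unfolded o_def]
            has_integral_linear[OF I bounded_linear_Im, unfolded o_def])
      moreover have "(2 * Re (t *\<^sub>R frechet_derivative h (at (t *\<^sub>R z)) z + h (t *\<^sub>R z))) *\<^sub>R bR +
          (2 * Im (t *\<^sub>R frechet_derivative h (at (t *\<^sub>R z)) z + h (t *\<^sub>R z))) *\<^sub>R bI = fx z t" for t
        unfolding fx_def P_def Q_def by (simp add: Dh cl algebra_simps)
      ultimately show ?thesis by (simp add: integral_unique)
    qed
    moreover have "blinfun_apply ((2 * Re (h z)) *\<^sub>R bR + (2 * Im (h z)) *\<^sub>R bI) = (\<lambda>v. 2 * Re (cnj (h z) * v))"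
      by (intro ext) (simp add: b blinfun.bilinear_simps algebra_simps)
    ultimately show ?thesis by simp
  qed
  moreover have "\<phi> 0 = 0" by (simp add: \<phi>_def)
  ultimately show ?thesis by blast
qed

lemma ex1_magnetic_phase:
  assumes "equivariant_pair \<rho> \<tau>"
  shows "\<exists>!\<phi>. is_magnetic_phase \<nu> \<mu> \<tau> \<phi>"
proof -
  have \<tau>: "smooth \<tau>" using assms by (simp add: equivariant_pair_def)
  define T where "T = (\<lambda>z. \<tau> z * dzbar (\<lambda>w. cnj (\<tau> w)) z - cnj (\<tau> z) * dzbar \<tau> z)"
  define B where "B = complex_of_real (magnetic_B \<nu> \<mu> \<tau>)"
  define h where "h = (\<lambda>z. (- \<i> * (\<nu> - B)) * z + (- \<i> * \<mu>) * T z)"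
  have h_eq: "h z = - \<i> * (magnetic_S \<nu> \<mu> \<tau> z - B * z)" for z
    by (simp add: h_def T_def magnetic_S_def algebra_simps)
  have df: "f differentiable (at z)" if "smooth f" for f :: "complex \<Rightarrow> complex" and z
    using smooth_has_derivative[OF that] differentiable_def by blast
  note sm = \<tau> smooth_dz[OF \<tau>] smooth_cnj[OF \<tau>] smooth_dz[OF smooth_cnj[OF \<tau>]]
  have T: "smooth T" unfolding T_def by (intro smooth_diff smooth_intros(5) sm)
  have h: "smooth h" unfolding h_def by (intro smooth_intros(1,2,4,5) T)
  have id: "dz (\<lambda>w. w) z = 1" for z by (rule dz_eqI[where b = 0]) (auto intro!: derivative_eq_intros)
  have const: "dz (\<lambda>w. c) z = 0" for c z by (rule dz_eqI[where b = 0]) (auto intro!: derivative_eq_intros)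
  have "dz T z = cnj (dz \<tau> z) * dz \<tau> z - cnj (dzbar \<tau> z) * dzbar \<tau> z
      + (\<tau> z * cnj (dz (dzbar \<tau>) z) - cnj (\<tau> z) * dz (dzbar \<tau>) z)" for z
  proof -
    have T_eq: "T = (\<lambda>z. \<tau> z * cnj (dz \<tau> z) - cnj (\<tau> z) * dzbar \<tau> z)"
      unfolding T_def using dz_cnj(2)[OF df[OF \<tau>]] by simp
    have 1: "smooth (\<lambda>z. \<tau> z * cnj (dz \<tau> z))" "smooth (\<lambda>z. cnj (\<tau> z) * dzbar \<tau> z)"
      by (intro smooth_intros(5) smooth_cnj sm)+
    show ?thesis
      unfolding T_eq
      by (simp add: dz_diff[OF 1[THEN df]] dz_mult[OF df df] dz_cnj[OF df] sm smooth_cnj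
          dz_dzbar_commute[OF \<tau>] algebra_simps)
  qed
  then have "Re (dz T z) = (norm (dz \<tau> z))\<^sup>2 - (norm (dzbar \<tau> z))\<^sup>2" for z
    unfolding cmod_power2 by (simp add: power2_eq_square)
  moreover have "dz h z = - \<i> * (\<nu> - B) - \<i> * \<mu> * dz T z" for z
  proof -
    define c d where "c = - \<i> * (\<nu> - B)" and "d = - \<i> * complex_of_real \<mu>"
    have 1: "smooth (\<lambda>z. c * z)" "smooth (\<lambda>z. d * T z)"
      by (intro smooth_intros(1,2,5) T)+
    have "dz (\<lambda>z. c * z + d * T z) z = c + d * dz T z"
      by (simp add: dz_add[OF 1[THEN df]] dz_mult(1)[OF df df] id const smooth_intros(1,2) T)
    then show ?thesis unfolding h_def c_def d_def by simp
  qed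
  ultimately have "Im (dz h z) = - (\<nu> + \<mu> * ((norm (dz \<tau> z))\<^sup>2 - (norm (dzbar \<tau> z))\<^sup>2) - magnetic_B \<nu> \<mu> \<tau>)" for z
    by (simp add: B_def)
  then have closed: "Im (dz h z) = 0" for z
    using magnetic_field_eq[OF assms, of \<nu> \<mu> z] by (simp add: magnetic_field_def)
  obtain \<phi> where \<phi>: "\<phi> 0 = 0" "\<And>z. (\<phi> has_derivative (\<lambda>v. 2 * Re (cnj (h z) * v))) (at z)"
    using smooth_potential[OF h closed] by blast
  have "C_diff n \<phi>" for n
  proof (cases n)
    case 0
    then show ?thesis using has_derivative_continuous[OF \<phi>(2)]
      by (simp add: continuous_on_eq_continuous_at)
  next
    case (Suc m)
    have "smooth (\<lambda>z. cnj (h z) * v)" for v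
      by (intro smooth_intros(1,5) smooth_cnj h)
    moreover have "bounded_linear (\<lambda>z. 2 * Re z)"
      by (rule bounded_linear_compose[OF bounded_linear_mult_right bounded_linear_Re])
    ultimately have 1: "smooth (\<lambda>z. 2 * Re (cnj (h z) * v))" for v
      by (rule smooth_intros(3)[where L = "\<lambda>z. 2 * Re z"])
    show ?thesis
      unfolding Suc by (rule C_diff_SucI[OF \<phi>(2)]) (use 1 in \<open>simp only: smooth_def\<close>)
  qed
  then have "smooth \<phi>" by (simp add: smooth_def)
  moreover have "dzbar (\<lambda>w. complex_of_real (\<phi> w)) z = h z" for z
    by (rule iffD2[OF dzbar_of_real_iff[OF \<phi>(2)] refl])
  ultimately have ex: "is_magnetic_phase \<nu> \<mu> \<tau> \<phi>"
    unfolding is_magnetic_phase_def using \<phi>(1) h_eq B_def by simp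
  have der: "(\<psi> has_derivative (\<lambda>v. 2 * Re (cnj (h z) * v))) (at z)" if "is_magnetic_phase \<nu> \<mu> \<tau> \<psi>" for \<psi> z
  proof -
    have "smooth \<psi>" and "dzbar (\<lambda>w. complex_of_real (\<psi> w)) z = h z"
      using that h_eq[of z] B_def by (simp_all add: is_magnetic_phase_def)
    then show ?thesis
      using smooth_has_derivative[of \<psi> z] dzbar_of_real_iff[OF smooth_has_derivative[of \<psi> z], of "h z"] by (metis (lifting))
  qed
  have "\<psi> z = \<phi> z" if \<psi>: "is_magnetic_phase \<nu> \<mu> \<tau> \<psi>" for \<psi> z
  proof -
    have "((\<lambda>z. \<psi> z - \<phi> z) has_derivative (\<lambda>v. 0)) (at z)" for z
      using has_derivative_diff[OF der[OF \<psi>] \<phi>(2)] by simp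
    then have "\<psi> z - \<phi> z = \<psi> 0 - \<phi> 0"
      by (rule has_derivative_zero_unique[OF convex_UNIV]) auto
    moreover have "\<psi> 0 = 0"
      using \<psi> unfolding is_magnetic_phase_def by blast
    ultimately show ?thesis using \<phi>(1) by simp
  qed
  then show ?thesis using ex by (intro ex1I[of _ \<phi>]) auto
qed

end

theory Submission
  imports Defs "HOL-Probability.Distributions" "HOL-Real_Asymp.Real_Asymp"
begin

text \<open>The phase \<open>\<phi>\<close> is chosen so that the unimodular function \<open>U = exp (- \<i> \<phi>)\<close> removes the gauge: the magnetic
Schroedinger operator maps \<open>U F\<close> to \<open>U\<close> times \<open>L F\<close>, where
\<open>L = - (\<partial> - B cnj z) (\<partial>bar + B z) + B\<close> is the Landau operator of the constant field \<open>B\<close>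
(\<open>magnetic_schroedinger_gauge\<close>). Multiplication by \<open>U\<close> is unitary, so it suffices to decompose
\<open>L\<^sup>2\<close> into the eigenspaces of \<open>L\<close>; the factor \<open>exp (- \<i> \<psi>)\<close> in the kernel is the trace of this conjugation.

For the Landau operator the asserted kernels are the starting point: they define operators \<open>P\<^sub>k\<close>, and an
elementary Hilbert space argument (locale \<open>total_projections\<close>) reduces the decomposition to four facts.

\<^item> \<open>P\<^sub>k f\<close> is an eigenfunction of level \<open>k\<close> (\<open>landau_projection_mem\<close>). The kernel is a combination of kernels
  on which \<open>\<partial>bar + B z\<close> and \<open>- \<partial> + B cnj z\<close> act as lowering and raising operators, and the recursion for
  the coefficients of \<open>L\<^sub>k\<close> is the eigenvalue equation.
\<^item> If \<open>F\<close> is an eigenfunction of level \<open>k\<close>, then \<open>P\<^sub>j F\<close> is \<open>F\<close> for \<open>j = k\<close> and \<open>0\<close> otherwise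
  (\<open>landau_projection_on_level\<close>). Magnetic translations commute with \<open>L\<close>, so evaluation at the origin is
  enough, and there \<open>P\<^sub>j F\<close> is a combination of the Gaussian moments
  \<open>m (c, i) = \<integral> exp (- c |u|\<^sup>2) |u|\<^bsup>2 i\<^esup> F\<close> with \<open>c = B\<close>. Green's identity against radial functions gives a
  two-term recursion in \<open>i\<close> for these moments (\<open>radial_moment_recursion\<close>), so the moments of all eigenfunctions of
  level \<open>k\<close> are proportional to each other, and in particular to those of the radial eigenfunction
  \<open>exp (- B |u|\<^sup>2) L\<^sub>k (2 B |u|\<^sup>2)\<close>, which are computed by binomial sums. The factor of proportionality is \<open>F 0\<close>,
  because a function with vanishing moments vanishes at the origin, by the argument of the last item.
\<^item> \<open>P\<^sub>k\<close> is bounded and symmetric, since its kernel is Hermitian and dominated by an integrable function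
  of \<open>z - w\<close> (locale \<open>convolution_bounded_kernel\<close>).
\<^item> If all \<open>P\<^sub>k f\<close> vanish, then \<open>f = 0\<close> (\<open>landau_projection_total\<close>). The hypothesis says that all moments with
  \<open>c = B\<close> of all magnetic translates of \<open>f\<close> vanish. Expanding the exponential, the same follows for
  \<open>c = (3 / 2) B\<close>, and by iteration for arbitrarily large \<open>c\<close>, where the Gaussians concentrate at a point.

Two continuous projection kernels agree because elements of the eigenspace are continuous functions,
and the invariance is read off from the explicit formula.\<close>

section \<open>Integration\<close>

text \<open>Differentiation under the integral sign. By the mean value inequality the difference quotients are
  dominated by \<open>2 D\<close>, so that dominated convergence applies along every sequence.\<close>

lemma has_derivative_integral_dominated:
  fixes f :: "'a::real_normed_vector \<Rightarrow> 'b \<Rightarrow> 'c::{banach, second_countable_topology}"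
  assumes \<delta>: "0 < \<delta>"
    and der: "\<And>x w. x \<in> ball x0 \<delta> \<Longrightarrow> ((\<lambda>x. f x w) has_derivative f' x w) (at x)"
    and int: "\<And>x. x \<in> ball x0 \<delta> \<Longrightarrow> integrable M (f x)"
    and meas: "\<And>v. (\<lambda>w. f' x0 w v) \<in> borel_measurable M"
    and D: "integrable M D" "\<And>w. 0 \<le> D w"
    and dom: "\<And>x w v. x \<in> ball x0 \<delta> \<Longrightarrow> norm (f' x w v) \<le> D w * norm v"
  shows "((\<lambda>x. \<integral>w. f x w \<partial>M) has_derivative (\<lambda>v. \<integral>w. f' x0 w v \<partial>M)) (at x0)"
proof -
  have x0: "x0 \<in> ball x0 \<delta>" using \<delta> by simp
  have lin: "bounded_linear (f' x w)" if "x \<in> ball x0 \<delta>" for x w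
    using der[OF that] by (rule has_derivative_bounded_linear)
  have int': "integrable M (\<lambda>w. f' x0 w v)" for v
  proof (rule Bochner_Integration.integrable_bound)
    show "integrable M (\<lambda>w. D w * norm v)" using D(1) by simp
    show "AE w in M. norm (f' x0 w v) \<le> norm (D w * norm v)"
      using order_trans[OF dom[OF x0, of _ v] abs_ge_self] by auto
  qed (rule meas)
  have bl: "bounded_linear (\<lambda>v. \<integral>w. f' x0 w v \<partial>M)"
  proof
    fix u v :: 'a and r :: real
    show "(\<integral>w. f' x0 w (u + v) \<partial>M) = (\<integral>w. f' x0 w u \<partial>M) + (\<integral>w. f' x0 w v \<partial>M)"
      using int' by (simp add: linear_add[OF bounded_linear.linear[OF lin[OF x0]]])
    show "(\<integral>w. f' x0 w (r *\<^sub>R v) \<partial>M) = r *\<^sub>R (\<integral>w. f' x0 w v \<partial>M)"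
      by (simp add: linear_scale[OF bounded_linear.linear[OF lin[OF x0]]])
    show "\<exists>K. \<forall>v. norm (\<integral>w. f' x0 w v \<partial>M) \<le> norm v * K"
    proof (intro exI allI)
      fix v
      have "norm (\<integral>w. f' x0 w v \<partial>M) \<le> (\<integral>w. norm (f' x0 w v) \<partial>M)" by simp
      also have "\<dots> \<le> (\<integral>w. D w * norm v \<partial>M)"
        by (intro integral_mono integrable_norm int' dom x0) (use D(1) in simp)
      finally show "norm (\<integral>w. f' x0 w v \<partial>M) \<le> norm v * (\<integral>w. D w \<partial>M)" by (simp add: mult.commute)
    qed
  qed
  define q where "q x w = (f x w - f x0 w - f' x0 w (x - x0)) /\<^sub>R norm (x - x0)" for x w
  have q_int: "integral\<^sup>L M (q x) =
      ((\<integral>w. f x w \<partial>M) - (\<integral>w. f x0 w \<partial>M) - (\<integral>w. f' x0 w (x - x0) \<partial>M)) /\<^sub>R norm (x - x0)"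
    if "x \<in> ball x0 \<delta>" for x
    unfolding q_def using int[OF that] int[OF x0] int' by simp
  have q_bound: "norm (q x w) \<le> 2 * D w" if x: "x \<in> ball x0 \<delta>" "x \<noteq> x0" for x w
  proof -
    have "norm (f x w - f x0 w) \<le> D w * norm (x - x0)"
    proof (rule differentiable_bound[OF convex_ball])
      show "((\<lambda>x. f x w) has_derivative f' y w) (at y within ball x0 \<delta>)" if "y \<in> ball x0 \<delta>" for y
        using der[OF that] by (rule has_derivative_at_withinI)
      show "onorm (f' y w) \<le> D w" if "y \<in> ball x0 \<delta>" for y
        by (rule onorm_bound[OF D(2) dom[OF that]])
    qed (use x x0 in auto)
    moreover have "norm (f' x0 w (x - x0)) \<le> D w * norm (x - x0)" by (rule dom[OF x0])
    ultimately have "norm (f x w - f x0 w - f' x0 w (x - x0)) \<le> 2 * D w * norm (x - x0)"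
      using norm_triangle_ineq4[of "f x w - f x0 w" "f' x0 w (x - x0)"] by simp
    then show ?thesis using x by (simp add: q_def divide_simps mult.commute)
  qed
  have "((\<lambda>x. integral\<^sup>L M (q x)) \<longlongrightarrow> 0) (at x0)"
  proof -
    have "((\<lambda>n. integral\<^sup>L M (q (X n))) \<longlonglongrightarrow> 0)" if X: "\<And>n. X n \<noteq> x0" "X \<longlonglongrightarrow> x0" for X
    proof -
      obtain N where N: "\<And>n. n \<ge> N \<Longrightarrow> X n \<in> ball x0 \<delta>"
        using X(2) \<delta> unfolding lim_sequentially by (metis dist_commute mem_ball)
      have "(\<lambda>n. integral\<^sup>L M (q (X (n + N)))) \<longlonglongrightarrow> integral\<^sup>L M (\<lambda>w. 0)"
      proof (rule integral_dominated_convergence[where w = "\<lambda>w. 2 * D w"])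
        show "q (X (n + N)) \<in> borel_measurable M" for n
        proof -
          have 1: "f (X (n + N)) \<in> borel_measurable M" "f x0 \<in> borel_measurable M"
            by (rule borel_measurable_integrable, rule int, (rule N x0, simp?))+
          show ?thesis
            unfolding q_def
            by (rule borel_measurable_scaleR[OF borel_measurable_const
                  borel_measurable_diff[OF borel_measurable_diff[OF 1] meas]])
        qed
        show "AE w in M. (\<lambda>n. q (X (n + N)) w) \<longlonglongrightarrow> 0"
        proof (rule AE_I2)
          fix w
          have "((\<lambda>x. q x w) \<longlongrightarrow> 0) (at x0)"
            using der[OF x0, of w] unfolding has_derivative_at_within q_def by simp
          then have "(\<lambda>n. q (X n) w) \<longlonglongrightarrow> 0"
            using X unfolding tendsto_at_iff_sequentially o_def by simp
          then show "(\<lambda>n. q (X (n + N)) w) \<longlonglongrightarrow> 0" by (rule LIMSEQ_ignore_initial_segment)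
        qed
        show "AE w in M. norm (q (X (n + N)) w) \<le> 2 * D w" for n
          using q_bound[OF N[of "n + N"] X(1)] by auto
      qed (use D(1) in auto)
      then show ?thesis using LIMSEQ_offset[of "\<lambda>n. integral\<^sup>L M (q (X n))" N] by simp
    qed
    then show ?thesis unfolding tendsto_at_iff_sequentially o_def by simp
  qed
  moreover have "\<forall>\<^sub>F x in at x0. integral\<^sup>L M (q x) =
      ((\<integral>w. f x w \<partial>M) - (\<integral>w. f x0 w \<partial>M) - (\<integral>w. f' x0 w (x - x0) \<partial>M)) /\<^sub>R norm (x - x0)"
    using q_int eventually_at_ball'[OF \<delta>, of x0 UNIV] by (auto elim!: eventually_mono)
  ultimately have "((\<lambda>x. ((\<integral>w. f x w \<partial>M) - (\<integral>w. f x0 w \<partial>M) - (\<integral>w. f' x0 w (x - x0) \<partial>M)) /\<^sub>R norm (x - x0))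
      \<longlongrightarrow> 0) (at x0)"
    by (rule Lim_transform_eventually)
  then show ?thesis using bl by (simp add: has_derivative_at_within)
qed

lemma
  fixes f :: "'a::euclidean_space \<Rightarrow> 'b::{banach, second_countable_topology}"
  assumes f: "f \<in> borel_measurable lborel"
  shows lborel_integral_translate: "(LBINT x. f (c + x)) = (LBINT x. f x)"
    and lborel_integrable_translate_iff: "integrable lborel (\<lambda>x. f (c + x)) \<longleftrightarrow> integrable lborel f"
  using integral_distr[of "(+) c" lborel borel f] integrable_distr_eq[of "(+) c" lborel borel f] f
  by (simp_all add: lborel_distr_plus)

lemma lborel_integrable_translate:
  fixes f :: "'a::euclidean_space \<Rightarrow> 'b::{banach, second_countable_topology}"
  assumes "integrable lborel f"
  shows "integrable lborel (\<lambda>x. f (c + x))"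
  using lborel_integrable_translate_iff[OF borel_measurable_integrable[OF assms]] assms by simp

lemma lborel_integral_scale:
  fixes f :: "complex \<Rightarrow> 'b::{banach, second_countable_topology}"
  assumes f: "f \<in> borel_measurable borel" and c: "c > 0"
  shows "(LBINT x. f x) = c\<^sup>2 *\<^sub>R (LBINT x. f (c *\<^sub>R x))"
proof -
  have "(LBINT x. f x) = (\<integral>x. f x \<partial>density (distr lborel borel (\<lambda>x::complex. 0 + c *\<^sub>R x)) (\<lambda>_. \<bar>c\<bar>^DIM(complex)))"
    using lborel_affine[of c "0::complex"] c by simp
  also have "\<dots> = (LBINT x. c\<^sup>2 *\<^sub>R f (c *\<^sub>R x))"
    using f c by (subst integral_density) (auto simp: integral_distr)
  finally show ?thesis by simp
qed

lemma lborel_integrable_scale: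
  fixes f :: "complex \<Rightarrow> 'b::{banach, second_countable_topology}"
  assumes f: "integrable lborel f" and c: "c > 0"
  shows "integrable lborel (\<lambda>x. f (c *\<^sub>R x))"
proof -
  have [measurable]: "f \<in> borel_measurable borel" using f by auto
  have "integrable (density (distr lborel borel (\<lambda>x::complex. 0 + c *\<^sub>R x)) (\<lambda>_. \<bar>c\<bar>^DIM(complex))) f"
    using lborel_affine[of c "0::complex"] c f by simp
  then have "integrable lborel (\<lambda>x. c\<^sup>2 *\<^sub>R f (c *\<^sub>R x))"
    using c by (subst (asm) integrable_density) (auto simp: integrable_distr_eq)
  then have "integrable lborel (\<lambda>x. (1 / c\<^sup>2) *\<^sub>R (c\<^sup>2 *\<^sub>R f (c *\<^sub>R x)))"
    by (rule integrable_scaleR_right)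
  then show ?thesis using c by simp
qed

lemma real_gaussian:
  "integrable lborel (\<lambda>x::real. exp (- x\<^sup>2))" "(LBINT x. exp (- (x::real)\<^sup>2)) = sqrt pi"
proof -
  have "has_bochner_integral lborel (\<lambda>x::real. exp (- x\<^sup>2) * x ^ (2 * 0)) (sqrt pi * (fact (2 * 0) / (2 ^ (2 * 0) * fact 0)))"
    using has_bochner_integral_even_function[OF gaussian_moment_0] by simp
  then show "integrable lborel (\<lambda>x::real. exp (- x\<^sup>2))" "(LBINT x. exp (- (x::real)\<^sup>2)) = sqrt pi"
    by (auto simp: has_bochner_integral_iff)
qed

text \<open>In the standard basis the Gaussian is the product of two one-dimensional ones.\<close>

lemma complex_gaussian:
  "has_bochner_integral lborel (\<lambda>z::complex. exp (- (norm z)\<^sup>2)) pi"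
proof -
  have "(\<integral>\<^sup>+z. ennreal (exp (- (norm (z::complex))\<^sup>2)) \<partial>lborel)
      = (\<integral>\<^sup>+z. (\<Prod>b\<in>Basis. ennreal (exp (- ((z::complex) \<bullet> b)\<^sup>2))) \<partial>lborel)"
    by (simp add: Basis_complex_def cmod_power2 ennreal_mult[symmetric] exp_add[symmetric])
  also have "\<dots> = (\<Prod>b\<in>(Basis :: complex set). (\<integral>\<^sup>+x. ennreal (exp (- (x::real)\<^sup>2)) \<partial>lborel))"
    by (intro nn_integral_lborel_prod) auto
  also have "(\<integral>\<^sup>+x. ennreal (exp (- (x::real)\<^sup>2)) \<partial>lborel) = ennreal (sqrt pi)"
    using real_gaussian by (subst nn_integral_eq_integral) auto
  also have "(\<Prod>b\<in>(Basis :: complex set). ennreal (sqrt pi)) = ennreal pi"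
    by (simp add: Basis_complex_def ennreal_mult[symmetric] power2_eq_square)
  finally show ?thesis
    by (intro has_bochner_integral_nn_integral) auto
qed

lemma complex_gaussian_scaled:
  assumes c: "c > 0"
  shows "integrable lborel (\<lambda>z::complex. exp (- c * (norm z)\<^sup>2))"
    "(LBINT z. exp (- c * (norm (z::complex))\<^sup>2)) = pi / c"
proof -
  have *: "exp (- c * (norm z)\<^sup>2) = exp (- (norm (sqrt c *\<^sub>R z))\<^sup>2)" for z :: complex
    using c by (simp add: power_mult_distrib)
  show "integrable lborel (\<lambda>z::complex. exp (- c * (norm z)\<^sup>2))"
    unfolding * using complex_gaussian c
    by (intro lborel_integrable_scale[where f = "\<lambda>z. exp (- (norm z)\<^sup>2)"]) (auto simp: has_bochner_integral_iff)
  have "pi = (sqrt c)\<^sup>2 *\<^sub>R (LBINT z. exp (- c * (norm (z::complex))\<^sup>2))"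
    unfolding * using complex_gaussian c
      lborel_integral_scale[of "\<lambda>z. exp (- (norm z)\<^sup>2)" "sqrt c"] by (auto simp: has_bochner_integral_iff)
  then show "(LBINT z. exp (- c * (norm (z::complex))\<^sup>2)) = pi / c"
    using c by (simp add: field_simps)
qed

text \<open>Boxes form an intersection-stable generator of the Borel sets. Truncating to the boxes of an exhaustion
  makes the function integrable, and then the Borel sets over which it has integral \<open>0\<close> form a Dynkin system.\<close>

lemma AE_zero_if_integral_box_zero:
  fixes f :: "complex \<Rightarrow> complex"
  assumes int: "\<And>a b. set_integrable lborel (box a b) f"
    and zero: "\<And>a b. (LINT x:box a b|lborel. f x) = 0"
  shows "AE x in lborel. f x = 0"
proof -
  let ?A = "\<lambda>n::nat. box (- (real n *\<^sub>R One)) (real n *\<^sub>R One) :: complex set"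
  let ?E = "range (\<lambda>(a, b). box a b :: complex set)"
  have "AE x in lborel. indicator (?A n) x *\<^sub>R f x = 0" for n
  proof -
    define h where "h x = indicator (?A n) x *\<^sub>R f x" for x
    have h: "integrable lborel h"
      using int[of "- (real n *\<^sub>R One)" "real n *\<^sub>R One"] by (simp add: set_integrable_def h_def[abs_def])
    have hI: "integrable lborel (\<lambda>x. indicator X x *\<^sub>R h x)" if "X \<in> sets borel" for X
      using h that integrable_mult_indicator[of X lborel h] by simp
    have box0: "(LBINT x. indicator X x *\<^sub>R h x) = 0" if "X \<in> ?E" for X
    proof -
      obtain a b where X: "X = box a b" using \<open>X \<in> ?E\<close> by auto
      obtain a' b' where "X \<inter> ?A n = box a' b'" unfolding X box_Int_box by blast
      then have "indicator X x *\<^sub>R h x = indicator (box a' b') x *\<^sub>R f x" for x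
        by (auto simp: h_def indicator_def)
      then show ?thesis using zero[of a' b'] by (simp add: set_lebesgue_integral_def)
    qed
    have total: "(LBINT x. h x) = 0"
      using zero unfolding set_lebesgue_integral_def h_def by blast
    have P: "(LBINT x. indicator X x *\<^sub>R h x) = 0" if "X \<in> sigma_sets UNIV ?E" for X
    proof (rule sigma_sets_induct_disjoint[OF _ _ that])
      show "Int_stable ?E" by (auto simp: Int_stable_def box_Int_box)
      show "(LBINT x. indicator X x *\<^sub>R h x) = 0" if "X \<in> ?E" for X using box0[OF that] .
    next
      fix X assume X: "X \<in> sigma_sets UNIV ?E" "(LBINT x. indicator X x *\<^sub>R h x) = 0"
      then have Xb: "X \<in> sets borel" by (simp add: borel_eq_box)
      have "(LBINT x. indicator (UNIV - X) x *\<^sub>R h x) = (LBINT x. h x - indicator X x *\<^sub>R h x)"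
        by (intro Bochner_Integration.integral_cong) (auto simp: indicator_def)
      then show "(LBINT x. indicator (UNIV - X) x *\<^sub>R h x) = 0"
        using X(2) total h hI[OF Xb] by simp
    next
      fix X :: "nat \<Rightarrow> complex set"
      assume X: "disjoint_family X" "range X \<subseteq> sigma_sets UNIV ?E" "\<And>i. (LBINT x. indicator (X i) x *\<^sub>R h x) = 0"
      then have Xb: "\<And>i. X i \<in> sets lborel" by (auto simp: borel_eq_box)
      have "(LINT x:(\<Union>i. X i)|lborel. h x) = (\<Sum>i. (LINT x:X i|lborel. h x))"
        using X(1) Xb hI[of "\<Union>i. X i"]
        by (intro lebesgue_integral_countable_add) (auto simp: disjoint_family_on_def set_integrable_def)
      then show "(LBINT x. indicator (\<Union>i. X i) x *\<^sub>R h x) = 0"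
        using X(3) by (simp add: set_lebesgue_integral_def)
    qed auto
    have "AE x in lborel. Re (h x) = 0" "AE x in lborel. Im (h x) = 0"
    proof -
      have S: "(LINT x:X|lborel. Re (h x)) = 0 \<and> (LINT x:X|lborel. Im (h x)) = 0" if "X \<in> sets lborel" for X
      proof -
        have *: "(LBINT x. indicator X x *\<^sub>R h x) = 0" "integrable lborel (\<lambda>x. indicator X x *\<^sub>R h x)"
          using P[of X] hI[of X] that by (auto simp: borel_eq_box)
        show ?thesis
          using integral_Re[OF *(2)] integral_Im[OF *(2)] *(1) by (simp add: set_lebesgue_integral_def)
      qed
      show "AE x in lborel. Re (h x) = 0"
        by (rule density_unique_real) (use h S in \<open>auto intro: integrable_Re\<close>)
      show "AE x in lborel. Im (h x) = 0"
        by (rule density_unique_real) (use h S in \<open>auto intro: integrable_Im\<close>)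
    qed
    then show ?thesis unfolding h_def[symmetric] by eventually_elim (simp add: complex_eq_iff)
  qed
  then have "AE x in lborel. \<forall>n. indicator (?A n) x *\<^sub>R f x = 0" unfolding AE_all_countable by blast
  then show ?thesis
  proof eventually_elim
    fix x assume x: "\<forall>n. indicator (?A n) x *\<^sub>R f x = 0"
    have "x \<in> (\<Union>n. ?A n)" by (simp only: UN_box_eq_UNIV UNIV_I)
    then obtain n where "x \<in> ?A n" by blast
    then show "f x = 0" using x[rule_format, of n] by simp
  qed
qed

lemma continuous_AE_zero:
  fixes g :: "complex \<Rightarrow> complex"
  assumes "continuous_on UNIV g" "AE z in lborel. g z = 0"
  shows "g z = 0"
proof (rule ccontr)
  assume z: "g z \<noteq> 0"
  have "open {z. g z \<noteq> 0}"
    by (rule open_Collect_neq[OF assms(1) continuous_on_const])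
  then obtain e where e: "e > 0" "ball z e \<subseteq> {z. g z \<noteq> 0}"
    using z by (auto elim!: openE)
  have "AE z' in lborel. z' \<notin> ball z e"
    using assms(2) by eventually_elim (use e(2) in auto)
  then have "ball z e \<in> null_sets lborel" by (subst AE_iff_null_sets) auto
  then have "measure lborel (ball z e) = 0" by (simp add: null_sets_def measure_def)
  then show False using content_ball_pos[OF e(1), of z] by simp
qed

lemma compact_support_integrable:
  fixes f :: "complex \<Rightarrow> complex"
  assumes "continuous_on UNIV f" "\<And>z. R < norm z \<Longrightarrow> f z = 0"
  shows "integrable lborel f"
proof -
  have "integrable lborel (\<lambda>z. indicator (cball 0 R) z *\<^sub>R f z)"
    by (rule borel_integrable_compact) (auto intro: continuous_on_subset[OF assms(1)])
  moreover have "indicator (cball 0 R) z *\<^sub>R f z = f z" for z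
    using assms(2)[of z] by (auto simp: indicator_def)
  ultimately show ?thesis by simp
qed

section \<open>Square integrable functions\<close>

lemma borel_measurable_cnj [measurable (raw)]:
  "f \<in> borel_measurable M \<Longrightarrow> (\<lambda>x. cnj (f x)) \<in> borel_measurable M"
  by (rule borel_measurable_continuous_on[OF continuous_on_cnj[OF continuous_on_id]])

lemma L2_measurable: "f \<in> L2 \<Longrightarrow> f \<in> borel_measurable borel"
  by (simp add: L2_def)

lemma L2_square_integrable: "f \<in> L2 \<Longrightarrow> integrable lborel (\<lambda>z. (norm (f z))\<^sup>2)"
  by (simp add: L2_def)

lemma L2I:
  "f \<in> borel_measurable borel \<Longrightarrow> integrable lborel (\<lambda>z. (norm (f z))\<^sup>2) \<Longrightarrow> f \<in> L2"
  by (simp add: L2_def)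

lemma L2_bound:
  assumes "g \<in> L2" "f \<in> borel_measurable borel" "\<And>z. norm (f z) \<le> norm (g z)"
  shows "f \<in> L2"
proof (rule L2I)
  show "integrable lborel (\<lambda>z. (norm (f z))\<^sup>2)"
    by (rule Bochner_Integration.integrable_bound[OF L2_square_integrable[OF assms(1)]])
      (use assms(2,3) in \<open>auto intro!: power_mono\<close>)
qed fact

lemma L2_zero: "(\<lambda>z. 0) \<in> L2"
  by (simp add: L2_def)

lemma L2_scale: "f \<in> L2 \<Longrightarrow> (\<lambda>z. c * f z) \<in> L2"
  by (auto simp: L2_def norm_mult power_mult_distrib)

lemma L2_add:
  assumes f: "f \<in> L2" and g: "g \<in> L2"
  shows "(\<lambda>z. f z + g z) \<in> L2"
proof (rule L2I)
  note [measurable] = L2_measurable[OF f] L2_measurable[OF g]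
  show "(\<lambda>z. f z + g z) \<in> borel_measurable borel" by measurable
  show "integrable lborel (\<lambda>z. (norm (f z + g z))\<^sup>2)"
  proof (rule Bochner_Integration.integrable_bound)
    show "integrable lborel (\<lambda>z. 2 * (norm (f z))\<^sup>2 + 2 * (norm (g z))\<^sup>2)"
      using L2_square_integrable[OF f] L2_square_integrable[OF g] by simp
    have "(norm (f z + g z))\<^sup>2 \<le> (norm (f z) + norm (g z))\<^sup>2" for z
      by (intro power_mono norm_triangle_ineq) simp
    also have "\<dots> z \<le> 2 * (norm (f z))\<^sup>2 + 2 * (norm (g z))\<^sup>2" for z
      using sum_squares_bound[of "norm (f z)" "norm (g z)"] by (simp add: power2_sum)
    finally show "AE z in lborel. norm ((norm (f z + g z))\<^sup>2) \<le> norm (2 * (norm (f z))\<^sup>2 + 2 * (norm (g z))\<^sup>2)"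
      by simp
  qed measurable
qed

lemma L2_diff: "f \<in> L2 \<Longrightarrow> g \<in> L2 \<Longrightarrow> (\<lambda>z. f z - g z) \<in> L2"
  using L2_add[OF _ L2_scale[of g "-1"]] by simp

lemma L2_sum: "(\<And>k. k \<in> I \<Longrightarrow> f k \<in> L2) \<Longrightarrow> (\<lambda>z. \<Sum>k\<in>I. f k z) \<in> L2"
  by (induction I rule: infinite_finite_induct) (auto simp: L2_zero L2_add)

lemma L2_translate:
  assumes F: "F \<in> L2"
  shows "(\<lambda>u. F (z + u)) \<in> L2"
proof (rule L2I)
  note [measurable] = L2_measurable[OF F]
  show "(\<lambda>u. F (z + u)) \<in> borel_measurable borel" by measurable
  show "integrable lborel (\<lambda>u. (norm (F (z + u)))\<^sup>2)"
    by (rule lborel_integrable_translate[OF L2_square_integrable[OF F]])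
qed

lemma L2_indicator_box: "(\<lambda>z. complex_of_real (indicator (box a b) z)) \<in> L2"
proof (rule L2I)
  have "(norm (complex_of_real (indicator (box a b) z)))\<^sup>2 = indicator (box a b) z" for z
    by (simp add: indicator_def)
  then show "integrable lborel (\<lambda>z. (norm (complex_of_real (indicator (box a b) z)))\<^sup>2)"
    using emeasure_lborel_box_finite[of a b] by (simp add: integrable_real_indicator)
qed measurable

lemma L2_norm_nonneg: "0 \<le> L2_norm f"
  by (simp add: L2_norm_def)

lemma L2_norm_square: "(L2_norm f)\<^sup>2 = (LBINT z. (norm (f z))\<^sup>2)"
  by (simp add: L2_norm_def)

lemma L2_mult_integrable:
  assumes f: "f \<in> L2" and g: "g \<in> L2"
  shows "integrable lborel (\<lambda>z. norm (f z) * norm (g z))" "integrable lborel (\<lambda>z. f z * g z)"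
    "integrable lborel (\<lambda>z. f z * cnj (g z))"
proof -
  note [measurable] = L2_measurable[OF f] L2_measurable[OF g]
  show *: "integrable lborel (\<lambda>z. norm (f z) * norm (g z))"
  proof (rule Bochner_Integration.integrable_bound)
    show "integrable lborel (\<lambda>z. (norm (f z))\<^sup>2 + (norm (g z))\<^sup>2)"
      using L2_square_integrable[OF f] L2_square_integrable[OF g] by simp
    show "AE z in lborel. norm (norm (f z) * norm (g z)) \<le> norm ((norm (f z))\<^sup>2 + (norm (g z))\<^sup>2)"
    proof (rule AE_I2)
      fix z
      have "norm (f z) * norm (g z) \<le> (norm (f z))\<^sup>2 + (norm (g z))\<^sup>2"
        using sum_squares_bound[of "norm (f z)" "norm (g z)"] mult_nonneg_nonneg[OF norm_ge_zero norm_ge_zero, of "f z" "g z"]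
        unfolding mult.assoc by linarith
      then show "norm (norm (f z) * norm (g z)) \<le> norm ((norm (f z))\<^sup>2 + (norm (g z))\<^sup>2)"
        by simp
    qed
  qed measurable
  show "integrable lborel (\<lambda>z. f z * g z)" "integrable lborel (\<lambda>z. f z * cnj (g z))"
    by (rule Bochner_Integration.integrable_bound[OF *], measurable, simp add: norm_mult)+
qed

text \<open>The integrated inequality \<open>2 s t |f| |g| \<le> s\<^sup>2 |f|\<^sup>2 + t\<^sup>2 |g|\<^sup>2\<close>, with \<open>s\<close> and \<open>t\<close> the two norms. If one norm
  vanishes, the free parameter can be sent to infinity.\<close>

lemma L2_Cauchy_Schwarz:
  assumes f: "f \<in> L2" and g: "g \<in> L2"
  shows "(LBINT z. norm (f z) * norm (g z)) \<le> L2_norm f * L2_norm g"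
proof -
  let ?I = "LBINT z. norm (f z) * norm (g z)"
  have I: "0 \<le> ?I" by simp
  have sq: "2 * s * t * ?I \<le> s\<^sup>2 * (L2_norm f)\<^sup>2 + t\<^sup>2 * (L2_norm g)\<^sup>2" for s t
  proof -
    have "2 * s * t * ?I = (LBINT z. 2 * s * t * (norm (f z) * norm (g z)))" by simp
    also have "\<dots> \<le> (LBINT z. s\<^sup>2 * (norm (f z))\<^sup>2 + t\<^sup>2 * (norm (g z))\<^sup>2)"
    proof (intro integral_mono)
      show "2 * s * t * (norm (f z) * norm (g z)) \<le> s\<^sup>2 * (norm (f z))\<^sup>2 + t\<^sup>2 * (norm (g z))\<^sup>2" for z
        using sum_squares_bound[of "s * norm (f z)" "t * norm (g z)"] by (simp add: power_mult_distrib algebra_simps)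
    qed (use L2_mult_integrable[OF f g] L2_square_integrable[OF f] L2_square_integrable[OF g] in auto)
    also have "\<dots> = s\<^sup>2 * (L2_norm f)\<^sup>2 + t\<^sup>2 * (L2_norm g)\<^sup>2"
      using L2_square_integrable[OF f] L2_square_integrable[OF g] by (simp add: L2_norm_square)
    finally show ?thesis .
  qed
  let ?a = "L2_norm f" and ?b = "L2_norm g"
  show ?thesis
  proof (cases "?a > 0 \<and> ?b > 0")
    case True
    then have "2 * (?a * ?b) * ?I \<le> 2 * (?a * ?b) * (?a * ?b)"
      using sq[of ?b ?a] by (simp add: algebra_simps power2_eq_square)
    then show ?thesis using True by (simp add: mult_le_cancel_left_pos)
  next
    case False
    have "?I \<le> 0"
    proof (rule ccontr)
      assume "\<not> ?I \<le> 0"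
      then have I: "?I > 0" by simp
      have *: False if "\<And>t. 2 * t * ?I \<le> C" for C :: real
        using that[of "(\<bar>C\<bar> + 1) / ?I"] I by simp
      consider "?a = 0" | "?b = 0" using False L2_norm_nonneg[of f] L2_norm_nonneg[of g] by linarith
      then show False
      proof cases
        case 1
        have "2 * s * ?I \<le> ?b\<^sup>2" for s using sq[of s 1] 1 by simp
        then show False by (rule *)
      next
        case 2
        have "2 * t * ?I \<le> ?a\<^sup>2" for t using sq[of 1 t] 2 by simp
        then show False by (rule *)
      qed
    qed
    then show ?thesis using mult_nonneg_nonneg[OF L2_norm_nonneg[of f] L2_norm_nonneg[of g]] by simp
  qed
qed

lemma norm_integral_mult_le:
  assumes f: "f \<in> L2" and g: "g \<in> L2"
  shows "norm (LBINT z. f z * g z) \<le> L2_norm f * L2_norm g"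
proof -
  have "norm (LBINT z. f z * g z) \<le> (LBINT z. norm (f z * g z))" by simp
  also have "\<dots> = (LBINT z. norm (f z) * norm (g z))" by (simp add: norm_mult)
  also have "\<dots> \<le> L2_norm f * L2_norm g" by (rule L2_Cauchy_Schwarz[OF f g])
  finally show ?thesis .
qed

lemma L2_inner_diff:
  assumes "f \<in> L2" "g \<in> L2" "h \<in> L2"
  shows "L2_inner (\<lambda>z. f z - g z) h = L2_inner f h - L2_inner g h"
    and "L2_inner h (\<lambda>z. f z - g z) = L2_inner h f - L2_inner h g"
  unfolding L2_inner_def using assms by (simp_all add: L2_mult_integrable algebra_simps)

lemma L2_inner_zero: "L2_inner (\<lambda>z. 0) f = 0" "L2_inner f (\<lambda>z. 0) = 0"
  by (simp_all add: L2_inner_def)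

lemma L2_inner_cnj: "L2_inner g f = cnj (L2_inner f g)"
  unfolding L2_inner_def by (subst Bochner_Integration.integral_cnj[symmetric]) (simp add: mult.commute)

lemma L2_inner_self: "L2_inner f f = of_real ((L2_norm f)\<^sup>2)"
  by (simp add: L2_inner_def L2_norm_square complex_norm_square[symmetric] integral_complex_of_real[symmetric] del: integral_complex_of_real of_real_power)

lemma L2_norm_square_pythagoras:
  assumes f: "f \<in> L2" and g: "g \<in> L2" and orth: "L2_inner f g = 0"
  shows "(L2_norm (\<lambda>z. f z - g z))\<^sup>2 = (L2_norm f)\<^sup>2 + (L2_norm g)\<^sup>2"
proof -
  have "L2_inner g f = 0" using L2_inner_cnj[of g f] orth by simp
  then have "L2_inner (\<lambda>z. f z - g z) (\<lambda>z. f z - g z) = L2_inner f f + L2_inner g g"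
    using orth by (simp add: L2_inner_diff f g L2_diff)
  then show ?thesis unfolding L2_inner_self by (simp flip: of_real_add of_real_power)
qed

text \<open>A squared form of the triangle inequality, which avoids Minkowski's inequality.\<close>

lemma L2_norm_square_diff_triangle:
  assumes f: "f \<in> L2" and g: "g \<in> L2" and h: "h \<in> L2"
  shows "(L2_norm (\<lambda>z. f z - h z))\<^sup>2 \<le> 2 * (L2_norm (\<lambda>z. f z - g z))\<^sup>2 + 2 * (L2_norm (\<lambda>z. g z - h z))\<^sup>2"
proof -
  have "(LBINT z. (norm (f z - h z))\<^sup>2) \<le> (LBINT z. 2 * (norm (f z - g z))\<^sup>2 + 2 * (norm (g z - h z))\<^sup>2)"
  proof (rule integral_mono)
    show "(norm (f z - h z))\<^sup>2 \<le> 2 * (norm (f z - g z))\<^sup>2 + 2 * (norm (g z - h z))\<^sup>2" for z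
    proof -
      have "norm (f z - h z) \<le> norm (f z - g z) + norm (g z - h z)"
        using norm_triangle_ineq[of "f z - g z" "g z - h z"] by simp
      then have "(norm (f z - h z))\<^sup>2 \<le> (norm (f z - g z) + norm (g z - h z))\<^sup>2" by (rule power_mono) simp
      also have "\<dots> \<le> 2 * (norm (f z - g z))\<^sup>2 + 2 * (norm (g z - h z))\<^sup>2"
        using sum_squares_bound[of "norm (f z - g z)" "norm (g z - h z)"] by (simp add: power2_sum)
      finally show ?thesis .
    qed
  qed (use L2_square_integrable[OF L2_diff[OF f h]] L2_square_integrable[OF L2_diff[OF f g]]
      L2_square_integrable[OF L2_diff[OF g h]] in auto)
  then show ?thesis
    using L2_square_integrable[OF L2_diff[OF f g]] L2_square_integrable[OF L2_diff[OF g h]]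
    by (simp add: L2_norm_square)
qed

lemma AE_eq_if_L2_norm_diff_zero:
  assumes "f \<in> L2" "g \<in> L2" "L2_norm (\<lambda>z. f z - g z) = 0"
  shows "AE z in lborel. f z = g z"
proof -
  have "(LBINT z. (norm (f z - g z))\<^sup>2) = 0" using L2_norm_square[of "\<lambda>z. f z - g z"] assms(3) by simp
  then have "AE z in lborel. (norm (f z - g z))\<^sup>2 = 0"
    using integral_nonneg_eq_0_iff_AE[OF L2_square_integrable[OF L2_diff[OF assms(1,2)]]] by simp
  then show ?thesis by eventually_elim simp
qed

text \<open>The Riesz--Fischer theorem. Along a rapidly converging subsequence with differences \<open>d\<^sub>j\<close> the function
  \<open>\<Sum> 2\<^sup>j |d\<^sub>j|\<^sup>2\<close> is integrable, hence finite almost everywhere, which forces geometric decay of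
  the \<open>|d\<^sub>j|\<close> and pointwise convergence. Fatou's lemma identifies the pointwise limit as the limit in the mean.\<close>

lemma L2_complete:
  assumes S: "\<And>n. S n \<in> L2"
    and Cauchy: "\<And>e. 0 < e \<Longrightarrow> \<exists>N. \<forall>m\<ge>N. \<forall>n\<ge>N. (L2_norm (\<lambda>z. S m z - S n z))\<^sup>2 \<le> e"
  shows "\<exists>g\<in>L2. (\<lambda>n. L2_norm (\<lambda>z. S n z - g z)) \<longlonglongrightarrow> 0"
proof -
  note [measurable] = L2_measurable[OF S]
  have nn: "(\<integral>\<^sup>+z. ennreal ((norm (f z))\<^sup>2) \<partial>lborel) = ennreal ((L2_norm f)\<^sup>2)" if "f \<in> L2" for f
    unfolding L2_norm_square using L2_square_integrable[OF that] by (intro nn_integral_eq_integral) auto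
  have "\<exists>N. \<forall>m\<ge>N. \<forall>n\<ge>N. (L2_norm (\<lambda>z. S m z - S n z))\<^sup>2 \<le> (1/4) ^ j" for j :: nat
    by (rule Cauchy) simp
  then obtain N where N: "\<And>j m n. m \<ge> N j \<Longrightarrow> n \<ge> N j \<Longrightarrow> (L2_norm (\<lambda>z. S m z - S n z))\<^sup>2 \<le> (1/4) ^ j"
    by metis
  define r where "r j = (\<Sum>i\<le>j. N i) + j" for j
  have r: "N j \<le> r j" "N j \<le> r (Suc j)" for j
    unfolding r_def using member_le_sum[of j "{..j}" N] by auto
  have r_ge: "j \<le> r j" for j by (simp add: r_def)
  define d where "d j z = S (r (Suc j)) z - S (r j) z" for j z
  have [measurable]: "d j \<in> borel_measurable borel" for j unfolding d_def by measurable
  have dL2: "d j \<in> L2" for j unfolding d_def by (intro L2_diff S)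
  have "(\<integral>\<^sup>+z. (\<Sum>j. ennreal (2 ^ j * (norm (d j z))\<^sup>2)) \<partial>lborel)
      = (\<Sum>j. \<integral>\<^sup>+z. ennreal (2 ^ j * (norm (d j z))\<^sup>2) \<partial>lborel)"
    by (rule nn_integral_suminf) measurable
  also have "\<dots> = (\<Sum>j. ennreal (2 ^ j * (L2_norm (d j))\<^sup>2))"
    using nn[OF dL2] by (simp add: ennreal_mult nn_integral_cmult)
  also have "\<dots> \<le> (\<Sum>j. ennreal ((1/2) ^ j))"
  proof (intro suminf_le ennreal_leI)
    fix j
    have "(2::real) ^ j * (L2_norm (d j))\<^sup>2 \<le> 2 ^ j * (1/4) ^ j"
      unfolding d_def by (intro mult_left_mono N r) simp
    also have "\<dots> = (1/2) ^ j" by (simp add: power_mult_distrib[symmetric])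
    finally show "(2::real) ^ j * (L2_norm (d j))\<^sup>2 \<le> (1/2) ^ j" .
  qed auto
  also have "\<dots> = ennreal (\<Sum>j. (1/2) ^ j)"
    by (rule suminf_ennreal_eq) (auto intro: summable_sums)
  also have "\<dots> < \<infinity>" by simp
  finally have "AE z in lborel. (\<Sum>j. ennreal (2 ^ j * (norm (d j z))\<^sup>2)) \<noteq> \<infinity>"
    by (intro nn_integral_PInf_AE) auto
  then have conv: "AE z in lborel. (\<lambda>j. S (r j) z) \<longlonglongrightarrow> lim (\<lambda>j. S (r j) z)"
  proof eventually_elim
    fix z assume "(\<Sum>j. ennreal (2 ^ j * (norm (d j z))\<^sup>2)) \<noteq> \<infinity>"
    then have sm: "summable (\<lambda>j. 2 ^ j * (norm (d j z))\<^sup>2)"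
      by (intro summable_suminf_not_top) auto
    define M where "M = (\<Sum>j. 2 ^ j * (norm (d j z))\<^sup>2)"
    have "norm (d j z) \<le> sqrt M * (sqrt (1/2)) ^ j" for j
    proof -
      have "2 ^ j * (norm (d j z))\<^sup>2 \<le> M"
        unfolding M_def using sum_le_suminf[OF sm, of "{j}"] by simp
      then have "(norm (d j z))\<^sup>2 \<le> M * (1/2) ^ j" by (simp add: field_simps)
      then have "norm (d j z) \<le> sqrt (M * (1/2) ^ j)" by (rule real_le_rsqrt)
      then show ?thesis by (simp add: real_sqrt_mult real_sqrt_power)
    qed
    moreover have "sqrt (1/2) < (1::real)" by (rule real_less_lsqrt) auto
    then have "summable (\<lambda>j. sqrt M * (sqrt (1/2)) ^ j)"
      by (intro summable_mult summable_geometric) simp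
    ultimately have "summable (\<lambda>j. d j z)" by (rule summable_comparison_test'[rotated, where N = 0])
    then have "convergent (\<lambda>n. \<Sum>j<n. d j z)" by (simp add: summable_iff_convergent)
    moreover have "(\<Sum>j<n. d j z) = S (r n) z - S (r 0) z" for n
      unfolding d_def by (rule sum_lessThan_telescope)
    ultimately have "convergent (\<lambda>n. S (r n) z - S (r 0) z)" by simp
    then have "convergent (\<lambda>n. S (r n) z)" using convergent_diff_const_right_iff by blast
    then show "(\<lambda>j. S (r j) z) \<longlonglongrightarrow> lim (\<lambda>j. S (r j) z)" by (simp add: convergent_LIMSEQ_iff)
  qed
  define g where "g z = lim (\<lambda>j. S (r j) z)" for z
  have gm[measurable]: "g \<in> borel_measurable borel" unfolding g_def by measurable
  have fatou: "(\<integral>\<^sup>+z. ennreal ((norm (S m z - g z))\<^sup>2) \<partial>lborel) \<le> ennreal e"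
    if M: "\<And>n. n \<ge> M \<Longrightarrow> (L2_norm (\<lambda>z. S m z - S n z))\<^sup>2 \<le> e" for m M e
  proof -
    have "(\<integral>\<^sup>+z. ennreal ((norm (S m z - g z))\<^sup>2) \<partial>lborel)
        = (\<integral>\<^sup>+z. liminf (\<lambda>j. ennreal ((norm (S m z - S (r j) z))\<^sup>2)) \<partial>lborel)"
      using conv
    proof (intro nn_integral_cong_AE, eventually_elim)
      fix z assume "(\<lambda>j. S (r j) z) \<longlonglongrightarrow> lim (\<lambda>j. S (r j) z)"
      then have "(\<lambda>j. ennreal ((norm (S m z - S (r j) z))\<^sup>2)) \<longlonglongrightarrow> ennreal ((norm (S m z - g z))\<^sup>2)"
        unfolding g_def by (intro tendsto_intros)
      then show "ennreal ((norm (S m z - g z))\<^sup>2) = liminf (\<lambda>j. ennreal ((norm (S m z - S (r j) z))\<^sup>2))"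
        using lim_imp_Liminf[OF sequentially_bot] by (metis (no_types, lifting))
    qed
    also have "\<dots> \<le> liminf (\<lambda>j. \<integral>\<^sup>+z. ennreal ((norm (S m z - S (r j) z))\<^sup>2) \<partial>lborel)"
      by (rule nn_integral_liminf) measurable
    also have "\<dots> = liminf (\<lambda>j. ennreal ((L2_norm (\<lambda>z. S m z - S (r j) z))\<^sup>2))"
      using nn[OF L2_diff[OF S S]] by simp
    also have "\<dots> \<le> limsup (\<lambda>j. ennreal ((L2_norm (\<lambda>z. S m z - S (r j) z))\<^sup>2))"
      by (rule Liminf_le_Limsup) simp
    also have "\<dots> \<le> ennreal e"
    proof (rule Limsup_bounded)
      show "\<forall>\<^sub>F j in sequentially. ennreal ((L2_norm (\<lambda>z. S m z - S (r j) z))\<^sup>2) \<le> ennreal e"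
        using eventually_ge_at_top[of M]
        by eventually_elim (use M order_trans[OF _ r_ge] in \<open>auto intro!: ennreal_leI\<close>)
    qed
    finally show ?thesis .
  qed
  have L2d: "(\<lambda>z. S m z - g z) \<in> L2" if "(\<integral>\<^sup>+z. ennreal ((norm (S m z - g z))\<^sup>2) \<partial>lborel) \<le> ennreal e" for m e
    by (rule L2I, measurable) (rule integrableI_bounded, use that in \<open>auto simp: top.not_eq_extremum intro: le_less_trans\<close>)
  have gL2: "g \<in> L2"
  proof -
    obtain M where "\<And>n. n \<ge> M \<Longrightarrow> (L2_norm (\<lambda>z. S M z - S n z))\<^sup>2 \<le> 1" using Cauchy[of 1] by auto
    then have "(\<lambda>z. S M z - g z) \<in> L2" by (rule L2d[OF fatou])
    then have "(\<lambda>z. S M z - (S M z - g z)) \<in> L2" by (rule L2_diff[OF S])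
    moreover have "(\<lambda>z. S M z - (S M z - g z)) = g" by (rule ext) simp
    ultimately show ?thesis by simp
  qed
  have "(\<lambda>n. (L2_norm (\<lambda>z. S n z - g z))\<^sup>2) \<longlonglongrightarrow> 0"
  proof (rule LIMSEQ_I)
    fix e :: real assume e: "0 < e"
    obtain M where M: "\<And>m n. m \<ge> M \<Longrightarrow> n \<ge> M \<Longrightarrow> (L2_norm (\<lambda>z. S m z - S n z))\<^sup>2 \<le> e / 2"
      using Cauchy[of "e / 2"] e by auto
    have "(L2_norm (\<lambda>z. S m z - g z))\<^sup>2 \<le> e / 2" if "m \<ge> M" for m
      using fatou[of M m "e / 2"] M[OF that] nn[OF L2_diff[OF S gL2], of m] e by simp
    then show "\<exists>N. \<forall>n\<ge>N. norm ((L2_norm (\<lambda>z. S n z - g z))\<^sup>2 - 0) < e"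
      using e by (intro exI[of _ M]) fastforce
  qed
  then have "(\<lambda>n. sqrt ((L2_norm (\<lambda>z. S n z - g z))\<^sup>2)) \<longlonglongrightarrow> sqrt 0" by (rule tendsto_real_sqrt)
  then show ?thesis using gL2 by (intro bexI[of _ g]) (simp add: L2_norm_nonneg)
qed

section \<open>Orthogonal decompositions from symmetric projections\<close>

text \<open>The abstract part of the spectral decomposition. The operators act on functions, not on classes, and
  \<open>proj_on\<close> is a pointwise identity; \<open>proj_bounded\<close> is continuity of the point evaluations of \<open>P k f\<close>.\<close>

locale total_projections =
  fixes A :: "nat \<Rightarrow> (complex \<Rightarrow> complex) set"
    and P :: "nat \<Rightarrow> (complex \<Rightarrow> complex) \<Rightarrow> complex \<Rightarrow> complex"
  assumes subset_L2: "A k \<subseteq> L2"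
    and zero_mem: "(\<lambda>z. 0) \<in> A k"
    and add_mem: "F \<in> A k \<Longrightarrow> H \<in> A k \<Longrightarrow> (\<lambda>z. F z + H z) \<in> A k"
    and scale_mem: "F \<in> A k \<Longrightarrow> (\<lambda>z. c * F z) \<in> A k"
    and proj_mem: "f \<in> L2 \<Longrightarrow> P k f \<in> A k"
    and proj_on: "F \<in> A k \<Longrightarrow> P j F = (if j = k then F else (\<lambda>z. 0))"
    and proj_diff: "f \<in> L2 \<Longrightarrow> g \<in> L2 \<Longrightarrow> P k (\<lambda>z. f z - g z) = (\<lambda>z. P k f z - P k g z)"
    and proj_symmetric: "f \<in> L2 \<Longrightarrow> g \<in> L2 \<Longrightarrow> L2_inner (P k f) g = L2_inner f (P k g)"
    and proj_bounded: "\<exists>C. \<forall>f\<in>L2. \<forall>z. norm (P k f z) \<le> C * L2_norm f"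
    and total: "f \<in> L2 \<Longrightarrow> (\<And>k. P k f = (\<lambda>z. 0)) \<Longrightarrow> AE z in lborel. f z = 0"

begin

lemma mem_L2: "F \<in> A k \<Longrightarrow> F \<in> L2"
  using subset_L2 by blast

lemma proj_L2: "f \<in> L2 \<Longrightarrow> P k f \<in> L2"
  using mem_L2 proj_mem by blast

lemma is_orthogonal_projection_proj:
  assumes f: "f \<in> L2"
  shows "is_orthogonal_projection (A k) f (P k f)"
  unfolding is_orthogonal_projection_def
proof (intro conjI ballI)
  fix F assume F: "F \<in> A k"
  then show "L2_inner (\<lambda>z. f z - P k f z) F = 0"
    using proj_on[OF F, of k] by (simp add: L2_inner_diff f mem_L2[OF F] proj_L2 proj_symmetric)
qed (rule proj_mem[OF f])

lemma orthogonal: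
  assumes "j \<noteq> k" and F: "F \<in> A j" and H: "H \<in> A k"
  shows "L2_inner F H = 0"
proof -
  have "L2_inner F H = L2_inner (P j F) H" using proj_on[OF F, of j] by simp
  also have "\<dots> = L2_inner F (P j H)" by (rule proj_symmetric[OF F[THEN mem_L2] H[THEN mem_L2]])
  also have "\<dots> = 0" using proj_on[OF H, of j] assms(1) by (simp add: L2_inner_zero)
  finally show ?thesis .
qed

lemma norm_proj_diff:
  assumes f: "f \<in> L2"
  shows "(L2_norm f)\<^sup>2 = (L2_norm (\<lambda>z. f z - P k f z))\<^sup>2 + (L2_norm (P k f))\<^sup>2"
proof -
  have "L2_inner (\<lambda>z. f z - P k f z) (P k f) = 0"
    using is_orthogonal_projection_proj[OF f, of k] proj_mem[OF f, of k]
    unfolding is_orthogonal_projection_def by blast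
  then have *: "L2_inner (\<lambda>z. f z - P k f z) (\<lambda>z. - P k f z) = 0"
    by (simp add: L2_inner_def)
  have "(L2_norm (\<lambda>z. (f z - P k f z) - - P k f z))\<^sup>2
      = (L2_norm (\<lambda>z. f z - P k f z))\<^sup>2 + (L2_norm (\<lambda>z. - P k f z))\<^sup>2"
    using L2_scale[OF proj_L2[OF f, of k], of "-1"]
    by (intro L2_norm_square_pythagoras L2_diff f proj_L2 *) simp
  then show ?thesis by (simp add: L2_norm_def)
qed

text \<open>\<open>P k\<close> fixes \<open>A k\<close> and does not increase norms, so a limit \<open>f\<close> of members of \<open>A k\<close> has distance \<open>0\<close>
  from \<open>P k f\<close>.\<close>

lemma closed_subspace: "L2_closed_subspace (A k)"
  unfolding L2_closed_subspace_def
proof (intro conjI ballI allI impI)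
  fix F f assume "(\<forall>n. F n \<in> A k) \<and> f \<in> L2 \<and> (\<lambda>n. L2_norm (\<lambda>z. F n z - f z)) \<longlonglongrightarrow> 0"
  then have F: "\<And>n. F n \<in> A k" and f: "f \<in> L2" and lim: "(\<lambda>n. L2_norm (\<lambda>z. F n z - f z)) \<longlonglongrightarrow> 0"
    by auto
  let ?a = "\<lambda>n. L2_norm (\<lambda>z. F n z - f z)"
  have sym: "L2_norm (\<lambda>z. f z - F n z) = ?a n" for n
    by (simp add: L2_norm_def norm_minus_commute)
  have "(L2_norm (\<lambda>z. f z - P k f z))\<^sup>2 \<le> 4 * (?a n)\<^sup>2" for n
  proof -
    have g: "(\<lambda>z. F n z - f z) \<in> L2" by (intro L2_diff f mem_L2[OF F])
    have "P k (\<lambda>z. F n z - f z) = (\<lambda>z. F n z - P k f z)"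
      using proj_diff[OF mem_L2[OF F[of n]] f, of k] proj_on[OF F, of k] by simp
    then have "(L2_norm (\<lambda>z. F n z - P k f z))\<^sup>2 \<le> (?a n)\<^sup>2"
      using norm_proj_diff[OF g, of k] by simp
    then show ?thesis
      using L2_norm_square_diff_triangle[OF f mem_L2[OF F[of n]] proj_L2[OF f, of k]] sym[of n] by simp
  qed
  moreover have "(\<lambda>n. 4 * (?a n)\<^sup>2) \<longlonglongrightarrow> 4 * 0\<^sup>2" by (intro tendsto_intros lim)
  ultimately have "(L2_norm (\<lambda>z. f z - P k f z))\<^sup>2 \<le> 4 * 0\<^sup>2"
    by (intro LIMSEQ_le_const[where X = "\<lambda>n. 4 * (?a n)\<^sup>2"]) auto
  then have "L2_norm (\<lambda>z. f z - P k f z) = 0" by simp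
  then show "\<exists>H\<in>A k. AE z in lborel. f z = H z"
    using AE_eq_if_L2_norm_diff_zero[OF f proj_L2[OF f]] proj_mem[OF f, of k] by blast
qed (use zero_mem add_mem scale_mem subset_L2 in auto)

definition remainder :: "nat \<Rightarrow> (complex \<Rightarrow> complex) \<Rightarrow> complex \<Rightarrow> complex"
  where "remainder n f z = f z - (\<Sum>k<n. P k f z)"

context
  fixes f assumes f: "f \<in> L2"
begin

lemma remainder_L2: "remainder n f \<in> L2"
  unfolding remainder_def by (intro L2_diff L2_sum f proj_L2)

lemma remainder_Suc: "remainder (Suc n) f = (\<lambda>z. remainder n f z - P n f z)"
  by (simp add: remainder_def fun_eq_iff)

lemma proj_remainder: "P j (remainder n f) = (if j < n then (\<lambda>z. 0) else P j f)"
proof (induction n)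
  case 0
  have "remainder 0 f = f" by (simp add: remainder_def fun_eq_iff)
  then show ?case by simp
next
  case (Suc n)
  show ?case
    unfolding remainder_Suc proj_diff[OF remainder_L2 proj_L2[OF f]] proj_on[OF proj_mem[OF f]] Suc
    by (auto simp: fun_eq_iff)
qed

text \<open>The difference is a combination of the functions \<open>P k f\<close> with \<open>k < n\<close>, and these \<open>P k\<close> annihilate
  the remainder.\<close>

lemma inner_remainder_diff:
  assumes "m \<le> n"
  shows "L2_inner (remainder n f) (\<lambda>z. remainder m f z - remainder n f z) = 0"
proof -
  have "L2_inner (remainder n f) (\<lambda>z. P k f z) = 0" if "k < n" for k
  proof -
    have "L2_inner (remainder n f) (P k f) = L2_inner (P k (remainder n f)) f"
      using proj_symmetric[OF remainder_L2 f] by simp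
    then show ?thesis using that by (simp add: proj_remainder L2_inner_zero)
  qed
  moreover have "remainder m f z - remainder n f z = (\<Sum>k\<in>{m..<n}. P k f z)" for z
    unfolding remainder_def using sum.atLeastLessThan_concat[OF le0 assms, of "\<lambda>k. P k f z"]
    by (simp add: atLeast0LessThan algebra_simps)
  moreover have "integrable lborel (\<lambda>z. remainder n f z * cnj (P k f z))" for k
    by (rule L2_mult_integrable(3)[OF remainder_L2 proj_L2[OF f]])
  ultimately show ?thesis
    unfolding L2_inner_def by (simp add: sum_distrib_left)
qed

lemma norm_remainder_diff:
  assumes "m \<le> n"
  shows "(L2_norm (\<lambda>z. remainder m f z - remainder n f z))\<^sup>2 = (L2_norm (remainder m f))\<^sup>2 - (L2_norm (remainder n f))\<^sup>2"
proof -
  have *: "L2_inner (remainder n f) (\<lambda>z. remainder n f z - remainder m f z) = 0"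
    using inner_remainder_diff[OF assms] L2_inner_diff(2)[OF remainder_L2 remainder_L2 remainder_L2, of n m n]
      L2_inner_diff(2)[OF remainder_L2 remainder_L2 remainder_L2, of n n m] by simp
  have "(L2_norm (\<lambda>z. remainder n f z - (remainder n f z - remainder m f z)))\<^sup>2
      = (L2_norm (remainder n f))\<^sup>2 + (L2_norm (\<lambda>z. remainder n f z - remainder m f z))\<^sup>2"
    by (intro L2_norm_square_pythagoras remainder_L2 L2_diff[OF remainder_L2 remainder_L2] *)
  moreover have "L2_norm (\<lambda>z. remainder n f z - remainder m f z) = L2_norm (\<lambda>z. remainder m f z - remainder n f z)"
    by (simp add: L2_norm_def norm_minus_commute)
  moreover have "(\<lambda>z. remainder n f z - (remainder n f z - remainder m f z)) = remainder m f"
    by (rule ext) simp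
  ultimately show ?thesis by simp
qed

text \<open>By Pythagoras the remainders form a Cauchy sequence. Every \<open>P k\<close> annihilates their limit, which is
  therefore \<open>0\<close> by totality.\<close>

lemma L2_norm_remainder_tendsto_0: "(\<lambda>n. L2_norm (remainder n f)) \<longlonglongrightarrow> 0"
proof -
  let ?a = "\<lambda>n. (L2_norm (remainder n f))\<^sup>2"
  have "decseq ?a"
  proof (rule decseq_SucI)
    fix n
    show "?a (Suc n) \<le> ?a n"
      using norm_remainder_diff[of n "Suc n"] zero_le_power2[of "L2_norm (\<lambda>z. remainder n f z - remainder (Suc n) f z)"]
      by simp
  qed
  then obtain L where "?a \<longlonglongrightarrow> L" by (metis decseq_convergent zero_le_power2)
  then have "Cauchy ?a" by (rule LIMSEQ_imp_Cauchy)
  have "\<exists>g\<in>L2. (\<lambda>n. L2_norm (\<lambda>z. remainder n f z - g z)) \<longlonglongrightarrow> 0"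
  proof (rule L2_complete[OF remainder_L2])
    fix e :: real assume "0 < e"
    then obtain N where N: "\<And>m n. m \<ge> N \<Longrightarrow> n \<ge> N \<Longrightarrow> \<bar>?a m - ?a n\<bar> < e"
      using \<open>Cauchy ?a\<close> unfolding Cauchy_def dist_real_def by meson
    have "(L2_norm (\<lambda>z. remainder m f z - remainder n f z))\<^sup>2 = \<bar>?a m - ?a n\<bar>" for m n
    proof (cases "m \<le> n")
      case True
      then show ?thesis using norm_remainder_diff[OF True] zero_le_power2[of "L2_norm (\<lambda>z. remainder m f z - remainder n f z)"] by simp
    next
      case False
      then have "n \<le> m" by simp
      moreover have "L2_norm (\<lambda>z. remainder n f z - remainder m f z) = L2_norm (\<lambda>z. remainder m f z - remainder n f z)"
        by (simp add: L2_norm_def norm_minus_commute)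
      ultimately show ?thesis
        using norm_remainder_diff[of n m] zero_le_power2[of "L2_norm (\<lambda>z. remainder m f z - remainder n f z)"] by simp
    qed
    then show "\<exists>N. \<forall>m\<ge>N. \<forall>n\<ge>N. (L2_norm (\<lambda>z. remainder m f z - remainder n f z))\<^sup>2 \<le> e"
      using N by (intro exI[of _ N]) (auto intro: less_imp_le)
  qed
  then obtain g where g: "g \<in> L2" and lim: "(\<lambda>n. L2_norm (\<lambda>z. remainder n f z - g z)) \<longlonglongrightarrow> 0" by blast
  have "P k g z = 0" for k z
  proof -
    obtain C where C: "\<And>h z. h \<in> L2 \<Longrightarrow> norm (P k h z) \<le> C * L2_norm h" using proj_bounded by meson
    have "norm (P k g z) \<le> C * L2_norm (\<lambda>z. remainder n f z - g z)" if "n > k" for n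
      using C[OF L2_diff[OF remainder_L2 g], of n z] that
      by (simp add: proj_diff[OF remainder_L2 g] proj_remainder)
    moreover have "(\<lambda>n. C * L2_norm (\<lambda>z. remainder n f z - g z)) \<longlonglongrightarrow> C * 0" by (intro tendsto_intros lim)
    ultimately have "norm (P k g z) \<le> C * 0"
      by (intro LIMSEQ_le_const[where X = "\<lambda>n. C * L2_norm (\<lambda>z. remainder n f z - g z)"]) (auto intro!: exI[of _ "Suc k"])
    then show ?thesis by simp
  qed
  then have "AE z in lborel. g z = 0" by (intro total[OF g]) auto
  then have "L2_norm (\<lambda>z. remainder n f z - g z) = L2_norm (remainder n f)" for n
    unfolding L2_norm_def using L2_measurable[OF remainder_L2] L2_measurable[OF g]
    by (intro arg_cong[where f = sqrt] integral_cong_AE) (auto elim!: eventually_mono)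
  then show ?thesis using lim by simp
qed

end

theorem orthogonal_decomposition: "L2_orthogonal_decomposition A"
  unfolding L2_orthogonal_decomposition_def
proof (intro conjI allI ballI impI)
  fix f assume f: "f \<in> L2"
  show "\<exists>F. (\<forall>k. F k \<in> A k) \<and> (\<lambda>n. L2_norm (\<lambda>z. f z - (\<Sum>k<n. F k z))) \<longlonglongrightarrow> 0"
    using proj_mem[OF f] L2_norm_remainder_tendsto_0[OF f] unfolding remainder_def
    by (intro exI[of _ "\<lambda>k. P k f"]) auto
qed (use closed_subspace orthogonal in auto)

end

section \<open>Integral operators dominated by a convolution\<close>

text \<open>Integral operators dominated by the convolution with an integrable function \<open>H\<close>. Boundedness of \<open>H\<close>
  makes the integrals converge for every \<open>z\<close>, and not only for almost every \<open>z\<close>.\<close>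

locale convolution_bounded_kernel =
  fixes K :: "complex \<Rightarrow> complex \<Rightarrow> complex" and H :: "complex \<Rightarrow> real" and C :: real
  assumes kernel_measurable: "(\<lambda>(z, w). K z w) \<in> borel_measurable (borel \<Otimes>\<^sub>M borel)"
    and H_integrable: "integrable lborel H"
    and H_even: "H (- u) = H u"
    and H_bounded: "H u \<le> C"
    and kernel_bound: "norm (K z w) \<le> H (z - w)"

begin

lemma H_nonneg: "0 \<le> H u"
  using order_trans[OF norm_ge_zero kernel_bound[of u 0]] by simp

lemma H_measurable [measurable]: "H \<in> borel_measurable borel"
  using borel_measurable_integrable[OF H_integrable] by simp

lemma kernel_measurable' [measurable]:
  "K z \<in> borel_measurable borel" "(\<lambda>z. K z w) \<in> borel_measurable borel"
  using measurable_compose[OF measurable_Pair1' kernel_measurable, of z]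
    measurable_compose[OF measurable_Pair2' kernel_measurable, of w] by simp_all

lemma H_shift: "integrable lborel (\<lambda>w. H (z - w))" "(LBINT w. H (z - w)) = (LBINT w. H w)"
proof -
  have *: "H (z - w) = H (- z + w)" for w using H_even[of "z - w"] by simp
  show "integrable lborel (\<lambda>w. H (z - w))"
    unfolding * by (rule lborel_integrable_translate[OF H_integrable])
  show "(LBINT w. H (z - w)) = (LBINT w. H w)"
    unfolding * by (rule lborel_integral_translate) simp
qed

lemma kernel_L2: "K z \<in> L2"
proof (rule L2I)
  have C: "0 \<le> C" using H_nonneg[of 0] H_bounded[of 0] by simp
  show "integrable lborel (\<lambda>w. (norm (K z w))\<^sup>2)"
  proof (rule Bochner_Integration.integrable_bound)
    show "integrable lborel (\<lambda>w. C * H (z - w))" using H_shift by simp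
    have "(norm (K z w))\<^sup>2 \<le> C * H (z - w)" for w
      unfolding power2_eq_square
      by (rule mult_mono) (use kernel_bound[of z w] order_trans[OF kernel_bound H_bounded] C in auto)
    then show "AE w in lborel. norm ((norm (K z w))\<^sup>2) \<le> norm (C * H (z - w))"
      using C H_nonneg by (auto simp: abs_mult)
  qed measurable
qed measurable

lemma integrable_kernel: "f \<in> L2 \<Longrightarrow> integrable lborel (\<lambda>w. K z w * f w)"
  by (rule L2_mult_integrable(2)[OF kernel_L2])

lemma integrable_convolution_square:
  assumes f: "f \<in> L2"
  shows "integrable (lborel \<Otimes>\<^sub>M lborel) (\<lambda>(z, w). H (z - w) * (norm (f w))\<^sup>2)"
    "integrable (lborel \<Otimes>\<^sub>M lborel) (\<lambda>(z, w). H (z - w) * (norm (f z))\<^sup>2)"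
proof -
  note [measurable] = L2_measurable[OF f]
  show 1: "integrable (lborel \<Otimes>\<^sub>M lborel) (\<lambda>(z, w). H (z - w) * (norm (f z))\<^sup>2)"
  proof (rule lborel_pair.Fubini_integrable)
    show "AE z in lborel. integrable lborel (\<lambda>w. case (z, w) of (z, w) \<Rightarrow> H (z - w) * (norm (f z))\<^sup>2)"
      using H_shift(1) by simp
    have "(LBINT w. norm (case (z, w) of (z, w) \<Rightarrow> H (z - w) * (norm (f z))\<^sup>2)) = (LBINT w. H w) * (norm (f z))\<^sup>2" for z
      using H_shift[of z] H_nonneg by (simp add: abs_mult)
    then show "integrable lborel (\<lambda>z. LBINT w. norm (case (z, w) of (z, w) \<Rightarrow> H (z - w) * (norm (f z))\<^sup>2))"
      using L2_square_integrable[OF f] by simp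
  qed measurable
  have "integrable (lborel \<Otimes>\<^sub>M lborel) (\<lambda>(z, w). case (w, z) of (z, w) \<Rightarrow> H (z - w) * (norm (f z))\<^sup>2)"
    by (rule lborel_pair.integrable_product_swap[OF 1])
  moreover have "H (w - z) = H (z - w)" for z w using H_even[of "z - w"] by simp
  ultimately show "integrable (lborel \<Otimes>\<^sub>M lborel) (\<lambda>(z, w). H (z - w) * (norm (f w))\<^sup>2)" by simp
qed

lemma integrable_kernel_pairing:
  assumes f: "f \<in> L2" and g: "g \<in> L2"
  shows "integrable (lborel \<Otimes>\<^sub>M lborel) (\<lambda>(z, w). K z w * f w * g z)"
proof (rule Bochner_Integration.integrable_bound)
  note [measurable] = L2_measurable[OF f] L2_measurable[OF g] kernel_measurable
  show "integrable (lborel \<Otimes>\<^sub>M lborel) (\<lambda>p. (case p of (z, w) \<Rightarrow> H (z - w) * (norm (f w))\<^sup>2)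
      + (case p of (z, w) \<Rightarrow> H (z - w) * (norm (g z))\<^sup>2))"
    by (intro Bochner_Integration.integrable_add integrable_convolution_square f g)
  show "(\<lambda>(z, w). K z w * f w * g z) \<in> borel_measurable (lborel \<Otimes>\<^sub>M lborel)"
  proof -
    have [measurable]: "(\<lambda>p. K (fst p) (snd p)) \<in> borel_measurable (borel \<Otimes>\<^sub>M borel)"
      using kernel_measurable by (simp add: case_prod_beta')
    have "(\<lambda>p. K (fst p) (snd p) * f (snd p) * g (fst p)) \<in> borel_measurable (borel \<Otimes>\<^sub>M borel)"
      by measurable
    moreover have "sets (lborel \<Otimes>\<^sub>M lborel) = sets (borel \<Otimes>\<^sub>M borel :: (complex \<times> complex) measure)"
      by (intro sets_pair_measure_cong) simp_all
    ultimately show ?thesis by (simp add: case_prod_beta' cong: measurable_cong_sets)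
  qed
  have "norm (K z w * f w * g z) \<le> H (z - w) * (norm (f w))\<^sup>2 + H (z - w) * (norm (g z))\<^sup>2" for z w
  proof -
    have "norm (f w) * norm (g z) \<le> (norm (f w))\<^sup>2 + (norm (g z))\<^sup>2"
      using sum_squares_bound[of "norm (f w)" "norm (g z)"] mult_nonneg_nonneg[OF norm_ge_zero norm_ge_zero, of "f w" "g z"]
      unfolding mult.assoc by linarith
    then have "norm (K z w) * (norm (f w) * norm (g z)) \<le> H (z - w) * ((norm (f w))\<^sup>2 + (norm (g z))\<^sup>2)"
      by (intro mult_mono kernel_bound) (auto simp: H_nonneg)
    then show ?thesis by (simp add: norm_mult algebra_simps)
  qed
  then show "AE p in lborel \<Otimes>\<^sub>M lborel. norm (case p of (z, w) \<Rightarrow> K z w * f w * g z)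
    \<le> norm ((case p of (z, w) \<Rightarrow> H (z - w) * (norm (f w))\<^sup>2) + (case p of (z, w) \<Rightarrow> H (z - w) * (norm (g z))\<^sup>2))"
    by (auto intro!: AE_I2 order_trans[OF _ abs_ge_self])
qed

lemma kernel_integral_swap:
  assumes f: "f \<in> L2" and g: "g \<in> L2"
  shows "(LBINT z. (LBINT w. K z w * f w) * g z) = (LBINT w. f w * (LBINT z. K z w * g z))"
proof -
  have "(LBINT z. (LBINT w. K z w * f w) * g z) = (LBINT z. (LBINT w. K z w * f w * g z))"
    by (simp del: integral_mult_right_zero integral_mult_left_zero add: integral_mult_left_zero[symmetric])
  also have "\<dots> = (LBINT w. (LBINT z. K z w * f w * g z))"
    using lborel_pair.Fubini_integral[OF integrable_kernel_pairing[OF f g]] by simp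
  also have "\<dots> = (LBINT w. f w * (LBINT z. K z w * g z))"
    by (simp add: mult.commute mult.left_commute del: integral_mult_right_zero integral_mult_left_zero
      add: integral_mult_right_zero[symmetric])
  finally show ?thesis .
qed

lemma kernel_integral_measurable:
  assumes f: "f \<in> L2"
  shows "(\<lambda>z. LBINT w. K z w * f w) \<in> borel_measurable borel"
proof -
  note [measurable] = L2_measurable[OF f]
  have [measurable]: "(\<lambda>p. K (fst p) (snd p)) \<in> borel_measurable (borel \<Otimes>\<^sub>M lborel)"
  proof -
    have "sets (borel \<Otimes>\<^sub>M lborel) = sets (borel \<Otimes>\<^sub>M borel :: (complex \<times> complex) measure)"
      by (intro sets_pair_measure_cong) simp_all
    then show ?thesis using kernel_measurable by (simp add: case_prod_beta' cong: measurable_cong_sets)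
  qed
  have "(\<lambda>p. K (fst p) (snd p) * f (snd p)) \<in> borel_measurable (borel \<Otimes>\<^sub>M lborel)" by measurable
  then show ?thesis
    by (intro lborel.borel_measurable_lebesgue_integral) (simp add: case_prod_beta')
qed

text \<open>Schur's test: split \<open>H = sqrt H * sqrt H\<close> and use the Cauchy--Schwarz inequality.\<close>

lemma kernel_integral_L2:
  assumes f: "f \<in> L2"
  shows "(\<lambda>z. LBINT w. K z w * f w) \<in> L2"
proof (rule L2I)
  note [measurable] = L2_measurable[OF f]
  let ?h = "LBINT w. H w"
  have bound: "(norm (LBINT w. K z w * f w))\<^sup>2 \<le> ?h * (LBINT w. H (z - w) * (norm (f w))\<^sup>2)" for z
  proof -
    let ?a = "\<lambda>w. complex_of_real (sqrt (H (z - w)))"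
    have a: "?a \<in> L2"
      by (rule L2I) (use H_shift(1)[of z] H_nonneg in auto)
    have af: "(\<lambda>w. ?a w * f w) \<in> L2"
    proof (rule L2I)
      have C: "0 \<le> C" using H_nonneg[of 0] H_bounded[of 0] by simp
      show "integrable lborel (\<lambda>w. (norm (?a w * f w))\<^sup>2)"
      proof (rule Bochner_Integration.integrable_bound)
        show "integrable lborel (\<lambda>w. C * (norm (f w))\<^sup>2)" using L2_square_integrable[OF f] by simp
        show "AE w in lborel. norm ((norm (?a w * f w))\<^sup>2) \<le> norm (C * (norm (f w))\<^sup>2)"
          using H_nonneg H_bounded C by (auto simp: norm_mult power_mult_distrib abs_mult intro!: mult_right_mono)
      qed measurable
    qed measurable
    have aa: "norm (?a w) * norm (?a w * f w) = H (z - w) * norm (f w)" for w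
      using H_nonneg by (simp add: norm_mult mult.assoc[symmetric])
    have "norm (LBINT w. K z w * f w) \<le> (LBINT w. norm (K z w * f w))" by simp
    also have "\<dots> \<le> (LBINT w. norm (?a w) * norm (?a w * f w))"
      unfolding aa
      by (rule integral_mono)
        (use integrable_norm[OF integrable_kernel[OF f, of z], unfolded norm_mult] L2_mult_integrable(1)[OF a af, unfolded aa] kernel_bound[of z]
          in \<open>auto simp: norm_mult intro!: mult_right_mono\<close>)
    also have "\<dots> \<le> L2_norm ?a * L2_norm (\<lambda>w. ?a w * f w)" by (rule L2_Cauchy_Schwarz[OF a af])
    finally have "(norm (LBINT w. K z w * f w))\<^sup>2 \<le> (L2_norm ?a * L2_norm (\<lambda>w. ?a w * f w))\<^sup>2"
      by (rule power_mono) simp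
    also have "\<dots> = ?h * (LBINT w. H (z - w) * (norm (f w))\<^sup>2)"
      using H_nonneg H_shift(2)[of z] by (simp add: power_mult_distrib L2_norm_square norm_mult)
    finally show ?thesis .
  qed
  show "integrable lborel (\<lambda>z. (norm (LBINT w. K z w * f w))\<^sup>2)"
  proof (rule Bochner_Integration.integrable_bound)
    show "integrable lborel (\<lambda>z. ?h * (LBINT w. H (z - w) * (norm (f w))\<^sup>2))"
      using lborel_pair.integrable_fst'[OF integrable_convolution_square(1)[OF f]] by simp
    show "(\<lambda>z. (norm (LBINT w. K z w * f w))\<^sup>2) \<in> borel_measurable lborel"
      using kernel_integral_measurable[OF f] by simp
    show "AE z in lborel. norm ((norm (LBINT w. K z w * f w))\<^sup>2) \<le> norm (?h * (LBINT w. H (z - w) * (norm (f w))\<^sup>2))"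
      using bound by (auto intro!: AE_I2 order_trans[OF _ abs_ge_self])
  qed
qed (rule kernel_integral_measurable[OF f])

end

section \<open>Differentiability classes and Wirtinger derivatives\<close>

lemma C_diff_differentiable: "C_diff (Suc n) f \<Longrightarrow> f differentiable (at x)"
  by simp

lemma C_diff_continuous: "C_diff n f \<Longrightarrow> continuous_on UNIV f"
proof (induction n)
  case (Suc n)
  then show ?case using C_diff_Suc_imp by blast
qed simp

lemma C_diff_dz:
  assumes "C_diff (Suc n) f"
  shows "C_diff n (dz f)" "C_diff n (dzbar f)"
proof -
  have *: "dz f = (\<lambda>z. (1/2) * (frechet_derivative f (at z) 1 + (- \<i>) * frechet_derivative f (at z) \<i>))"
    "dzbar f = (\<lambda>z. (1/2) * (frechet_derivative f (at z) 1 + \<i> * frechet_derivative f (at z) \<i>))"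
    by (auto simp: dz_def dzbar_def)
  have fd: "C_diff n (\<lambda>z. frechet_derivative f (at z) v)" for v using assms by simp
  show "C_diff n (dz f)" "C_diff n (dzbar f)"
    unfolding * by (rule C_diff_mult[OF C_diff_const C_diff_add[OF fd C_diff_mult[OF C_diff_const fd]]])+
qed

text \<open>The derivative is again the function times a function of class \<open>C\<^sup>n\<close>.\<close>

lemma C_diff_exp:
  fixes p :: "'a::real_normed_vector \<Rightarrow> complex"
  shows "C_diff n p \<Longrightarrow> C_diff n (\<lambda>x. exp (p x))"
proof (induction n arbitrary: p)
  case 0
  then show ?case by (simp add: continuous_on_exp)
next
  case (Suc n)
  have "((\<lambda>x. exp (p x)) has_derivative (\<lambda>v. exp (p x) * frechet_derivative p (at x) v)) (at x)" for x
    using has_derivative_compose[OF C_diff_has_derivative[OF Suc.prems] DERIV_exp[unfolded has_field_derivative_def]] .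
  moreover have "C_diff n (\<lambda>x. exp (p x) * frechet_derivative p (at x) v)" for v
    using Suc.prems by (intro C_diff_mult Suc.IH C_diff_Suc_imp[OF Suc.prems]) simp
  ultimately show ?case by (rule C_diff_SucI)
qed

lemma C_diff_translate: "C_diff n f \<Longrightarrow> C_diff n (\<lambda>u. f (z + u))"
proof (induction n arbitrary: f)
  case 0
  then show ?case by (auto intro!: continuous_on_compose2[of UNIV f] continuous_intros)
next
  case (Suc n)
  have "((\<lambda>u. f (z + u)) has_derivative frechet_derivative f (at (z + x))) (at x)" for x
  proof -
    have "((\<lambda>u. z + u) has_derivative (\<lambda>v. v)) (at x)" by (auto intro!: derivative_eq_intros)
    from has_derivative_compose[OF this C_diff_has_derivative[OF Suc.prems]] show ?thesis .
  qed
  moreover have "C_diff n (\<lambda>u. frechet_derivative f (at (z + u)) v)" for v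
    using Suc.prems Suc.IH[of "\<lambda>w. frechet_derivative f (at w) v"] by simp
  ultimately show ?case by (rule C_diff_SucI)
qed

lemma C_diff_cnj: "C_diff n f \<Longrightarrow> C_diff n (\<lambda>x. cnj (f x))"
  by (rule C_diff_bounded_linear[OF bounded_linear_cnj])

lemma C_diff_diff: "C_diff n f \<Longrightarrow> C_diff n g \<Longrightarrow> C_diff n (\<lambda>x. f x - g x)" for f g :: "_ \<Rightarrow> complex"
  using C_diff_add[OF _ C_diff_mult[OF C_diff_const[of n "-1"]], of f g] by simp

lemma C_diff_sum: "(\<And>j. j \<in> I \<Longrightarrow> C_diff n (g j)) \<Longrightarrow> C_diff n (\<lambda>z. \<Sum>j\<in>I. g j z)"
  by (induction I rule: infinite_finite_induct) (auto simp: C_diff_const intro!: C_diff_add)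

lemma has_derivative_imp_continuous_on:
  assumes "\<And>x. (f has_derivative f' x) (at x)"
  shows "continuous_on UNIV f"
  using has_derivative_continuous[OF assms] by (simp add: continuous_at_imp_continuous_on)

lemma dzbar_add:
  assumes "f differentiable (at z)" "g differentiable (at z)"
  shows "dzbar (\<lambda>w. f w + g w) z = dzbar f z + dzbar g z"
proof -
  have "((\<lambda>w. f w + g w) has_derivative
    (\<lambda>v. (dz f z + dz g z) * v + (dzbar f z + dzbar g z) * cnj v)) (at z)"
    by (rule has_derivative_eq_rhs[OF has_derivative_add[OF assms[THEN wirtinger_derivative]]])
      (simp add: fun_eq_iff algebra_simps)
  from dz_eqI[OF this] show ?thesis by auto
qed

lemma dz_linear: "dz (\<lambda>w. a * w) z = a" "dzbar (\<lambda>w. a * w) z = 0"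
proof -
  have "((\<lambda>w. a * w) has_derivative (\<lambda>v. a * v + 0 * cnj v)) (at z)"
    by (auto intro!: derivative_eq_intros)
  from dz_eqI[OF this] show "dz (\<lambda>w. a * w) z = a" "dzbar (\<lambda>w. a * w) z = 0" by auto
qed

lemma dz_const: "dz (\<lambda>w. c) z = 0" "dzbar (\<lambda>w. c) z = 0"
proof -
  have "((\<lambda>w. c) has_derivative (\<lambda>v. 0 * v + 0 * cnj v)) (at z)" by simp
  from dz_eqI[OF this] show "dz (\<lambda>w. c) z = 0" "dzbar (\<lambda>w. c) z = 0" .
qed

lemma dz_cmult:
  assumes "f differentiable (at z)"
  shows "dz (\<lambda>w. c * f w) z = c * dz f z" "dzbar (\<lambda>w. c * f w) z = c * dzbar f z"
  using dz_mult[of "\<lambda>w. c" z f] assms by (simp_all add: dz_const)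

section \<open>Gaussian moments\<close>

lemma power_exp_le:
  fixes x a :: real
  assumes a: "0 < a" and x: "0 \<le> x"
  shows "x ^ n \<le> fact n / a ^ n * exp (a * x)"
proof -
  have "summable (\<lambda>k. (a * x) ^ k /\<^sub>R fact k)" by (rule summable_exp_generic)
  then have "(a * x) ^ n /\<^sub>R fact n \<le> (\<Sum>k. (a * x) ^ k /\<^sub>R fact k)"
    using sum_le_suminf[of "\<lambda>k. (a * x) ^ k /\<^sub>R fact k" "{n}"] a x by simp
  then have "(a * x) ^ n / fact n \<le> exp (a * x)" by (simp add: exp_def divide_inverse mult.commute)
  then show ?thesis using a by (simp add: field_simps power_mult_distrib)
qed

lemma power_gaussian_bound:
  fixes c :: real
  assumes c: "0 < c"
  shows "\<exists>C>0. \<forall>x\<ge>0. x ^ n * exp (- c * x\<^sup>2) \<le> C * exp (- (c / 2) * x\<^sup>2)"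
proof (intro exI conjI allI impI)
  let ?C = "1 + fact n / (c / 2) ^ n"
  show "0 < ?C" using c by (simp add: add_pos_pos)
  fix x :: real assume x: "0 \<le> x"
  have "x ^ n \<le> 1 + (x\<^sup>2) ^ n"
  proof -
    have "2 * x ^ n \<le> 1 + (x ^ n)\<^sup>2" using sum_squares_bound[of 1 "x ^ n"] by simp
    moreover have "0 \<le> x ^ n" using x by simp
    ultimately have "x ^ n \<le> 1 + (x ^ n)\<^sup>2" by linarith
    then show ?thesis by (simp add: power_mult[symmetric] mult.commute)
  qed
  also have "\<dots> \<le> exp (c / 2 * x\<^sup>2) + fact n / (c / 2) ^ n * exp (c / 2 * x\<^sup>2)"
    using c by (intro add_mono power_exp_le) auto
  finally have "x ^ n * exp (- c * x\<^sup>2) \<le> ?C * exp (c / 2 * x\<^sup>2) * exp (- c * x\<^sup>2)"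
    by (intro mult_right_mono) (simp_all only: distrib_right mult_1_left exp_ge_zero)
  also have "\<dots> = ?C * exp (- (c / 2) * x\<^sup>2)"
  proof -
    have "exp (c / 2 * x\<^sup>2) * exp (- c * x\<^sup>2) = exp (- (c / 2) * x\<^sup>2)"
      unfolding exp_add[symmetric] by simp
    then show ?thesis by (simp only: mult.assoc)
  qed
  finally show "x ^ n * exp (- c * x\<^sup>2) \<le> ?C * exp (- (c / 2) * x\<^sup>2)" .
qed

definition gaussian_monomial :: "real \<Rightarrow> nat \<Rightarrow> complex \<Rightarrow> real"
  where "gaussian_monomial c n u = exp (- c * (norm u)\<^sup>2) * norm u ^ n"

lemma gaussian_monomial_nonneg: "0 \<le> gaussian_monomial c n u"
  by (simp add: gaussian_monomial_def)

lemma gaussian_monomial_measurable [measurable]: "gaussian_monomial c n \<in> borel_measurable borel"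
  unfolding gaussian_monomial_def by measurable

lemma gaussian_monomial_times_gaussian:
  "gaussian_monomial c n u * exp (- a * (norm u)\<^sup>2) = gaussian_monomial (c + a) n u"
proof -
  have "exp (- (c + a) * (norm u)\<^sup>2) = exp (- c * (norm u)\<^sup>2) * exp (- a * (norm u)\<^sup>2)"
    unfolding exp_add[symmetric] by (rule arg_cong[where f = exp]) (simp add: algebra_simps)
  then show ?thesis by (simp only: gaussian_monomial_def ac_simps)
qed

lemma gaussian_monomial_mult:
  "gaussian_monomial a m u * gaussian_monomial b n u = gaussian_monomial (a + b) (m + n) u"
  unfolding gaussian_monomial_def[of b] mult.assoc[symmetric] gaussian_monomial_times_gaussian
  by (simp add: gaussian_monomial_def power_add)

lemma gaussian_monomial_integrable:
  assumes c: "0 < c"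
  shows "integrable lborel (gaussian_monomial c n)"
proof -
  obtain C where C: "\<And>x. x \<ge> 0 \<Longrightarrow> x ^ n * exp (- c * x\<^sup>2) \<le> C * exp (- (c / 2) * x\<^sup>2)"
    using power_gaussian_bound[OF c, of n] by blast
  show ?thesis
  proof (rule Bochner_Integration.integrable_bound)
    show "integrable lborel (\<lambda>u::complex. C * exp (- (c / 2) * (norm u)\<^sup>2))"
      using complex_gaussian_scaled(1)[of "c / 2"] c by simp
    show "AE u in lborel. norm (gaussian_monomial c n u) \<le> norm (C * exp (- (c / 2) * (norm u)\<^sup>2))"
    proof (rule AE_I2)
      fix u :: complex
      show "norm (gaussian_monomial c n u) \<le> norm (C * exp (- (c / 2) * (norm u)\<^sup>2))"
        using C[OF norm_ge_zero, of u] order_trans[OF _ abs_ge_self]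
        by (simp add: gaussian_monomial_def mult.commute)
    qed
  qed measurable
qed

lemma gaussian_monomial_bounded:
  assumes B: "0 < B"
  shows "\<exists>C. \<forall>u. gaussian_monomial B n u \<le> C"
proof -
  obtain C where C: "C > 0" "\<And>x. x \<ge> 0 \<Longrightarrow> x ^ n * exp (- B * x\<^sup>2) \<le> C * exp (- (B / 2) * x\<^sup>2)"
    using power_gaussian_bound[OF B, of n] by blast
  have "gaussian_monomial B n u \<le> C * 1" for u
  proof -
    have "gaussian_monomial B n u \<le> C * exp (- (B / 2) * (norm u)\<^sup>2)"
      using C(2)[OF norm_ge_zero, of u] by (simp add: gaussian_monomial_def mult.commute)
    also have "\<dots> \<le> C * 1" using C(1) B by (intro mult_left_mono) auto
    finally show ?thesis .
  qed
  then show ?thesis by blast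
qed

lemma gaussian_monomial_L2:
  assumes c: "0 < c"
  shows "(\<lambda>u. complex_of_real (gaussian_monomial c n u)) \<in> L2"
proof (rule L2I)
  have "(gaussian_monomial c n u)\<^sup>2 = gaussian_monomial (2 * c) (2 * n) u" for u
    by (simp add: gaussian_monomial_def power_mult_distrib power_mult[symmetric] exp_double[symmetric] ac_simps)
  then show "integrable lborel (\<lambda>u. (norm (complex_of_real (gaussian_monomial c n u)))\<^sup>2)"
    using gaussian_monomial_integrable[of "2 * c" "2 * n"] c by simp
qed measurable

lemma gaussian_shift_L2:
  assumes c: "0 < c"
  shows "(\<lambda>w. complex_of_real (exp (- c * (norm (z0 - w))\<^sup>2))) \<in> L2"
proof (rule L2I)
  have "(exp (- c * (norm (z0 - w))\<^sup>2))\<^sup>2 = gaussian_monomial (2 * c) 0 (- z0 + w)" for w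
    unfolding exp_double[symmetric] by (simp add: gaussian_monomial_def norm_minus_commute[of z0 w])
  then show "integrable lborel (\<lambda>w. (norm (complex_of_real (exp (- c * (norm (z0 - w))\<^sup>2))))\<^sup>2)"
    using lborel_integrable_translate[OF gaussian_monomial_integrable[of "2 * c" 0], of "- z0"] c
    by (simp del: of_real_exp)
qed measurable

definition radial_moment :: "real \<Rightarrow> nat \<Rightarrow> (complex \<Rightarrow> complex) \<Rightarrow> complex"
  where "radial_moment c i F = (LBINT u. of_real (gaussian_monomial c (2 * i) u) * F u)"

lemma radial_moment_integrable:
  assumes "0 < c" "F \<in> L2"
  shows "integrable lborel (\<lambda>u. of_real (gaussian_monomial c n u) * F u)"
    "integrable lborel (\<lambda>u. gaussian_monomial c n u * norm (F u))"
  using L2_mult_integrable(1,2)[OF gaussian_monomial_L2[OF assms(1)] assms(2), of n]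
  by (simp_all add: gaussian_monomial_nonneg)

text \<open>Write \<open>exp (- (3 / 2) c r) = exp (- c r) exp (- (c / 2) r)\<close> and expand the second factor. The partial sums
  multiplied by \<open>exp (- c r)\<close> are bounded by \<open>exp (- (c / 2) r)\<close>, so integration term by term is justified. Any
  factor between \<open>1\<close> and \<open>2\<close> would do in place of \<open>3 / 2\<close>.\<close>

lemma radial_moments_vanish_extend:
  assumes c: "0 < c" and F: "F \<in> L2" and zero: "\<And>i. radial_moment c i F = 0"
  shows "radial_moment (3 / 2 * c) i F = 0"
proof -
  note [measurable] = L2_measurable[OF F]
  define s where "s n u = (\<Sum>j<n. (- (c / 2)) ^ j / fact j * gaussian_monomial c (2 * (i + j)) u)" for n u
  have s: "s n u = gaussian_monomial c (2 * i) u * (\<Sum>j<n. (- (c / 2) * (norm u)\<^sup>2) ^ j /\<^sub>R fact j)" for n u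
    unfolding s_def sum_distrib_left
  proof (rule sum.cong[OF refl])
    fix j
    have "norm u ^ (2 * (i + j)) = norm u ^ (2 * i) * ((norm u)\<^sup>2) ^ j"
      by (simp add: power_mult[symmetric] power_add[symmetric] distrib_left)
    then show "(- (c / 2)) ^ j / fact j * gaussian_monomial c (2 * (i + j)) u
        = gaussian_monomial c (2 * i) u * ((- (c / 2) * (norm u)\<^sup>2) ^ j /\<^sub>R fact j)"
      by (simp only: gaussian_monomial_def power_mult_distrib divide_inverse real_scaleR_def ac_simps)
  qed
  have "(LBINT u. of_real (s n u) * F u) = 0" for n
  proof -
    have "(LBINT u. of_real (s n u) * F u) =
        (LBINT u. (\<Sum>j<n. of_real ((- (c / 2)) ^ j / fact j) * (of_real (gaussian_monomial c (2 * (i + j)) u) * F u)))"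
      by (simp add: s_def sum_distrib_right mult.assoc)
    also have "\<dots> = (\<Sum>j<n. of_real ((- (c / 2)) ^ j / fact j) * radial_moment c (i + j) F)"
      unfolding radial_moment_def
      by (subst Bochner_Integration.integral_sum)
        (simp_all only: integrable_mult_right[OF radial_moment_integrable(1)[OF c F]] integral_mult_right_zero)
    finally show ?thesis using zero by simp
  qed
  moreover have "(\<lambda>n. LBINT u. of_real (s n u) * F u) \<longlonglongrightarrow> radial_moment (3 / 2 * c) i F"
    unfolding radial_moment_def
  proof (rule integral_dominated_convergence)
    show "integrable lborel (\<lambda>u. gaussian_monomial (c / 2) (2 * i) u * norm (F u))"
      using c by (intro radial_moment_integrable F) auto
    show "AE u in lborel. (\<lambda>n. of_real (s n u) * F u) \<longlonglongrightarrow> of_real (gaussian_monomial (3 / 2 * c) (2 * i) u) * F u"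
    proof (intro AE_I2 tendsto_intros)
      fix u
      have "(\<lambda>n. s n u) \<longlonglongrightarrow> gaussian_monomial c (2 * i) u * exp (- (c / 2) * (norm u)\<^sup>2)"
        unfolding s by (rule tendsto_mult_left[OF exp_converges[unfolded sums_def]])
      then show "(\<lambda>n. s n u) \<longlonglongrightarrow> gaussian_monomial (3 / 2 * c) (2 * i) u"
        unfolding gaussian_monomial_times_gaussian by simp
    qed
    show "AE u in lborel. norm (of_real (s n u) * F u) \<le> gaussian_monomial (c / 2) (2 * i) u * norm (F u)" for n
    proof (rule AE_I2)
      fix u :: complex
      let ?x = "c / 2 * (norm u)\<^sup>2"
      have "\<bar>\<Sum>j<n. (- (c / 2) * (norm u)\<^sup>2) ^ j /\<^sub>R fact j\<bar> \<le> (\<Sum>j<n. \<bar>(- (c / 2) * (norm u)\<^sup>2) ^ j /\<^sub>R fact j\<bar>)"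
        by (rule sum_abs)
      also have "\<dots> = (\<Sum>j<n. ?x ^ j /\<^sub>R fact j)"
        using c by (simp add: abs_mult power_abs)
      also have "\<dots> \<le> exp ?x"
        unfolding exp_def using c by (intro sum_le_suminf summable_exp_generic) auto
      finally have "\<bar>s n u\<bar> \<le> gaussian_monomial c (2 * i) u * exp ?x"
        unfolding s by (simp add: abs_mult gaussian_monomial_nonneg mult_left_mono)
      also have "\<dots> = gaussian_monomial (c / 2) (2 * i) u"
        using gaussian_monomial_times_gaussian[of c "2 * i" u "- (c / 2)"] by simp
      finally show "norm (of_real (s n u) * F u) \<le> gaussian_monomial (c / 2) (2 * i) u * norm (F u)"
        by (simp add: norm_mult mult_right_mono)
    qed
  qed (auto simp: s_def)
  ultimately have "(\<lambda>n. 0) \<longlonglongrightarrow> radial_moment (3 / 2 * c) i F" by simp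
  from LIMSEQ_unique[OF tendsto_const this] show ?thesis by simp
qed

text \<open>The Gaussians \<open>c / \<pi> exp (- c |u|\<^sup>2)\<close> form an approximate identity. Since \<open>F\<close> is only square
  integrable, it is split into a part near the origin, bounded by continuity, and a remote part, whose
  contribution is exponentially small.\<close>

lemma radial_moment_approximate_identity:
  assumes F: "F \<in> L2" and cont: "isCont F 0"
  shows "((\<lambda>c. of_real (c / pi) * radial_moment c 0 F) \<longlongrightarrow> F 0) at_top"
proof -
  note [measurable] = L2_measurable[OF F]
  obtain \<delta> where \<delta>: "\<delta> > 0" and near: "\<And>u. norm u < \<delta> \<Longrightarrow> norm (F u) \<le> norm (F 0) + 1"
  proof -
    have "\<forall>\<^sub>F u in nhds 0. dist (F u) (F 0) < 1"
      using cont unfolding isCont_def tendsto_at_iff_tendsto_nhds by (rule tendstoD) simp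
    then obtain \<delta> where d: "\<delta> > 0" "\<And>u. dist u 0 < \<delta> \<Longrightarrow> dist (F u) (F 0) < 1"
      unfolding eventually_nhds_metric by auto
    have "norm (F u) \<le> norm (F 0) + 1" if "norm u < \<delta>" for u
      using d(2)[of u] that norm_triangle_ineq2[of "F u" "F 0"] by (simp add: dist_norm)
    then show ?thesis using that d(1) by blast
  qed
  define G where "G u = (if norm u < \<delta> then F u else 0)" for u
  define R where "R u = (if norm u < \<delta> then 0 else F u)" for u
  have [measurable]: "G \<in> borel_measurable borel" "R \<in> borel_measurable borel"
    unfolding G_def R_def by measurable
  have GL2: "G \<in> L2"
    by (rule L2_bound[OF F]) (measurable, simp add: G_def)
  have RL2: "R \<in> L2"
    by (rule L2_bound[OF F]) (measurable, simp add: R_def)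
  have split: "radial_moment c 0 F = radial_moment c 0 G + radial_moment c 0 R" if "c > 0" for c
  proof -
    have "F u = G u + R u" for u by (simp add: G_def R_def)
    then show ?thesis
      unfolding radial_moment_def
      using radial_moment_integrable(1)[OF that GL2, of "2 * 0"] radial_moment_integrable(1)[OF that RL2, of "2 * 0"]
      by (simp add: distrib_left)
  qed
  have lim1: "((\<lambda>c. LBINT v. of_real (exp (- (norm v)\<^sup>2)) * G ((1 / sqrt c) *\<^sub>R v))
      \<longlongrightarrow> (LBINT v. of_real (exp (- (norm (v::complex))\<^sup>2)) * F 0)) at_top"
  proof (rule integral_dominated_convergence_at_top)
    show "integrable lborel (\<lambda>v::complex. exp (- (norm v)\<^sup>2) * (norm (F 0) + 1))"
      using complex_gaussian by (simp add: has_bochner_integral_iff)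
    show "\<forall>\<^sub>F c in at_top. AE v in lborel. norm (of_real (exp (- (norm v)\<^sup>2)) * G ((1 / sqrt c) *\<^sub>R v)) \<le> exp (- (norm v)\<^sup>2) * (norm (F 0) + 1)"
      using near by (intro always_eventually allI AE_I2) (simp add: norm_mult G_def)
    show "AE v in lborel. ((\<lambda>c. of_real (exp (- (norm v)\<^sup>2)) * G ((1 / sqrt c) *\<^sub>R v)) \<longlongrightarrow> of_real (exp (- (norm v)\<^sup>2)) * F 0) at_top"
    proof (intro AE_I2 tendsto_intros)
      fix v :: complex
      have "((\<lambda>c. 1 / sqrt c) \<longlongrightarrow> 0) at_top"
        by (intro tendsto_divide_0[OF tendsto_const] filterlim_at_top_imp_at_infinity sqrt_at_top)
      then have "((\<lambda>c. (1 / sqrt c) *\<^sub>R v) \<longlongrightarrow> 0 *\<^sub>R v) at_top" by (intro tendsto_intros)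
      then have lim0: "((\<lambda>c. (1 / sqrt c) *\<^sub>R v) \<longlongrightarrow> 0) at_top" by simp
      have "isCont G 0"
      proof -
        have "\<forall>\<^sub>F u in nhds 0. G u = F u"
          unfolding eventually_nhds_metric G_def using \<delta> by auto
        then show ?thesis using cont isCont_cong[of G F 0] by simp
      qed
      from isCont_tendsto_compose[OF this lim0] show "((\<lambda>c. G ((1 / sqrt c) *\<^sub>R v)) \<longlongrightarrow> F 0) at_top"
        using \<delta> by (simp add: G_def)
    qed
  qed measurable
  have val: "(LBINT v. of_real (exp (- (norm (v::complex))\<^sup>2)) * F 0) = of_real pi * F 0"
  proof -
    have "(LBINT v. complex_of_real (exp (- (norm (v::complex))\<^sup>2))) = of_real pi"
      using complex_gaussian by (simp add: has_bochner_integral_iff del: of_real_exp)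
    moreover have "integrable lborel (\<lambda>v::complex. complex_of_real (exp (- (norm v)\<^sup>2)))"
      using complex_gaussian by (simp add: has_bochner_integral_iff del: of_real_exp)
    ultimately show ?thesis by simp
  qed
  have eq: "(LBINT v. of_real (exp (- (norm v)\<^sup>2)) * G ((1 / sqrt c) *\<^sub>R v)) = of_real c * radial_moment c 0 G"
    if "c > 0" for c
  proof -
    have "radial_moment c 0 G = (1 / sqrt c)\<^sup>2 *\<^sub>R (LBINT v. of_real (gaussian_monomial c (2 * 0) ((1 / sqrt c) *\<^sub>R v)) * G ((1 / sqrt c) *\<^sub>R v))"
      unfolding radial_moment_def using that by (intro lborel_integral_scale) auto
    moreover have "gaussian_monomial c (2 * 0) ((1 / sqrt c) *\<^sub>R v) = exp (- (norm v)\<^sup>2)" for v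
      using that by (simp add: gaussian_monomial_def power_divide)
    ultimately show ?thesis using that by (simp add: power_divide scaleR_conv_of_real)
  qed
  have ev: "\<forall>\<^sub>F c in at_top. (LBINT v. of_real (exp (- (norm v)\<^sup>2)) * G ((1 / sqrt c) *\<^sub>R v)) = of_real c * radial_moment c 0 G"
    using eventually_gt_at_top[of 0] by (rule eventually_mono) (rule eq)
  have lim: "((\<lambda>c. of_real c * radial_moment c 0 G) \<longlongrightarrow> of_real pi * F 0) at_top"
    by (rule Lim_transform_eventually[OF lim1[unfolded val] ev])
  have rest: "((\<lambda>c. of_real c * radial_moment c 0 R) \<longlongrightarrow> 0) at_top"
  proof (rule Lim_null_comparison)
    let ?I = "LBINT u. gaussian_monomial 1 0 u * norm (F u)"
    show "\<forall>\<^sub>F c in at_top. norm (of_real c * radial_moment c 0 R) \<le> c * exp (- (c - 1) * \<delta>\<^sup>2) * ?I"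
      using eventually_ge_at_top[of 1]
    proof eventually_elim
      fix c :: real assume c: "1 \<le> c"
      have "norm (radial_moment c 0 R) \<le> (LBINT u. norm (of_real (gaussian_monomial c (2 * 0) u) * R u))"
        unfolding radial_moment_def by simp
      also have "\<dots> \<le> (LBINT u. exp (- (c - 1) * \<delta>\<^sup>2) * (gaussian_monomial 1 0 u * norm (F u)))"
      proof (rule integral_mono)
        show "integrable lborel (\<lambda>u. norm (of_real (gaussian_monomial c (2 * 0) u) * R u))"
          using c by (intro integrable_norm radial_moment_integrable RL2) auto
        show "integrable lborel (\<lambda>u. exp (- (c - 1) * \<delta>\<^sup>2) * (gaussian_monomial 1 0 u * norm (F u)))"
          using radial_moment_integrable(2)[OF zero_less_one F, of 0] by simp
        fix u
        show "norm (of_real (gaussian_monomial c (2 * 0) u) * R u) \<le> exp (- (c - 1) * \<delta>\<^sup>2) * (gaussian_monomial 1 0 u * norm (F u))"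
        proof (cases "norm u < \<delta>")
          case False
          then have "(c - 1) * \<delta>\<^sup>2 \<le> (c - 1) * (norm u)\<^sup>2" using c \<delta> by (intro mult_left_mono power_mono) auto
          then have "exp (- c * (norm u)\<^sup>2) \<le> exp (- (c - 1) * \<delta>\<^sup>2) * exp (- 1 * (norm u)\<^sup>2)"
            unfolding exp_add[symmetric] exp_le_cancel_iff by (simp add: algebra_simps)
          then show ?thesis using False
            by (simp add: R_def norm_mult gaussian_monomial_def mult.assoc[symmetric] mult_right_mono del: of_real_exp)
        qed (simp add: R_def gaussian_monomial_nonneg)
      qed
      finally have "norm (radial_moment c 0 R) \<le> exp (- (c - 1) * \<delta>\<^sup>2) * ?I" by simp
      then show "norm (of_real c * radial_moment c 0 R) \<le> c * exp (- (c - 1) * \<delta>\<^sup>2) * ?I"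
        using c by (simp add: norm_mult mult.assoc mult_left_mono)
    qed
    have "((\<lambda>c. c * exp (- (c - 1) * \<delta>\<^sup>2)) \<longlongrightarrow> 0) at_top"
      using \<delta> by real_asymp
    from tendsto_mult_left_zero[OF this] show "((\<lambda>c. c * exp (- (c - 1) * \<delta>\<^sup>2) * ?I) \<longlongrightarrow> 0) at_top" .
  qed
  have "((\<lambda>c. of_real (1 / pi) * (of_real c * radial_moment c 0 G + of_real c * radial_moment c 0 R))
      \<longlongrightarrow> of_real (1 / pi) * (of_real pi * F 0 + 0)) at_top"
    by (intro tendsto_intros lim rest)
  moreover have "\<forall>\<^sub>F c in at_top. of_real (1 / pi) * (of_real c * radial_moment c 0 G + of_real c * radial_moment c 0 R)
      = of_real (c / pi) * radial_moment c 0 F"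
    using eventually_gt_at_top[of 0] by eventually_elim (simp add: split algebra_simps)
  ultimately have "((\<lambda>c. of_real (c / pi) * radial_moment c 0 F) \<longlongrightarrow> of_real (1 / pi) * (of_real pi * F 0 + 0)) at_top"
    by (rule Lim_transform_eventually)
  then show ?thesis by simp
qed

section \<open>The Landau operator\<close>

definition landau :: "real \<Rightarrow> (complex \<Rightarrow> complex) \<Rightarrow> complex \<Rightarrow> complex"
  where "landau B F z = - dz (dzbar F) z - B * (z * dz F z - cnj z * dzbar F z)
    + complex_of_real ((B * norm z)\<^sup>2) * F z"

text \<open>The lowering operator \<open>\<partial>bar + B z\<close>; its formal adjoint is \<open>- \<partial> + B cnj z\<close>.\<close>

definition landau_lower :: "real \<Rightarrow> (complex \<Rightarrow> complex) \<Rightarrow> complex \<Rightarrow> complex"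
  where "landau_lower B F z = dzbar F z + B * z * F z"

lemma C_diff_landau_lower: "C_diff (Suc n) F \<Longrightarrow> C_diff n (landau_lower B F)"
  unfolding landau_lower_def[abs_def]
  by (rule C_diff_add[OF C_diff_dz(2) C_diff_mult[OF C_diff_mult[OF C_diff_const C_diff_id] C_diff_Suc_imp]])

lemma landau_factor:
  assumes F: "C_diff 2 F"
  shows "landau B F z = - dz (landau_lower B F) z + B * cnj z * landau_lower B F z + B * F z"
proof -
  have F: "C_diff (Suc (Suc 0)) F" using F by (simp only: numeral_2_eq_2)
  note d = C_diff_differentiable[OF F] C_diff_differentiable[OF C_diff_dz(2)[OF F]]
  have l: "(\<lambda>w. complex_of_real B * w) differentiable (at z)"
    by (rule C_diff_differentiable[where n = 0]) (intro C_diff_mult C_diff_const C_diff_id)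
  have "dz (landau_lower B F) z = dz (dzbar F) z + (B * F z + B * z * dz F z)"
    unfolding landau_lower_def[abs_def] using d l
    by (simp add: dz_add dz_mult(1) differentiable_mult dz_linear)
  moreover have "complex_of_real ((B * norm z)\<^sup>2) = B * B * (z * cnj z)"
    unfolding power_mult_distrib of_real_mult complex_norm_square by (simp add: power2_eq_square)
  ultimately show ?thesis
    unfolding landau_def landau_lower_def by (simp only:) (simp add: algebra_simps)
qed

lemma landau_cmult:
  assumes F: "C_diff 2 F"
  shows "landau B (\<lambda>z. c * F z) z = c * landau B F z"
proof -
  have F2: "C_diff (Suc (Suc 0)) F" using F by (simp only: numeral_2_eq_2)
  have lower: "landau_lower B (\<lambda>z. c * F z) = (\<lambda>z. c * landau_lower B F z)"
    by (rule ext) (simp add: landau_lower_def dz_cmult[OF C_diff_differentiable[OF F2]] algebra_simps)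
  show ?thesis
    unfolding landau_factor[OF C_diff_mult[OF C_diff_const F]] landau_factor[OF F] lower
    by (simp add: dz_cmult[OF C_diff_differentiable[OF C_diff_landau_lower[OF F2]]] algebra_simps)
qed

lemma landau_add:
  assumes F: "C_diff 2 F" and H: "C_diff 2 H"
  shows "landau B (\<lambda>z. F z + H z) z = landau B F z + landau B H z"
proof -
  have F2: "C_diff (Suc (Suc 0)) F" and H2: "C_diff (Suc (Suc 0)) H" using F H by (simp_all only: numeral_2_eq_2)
  have lower: "landau_lower B (\<lambda>z. F z + H z) = (\<lambda>z. landau_lower B F z + landau_lower B H z)"
    by (rule ext) (simp add: landau_lower_def dzbar_add[OF C_diff_differentiable[OF F2] C_diff_differentiable[OF H2]] algebra_simps)
  show ?thesis
    unfolding landau_factor[OF C_diff_add[OF F H]] landau_factor[OF F] landau_factor[OF H] lower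
    by (simp add: dz_add[OF C_diff_differentiable[OF C_diff_landau_lower[OF F2]] C_diff_differentiable[OF C_diff_landau_lower[OF H2]]] algebra_simps)
qed

text \<open>The translation by \<open>z\<close>, corrected by the phase that compensates the change of gauge; this makes it commute
  with the Landau operator.\<close>

definition magnetic_translation :: "real \<Rightarrow> complex \<Rightarrow> (complex \<Rightarrow> complex) \<Rightarrow> complex \<Rightarrow> complex"
  where "magnetic_translation B z F u = exp (of_real B * (z * cnj u - cnj z * u)) * F (z + u)"

lemma norm_magnetic_phase: "norm (exp (of_real B * (z * cnj u - cnj z * u))) = 1"
  by (simp add: norm_exp_eq_Re)

lemma magnetic_translation_0: "magnetic_translation B z F 0 = F z"
  by (simp add: magnetic_translation_def)

lemma L2_magnetic_translation:
  assumes F: "F \<in> L2"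
  shows "magnetic_translation B z F \<in> L2"
proof (rule L2_bound[OF L2_translate[OF F, of z]])
  note [measurable] = L2_measurable[OF F]
  have [measurable]: "(\<lambda>u. exp (of_real B * (z * cnj u - cnj z * u))) \<in> borel_measurable borel"
    by (intro borel_measurable_continuous_onI continuous_intros)
  show "magnetic_translation B z F \<in> borel_measurable borel"
    unfolding magnetic_translation_def by measurable
qed (simp add: magnetic_translation_def norm_mult norm_magnetic_phase)

lemma C_diff_magnetic_translation:
  assumes F: "C_diff n F"
  shows "C_diff n (magnetic_translation B z F)"
  unfolding magnetic_translation_def[abs_def]
  by (intro C_diff_mult C_diff_exp C_diff_diff C_diff_const C_diff_cnj C_diff_id C_diff_translate F)

lemma magnetic_translation_dz:
  assumes F: "F differentiable (at (z + u))"
  shows "dz (magnetic_translation B z F) u = magnetic_translation B z (dz F) u - B * cnj z * magnetic_translation B z F u"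
    "dzbar (magnetic_translation B z F) u = magnetic_translation B z (dzbar F) u + B * z * magnetic_translation B z F u"
proof -
  let ?e = "\<lambda>u. exp (of_real B * (z * cnj u - cnj z * u))"
  have "((\<lambda>u. of_real B * (z * cnj u - cnj z * u)) has_derivative (\<lambda>v. of_real B * (z * cnj v - cnj z * v))) (at u)"
    by (intro has_derivative_mult_right has_derivative_diff has_derivative_cnj has_derivative_ident)
  from has_derivative_compose[OF this DERIV_exp[unfolded has_field_derivative_def]]
  have e: "(?e has_derivative (\<lambda>v. ?e u * (of_real B * (z * cnj v - cnj z * v)))) (at u)" .
  have "((\<lambda>u. z + u) has_derivative (\<lambda>v. v)) (at u)" by (auto intro!: derivative_eq_intros)
  from has_derivative_compose[OF this wirtinger_derivative[OF F]]
  have s: "((\<lambda>u. F (z + u)) has_derivative (\<lambda>v. dz F (z + u) * v + dzbar F (z + u) * cnj v)) (at u)" .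
  have "(magnetic_translation B z F has_derivative
      (\<lambda>v. (magnetic_translation B z (dz F) u - B * cnj z * magnetic_translation B z F u) * v
        + (magnetic_translation B z (dzbar F) u + B * z * magnetic_translation B z F u) * cnj v)) (at u)"
    unfolding magnetic_translation_def[abs_def]
    by (rule has_derivative_eq_rhs[OF has_derivative_mult[OF e s]]) (simp add: fun_eq_iff algebra_simps)
  from dz_eqI[OF this]
  show "dz (magnetic_translation B z F) u = magnetic_translation B z (dz F) u - B * cnj z * magnetic_translation B z F u"
    "dzbar (magnetic_translation B z F) u = magnetic_translation B z (dzbar F) u + B * z * magnetic_translation B z F u" .
qed

lemma landau_magnetic_translation:
  assumes F: "C_diff 2 F"
  shows "landau B (magnetic_translation B z F) u = magnetic_translation B z (landau B F) u"
proof -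
  have F2: "C_diff (Suc (Suc 0)) F" using F by (simp only: numeral_2_eq_2)
  have lower: "landau_lower B (magnetic_translation B z F) = magnetic_translation B z (landau_lower B F)"
    by (rule ext) (simp add: landau_lower_def magnetic_translation_dz[OF C_diff_differentiable[OF F2]],
        simp add: magnetic_translation_def landau_lower_def algebra_simps)
  show ?thesis
    unfolding landau_factor[OF C_diff_magnetic_translation[OF F]] lower
    by (simp add: magnetic_translation_dz[OF C_diff_differentiable[OF C_diff_landau_lower[OF F2]]])
      (simp add: magnetic_translation_def landau_factor[OF F] algebra_simps)
qed

section \<open>Green's identity for radial test functions\<close>

lemma frechet_derivative_outside_support:
  fixes f :: "complex \<Rightarrow> complex"
  assumes "\<And>z. R < norm z \<Longrightarrow> f z = 0" "R < norm z"
  shows "frechet_derivative f (at z) = (\<lambda>v. 0)"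
proof -
  have "((\<lambda>w. 0) has_derivative (\<lambda>v. 0)) (at z)" by simp
  then have "(f has_derivative (\<lambda>v. 0)) (at z)"
    by (rule has_derivative_transform_within_open[OF _ open_Compl[OF closed_cball[of 0 R]]]) (use assms in auto)
  then show ?thesis using frechet_derivative_at by metis
qed

text \<open>Differentiate the constant \<open>t \<mapsto> \<integral> f (w + t v) dw\<close> at \<open>0\<close>.\<close>

lemma integral_frechet_derivative_compact_support:
  fixes f :: "complex \<Rightarrow> complex"
  assumes f: "C_diff (Suc 0) f" and supp: "\<And>z. R < norm z \<Longrightarrow> f z = 0"
  shows "integrable lborel (\<lambda>w. frechet_derivative f (at w) v)"
    "(LBINT w. frechet_derivative f (at w) v) = 0"
proof -
  let ?f' = "\<lambda>w. frechet_derivative f (at w) v"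
  have f'c: "continuous_on UNIV ?f'" using f by simp
  have supp': "?f' w = 0" if "R < norm w" for w
    using frechet_derivative_outside_support[OF supp that] by simp
  show int': "integrable lborel ?f'"
    by (rule compact_support_integrable[OF f'c supp'])
  have int: "integrable lborel f"
    by (rule compact_support_integrable[OF C_diff_continuous[OF f] supp])
  have [measurable]: "?f' \<in> borel_measurable borel" "f \<in> borel_measurable borel"
    using int int' by auto
  obtain M where M: "\<And>w. norm (?f' w) \<le> M" "0 \<le> M"
  proof -
    have "bounded (?f' ` cball 0 R)"
      by (intro compact_imp_bounded compact_continuous_image continuous_on_subset[OF f'c]) auto
    then obtain M where M: "M > 0" "\<And>w. norm w \<le> R \<Longrightarrow> norm (?f' w) \<le> M"
      unfolding bounded_pos by auto
    have "norm (?f' w) \<le> M" for w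
      using M supp'[of w] by (cases "norm w \<le> R") auto
    then show ?thesis using that M(1) by fastforce
  qed
  let ?D = "\<lambda>w. M * indicat_real (cball (0::complex) (R + norm v)) w"
  have "((\<lambda>t::real. LBINT w. f (t *\<^sub>R v + w)) has_derivative (\<lambda>s. LBINT w. s *\<^sub>R ?f' (0 *\<^sub>R v + w))) (at 0)"
  proof (rule has_derivative_integral_dominated[where \<delta> = 1 and D = ?D])
    fix t s :: real and w assume t: "t \<in> ball 0 1"
    show "((\<lambda>t. f (t *\<^sub>R v + w)) has_derivative (\<lambda>s. s *\<^sub>R ?f' (t *\<^sub>R v + w))) (at t)"
    proof -
      have lin: "linear (frechet_derivative f (at (t *\<^sub>R v + w)))"
        using C_diff_has_derivative[OF f] has_derivative_linear by blast
      have "((\<lambda>t. t *\<^sub>R v + w) has_derivative (\<lambda>s. s *\<^sub>R v)) (at t)"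
        by (auto intro!: derivative_eq_intros)
      from has_derivative_compose[OF this C_diff_has_derivative[OF f]]
      show ?thesis by (simp add: linear_scale[OF lin])
    qed
    show "integrable lborel (\<lambda>w. f (t *\<^sub>R v + w))"
      by (rule lborel_integrable_translate[OF int])
    show "norm (s *\<^sub>R ?f' (t *\<^sub>R v + w)) \<le> ?D w * norm s"
    proof (cases "norm w \<le> R + norm v")
      case True
      then show ?thesis
        using mult_right_mono[OF M(1)[of "t *\<^sub>R v + w"] abs_ge_zero[of s]] by (simp add: mult.commute)
    next
      case False
      have "norm (t *\<^sub>R v) \<le> 1 * norm v" unfolding norm_scaleR using t by (intro mult_right_mono) auto
      moreover have "norm w \<le> norm (t *\<^sub>R v + w) + norm (t *\<^sub>R v)"
        using norm_triangle_ineq4[of "t *\<^sub>R v + w" "t *\<^sub>R v"] by simp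
      ultimately have "R < norm (t *\<^sub>R v + w)" using False by simp
      then show ?thesis using supp' M by simp
    qed
  next
    show "integrable lborel ?D"
      using emeasure_lborel_cball_finite[of "0::complex" "R + norm v"]
      by (intro integrable_mult_right integrable_real_indicator) auto
  qed (use M in auto)
  moreover have "(LBINT w. f (t *\<^sub>R v + w)) = (LBINT w. f w)" for t
    by (rule lborel_integral_translate) simp
  ultimately have "((\<lambda>t::real. LBINT w. f w) has_derivative (\<lambda>s. s *\<^sub>R (LBINT w. ?f' w))) (at 0)"
    using int' by simp
  from has_derivative_unique[OF this has_derivative_const]
  have "1 *\<^sub>R (LBINT w. ?f' w) = 0" by (rule fun_cong)
  then show "(LBINT w. ?f' w) = 0" by simp
qed

lemma integral_dz_compact_support:
  assumes f: "C_diff (Suc 0) f" and supp: "\<And>z. R < norm z \<Longrightarrow> f z = 0"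
  shows "(LBINT w. dz f w) = 0" "(LBINT w. dzbar f w) = 0"
  using integral_frechet_derivative_compact_support[OF f supp]
  by (simp_all add: dz_def dzbar_def)

lemma integration_by_parts_dz:
  assumes a: "C_diff (Suc 0) a" and p: "C_diff (Suc 0) p" and supp: "\<And>z. R < norm z \<Longrightarrow> p z = 0"
  shows "(LBINT w. dz a w * p w) = - (LBINT w. a w * dz p w)"
    "(LBINT w. dzbar a w * p w) = - (LBINT w. a w * dzbar p w)"
proof -
  have ap: "C_diff (Suc 0) (\<lambda>w. a w * p w)" by (rule C_diff_mult[OF a p])
  have supp': "dz p z = 0" "dzbar p z = 0" if "R < norm z" for z
    using frechet_derivative_outside_support[OF supp that] by (simp_all add: dz_def dzbar_def)
  have c: "continuous_on UNIV a" "continuous_on UNIV p" "continuous_on UNIV (dz a)" "continuous_on UNIV (dzbar a)"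
    "continuous_on UNIV (dz p)" "continuous_on UNIV (dzbar p)"
    using C_diff_continuous[OF a] C_diff_continuous[OF p] C_diff_dz[OF a] C_diff_dz[OF p] by auto
  have int: "integrable lborel (\<lambda>w. dz a w * p w)" "integrable lborel (\<lambda>w. a w * dz p w)"
    "integrable lborel (\<lambda>w. dzbar a w * p w)" "integrable lborel (\<lambda>w. a w * dzbar p w)"
    using c supp supp' by (auto intro!: compact_support_integrable[where R = R] continuous_intros)
  have "0 = (LBINT w. dz (\<lambda>w. a w * p w) w)" "0 = (LBINT w. dzbar (\<lambda>w. a w * p w) w)"
    using integral_dz_compact_support[OF ap, of R] supp by simp_all
  then show "(LBINT w. dz a w * p w) = - (LBINT w. a w * dz p w)"
    "(LBINT w. dzbar a w * p w) = - (LBINT w. a w * dzbar p w)"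
    using int by (simp_all add: dz_mult C_diff_differentiable[OF a] C_diff_differentiable[OF p] add_eq_0_iff2)
qed

lemma radial_has_derivative:
  assumes "\<And>r. (h has_real_derivative h' r) (at r)"
  shows "((\<lambda>w. complex_of_real (h ((norm w)\<^sup>2))) has_derivative
    (\<lambda>v. (h' ((norm w)\<^sup>2) * cnj w) * v + (h' ((norm w)\<^sup>2) * w) * cnj v)) (at w)"
proof -
  have "((\<lambda>w. w \<bullet> w) has_derivative (\<lambda>v. 2 * (w \<bullet> v))) (at w)"
    by (auto intro!: derivative_eq_intros simp: inner_commute)
  then have "((\<lambda>w. (norm w)\<^sup>2) has_derivative (\<lambda>v. 2 * (w \<bullet> v))) (at w)" by (simp add: power2_norm_eq_inner)
  from has_derivative_compose[OF this assms[unfolded has_field_derivative_def]]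
  have "((\<lambda>w. h ((norm w)\<^sup>2)) has_derivative (\<lambda>v. h' ((norm w)\<^sup>2) * (2 * (w \<bullet> v)))) (at w)" .
  from bounded_linear.has_derivative[OF bounded_linear_of_real this]
  show ?thesis
    by (rule has_derivative_eq_rhs) (auto simp: fun_eq_iff complex_eq_iff inner_complex_def algebra_simps)
qed

lemma C_diff_radial:
  assumes "\<And>r. (h has_real_derivative h' r) (at r)" "continuous_on UNIV h'"
  shows "C_diff (Suc 0) (\<lambda>w::complex. complex_of_real (h ((norm w)\<^sup>2)))"
  by (rule C_diff_SucI[OF radial_has_derivative[OF assms(1)]])
    (auto intro!: continuous_intros continuous_on_compose2[OF assms(2)])

text \<open>Integrating by parts twice in the factorised form of the Landau operator. On radial functions \<open>h (|w|\<^sup>2)\<close> the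
  transposed operator is \<open>- h' - r h'' + B\<^sup>2 r h\<close>, the first order terms cancelling.\<close>

lemma landau_radial_green:
  assumes F: "C_diff 2 F"
    and h: "\<And>r. (h has_real_derivative h1 r) (at r)"
    and h1: "\<And>r. (h1 has_real_derivative h2 r) (at r)" and h2: "continuous_on UNIV h2"
    and supp: "\<And>r. R\<^sup>2 < r \<Longrightarrow> h r = 0" and R: "0 \<le> R"
  defines "r \<equiv> \<lambda>w::complex. (norm w)\<^sup>2"
  shows "(LBINT w. landau B F w * of_real (h (r w)))
    = (LBINT w. F w * of_real (- h1 (r w) - r w * h2 (r w) + B\<^sup>2 * r w * h (r w)))"
proof -
  have F2: "C_diff (Suc (Suc 0)) F" using F by (simp only: numeral_2_eq_2)
  note F1 = C_diff_Suc_imp[OF F2]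
  define G where "G = landau_lower B F"
  have G: "C_diff (Suc 0) G" unfolding G_def by (rule C_diff_landau_lower[OF F2])
  define k where "k s = h1 s + B * h s" for s
  define k' where "k' s = h2 s + B * h1 s" for s
  have k: "(k has_real_derivative k' s) (at s)" for s
    unfolding k_def[abs_def] k'_def by (intro derivative_intros DERIV_cmult h h1)
  have h1c: "continuous_on UNIV h1" using h1 DERIV_isCont continuous_at_imp_continuous_on by blast
  have k'c: "continuous_on UNIV k'"
    unfolding k'_def[abs_def] by (intro continuous_intros h2 h1c)
  define p where "p w = complex_of_real (h (r w))" for w
  define q where "q w = cnj w * complex_of_real (k (r w))" for w
  have p: "C_diff (Suc 0) p" unfolding p_def[abs_def] r_def by (rule C_diff_radial[OF h h1c])
  have dp: "dz p w = h1 (r w) * cnj w" for w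
    unfolding p_def[abs_def] r_def by (rule dz_eqI(1)[OF radial_has_derivative[OF h]])
  have q: "C_diff (Suc 0) q"
    unfolding q_def[abs_def] r_def
    by (intro C_diff_mult C_diff_radial[OF k k'c] C_diff_bounded_linear[OF bounded_linear_cnj] C_diff_id)
  have dq: "dzbar q w = of_real (k (r w) + r w * k' (r w))" for w
  proof -
    have dd: "cnj differentiable (at w)" "(\<lambda>w. complex_of_real (k (r w))) differentiable (at w)"
      unfolding r_def by (auto simp: differentiable_def intro: bounded_linear_imp_has_derivative[OF bounded_linear_cnj] radial_has_derivative[OF k])
    have "dzbar cnj w = 1"
      by (rule dz_eqI(2)[where a = 0]) (auto intro!: derivative_eq_intros)
    moreover have "dzbar (\<lambda>w. complex_of_real (k (r w))) w = k' (r w) * w"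
      unfolding r_def by (rule dz_eqI(2)[OF radial_has_derivative[OF k]])
    moreover have "w * cnj w = (complex_of_real (norm w))\<^sup>2"
      using complex_norm_square[of w] by simp
    ultimately show ?thesis
      unfolding q_def[abs_def] dz_mult(2)[OF dd] by (simp add: r_def algebra_simps)
  qed
  have far: "R\<^sup>2 < r w" if "R < norm w" for w
    unfolding r_def using that R by (intro power_strict_mono) auto
  have supp1: "h1 s = 0" if "R\<^sup>2 < s" for s
  proof -
    have "((\<lambda>x. 0) has_real_derivative h1 s) (at s)"
      by (rule has_field_derivative_transform_within_open[OF h, of "{R\<^sup>2<..}"]) (use that supp in auto)
    then show ?thesis using DERIV_unique[OF _ DERIV_const] by blast
  qed
  have psupp: "p w = 0" and qsupp: "q w = 0" if "R < norm w" for w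
    using far[OF that] by (simp_all add: p_def q_def k_def supp supp1)
  have c: "continuous_on UNIV F" "continuous_on UNIV G" "continuous_on UNIV (dz G)" "continuous_on UNIV (dzbar F)"
    "continuous_on UNIV p" "continuous_on UNIV q" "continuous_on UNIV (dz p)" "continuous_on UNIV (dzbar q)"
    using C_diff_continuous C_diff_dz(1)[OF G] C_diff_dz(2)[OF F1] C_diff_dz(1)[OF p] C_diff_dz(2)[OF q] F1 G p q
    by blast+
  have dsupp: "dz p w = 0" "dzbar q w = 0" if "R < norm w" for w
    using frechet_derivative_outside_support[OF psupp that] frechet_derivative_outside_support[OF qsupp that]
    by (simp_all add: dz_def dzbar_def)
  have int: "integrable lborel (\<lambda>w. dz G w * p w)" "integrable lborel (\<lambda>w. G w * dz p w)"
    "integrable lborel (\<lambda>w. G w * (B * cnj w * p w))"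
    "integrable lborel (\<lambda>w. F w * p w)" "integrable lborel (\<lambda>w. dzbar F w * q w)"
    "integrable lborel (\<lambda>w. F w * dzbar q w)" "integrable lborel (\<lambda>w. F w * (complex_of_real B * w * q w))"
    by (rule compact_support_integrable[where R = R]; use psupp qsupp dsupp in \<open>auto intro!: continuous_intros c\<close>)+
  have "(LBINT w. landau B F w * p w)
      = (LBINT w. - (dz G w * p w) + G w * (B * cnj w * p w) + B * (F w * p w))"
    unfolding landau_factor[OF F] G_def[symmetric] by (simp add: algebra_simps)
  also have "\<dots> = (LBINT w. G w * dz p w) + (LBINT w. G w * (B * cnj w * p w)) + B * (LBINT w. F w * p w)"
    using int integration_by_parts_dz(1)[OF G p psupp] by simp
  also have "(LBINT w. G w * dz p w) + (LBINT w. G w * (B * cnj w * p w))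
      = (LBINT w. G w * dz p w + G w * (B * cnj w * p w))"
    using int by simp
  also have "\<dots> = (LBINT w. dzbar F w * q w + F w * (complex_of_real B * w * q w))"
    unfolding G_def landau_lower_def dp by (simp add: q_def p_def k_def algebra_simps)
  also have "\<dots> = - (LBINT w. F w * dzbar q w) + (LBINT w. F w * (complex_of_real B * w * q w))"
    using int integration_by_parts_dz(2)[OF F1 q qsupp] by simp
  also have "\<dots> + B * (LBINT w. F w * p w) = (LBINT w. - (F w * dzbar q w) + F w * (complex_of_real B * w * q w) + B * (F w * p w))"
    using int by simp
  also have "\<dots> = (LBINT w. F w * of_real (- h1 (r w) - r w * h2 (r w) + B\<^sup>2 * r w * h (r w)))"
  proof (rule Bochner_Integration.integral_cong[OF refl])
    fix w
    have "w * cnj w = of_real (r w)" unfolding r_def by (rule complex_norm_square[symmetric])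
    then have "complex_of_real B * w * q w = of_real (B * r w * k (r w))"
      by (simp add: q_def mult.assoc[symmetric])
    then show "- (F w * dzbar q w) + F w * (complex_of_real B * w * q w) + B * (F w * p w)
        = F w * of_real (- h1 (r w) - r w * h2 (r w) + B\<^sup>2 * r w * h (r w))"
      unfolding dq by (simp add: p_def k_def k'_def algebra_simps power2_eq_square)
  qed
  finally show ?thesis by (simp add: p_def)
qed

lemma DERIV_positive_part_power:
  "((\<lambda>x::real. max 0 x ^ Suc (Suc n)) has_real_derivative real (Suc (Suc n)) * max 0 x ^ Suc n) (at x)"
proof -
  consider "x < 0" | "x > 0" | "x = 0" by linarith
  then show ?thesis
  proof cases
    case 1
    have "((\<lambda>x::real. 0) has_real_derivative 0) (at x)" by simp
    then have "((\<lambda>x::real. max 0 x ^ Suc (Suc n)) has_real_derivative 0) (at x)"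
      by (rule has_field_derivative_transform_within_open[of _ _ _ "{..<0}"]) (use 1 in auto)
    then show ?thesis using 1 by simp
  next
    case 2
    have "((\<lambda>x::real. x ^ Suc (Suc n)) has_real_derivative real (Suc (Suc n)) * x ^ Suc n) (at x)"
      using DERIV_pow[of "Suc (Suc n)" x] by simp
    then have "((\<lambda>x::real. max 0 x ^ Suc (Suc n)) has_real_derivative real (Suc (Suc n)) * x ^ Suc n) (at x)"
      by (rule has_field_derivative_transform_within_open[of _ _ _ "{0<..}"]) (use 2 in auto)
    then show ?thesis using 2 by simp
  next
    case 3
    have "(\<lambda>h::real. max 0 h ^ Suc (Suc n) / h) \<midarrow>0\<rightarrow> 0"
    proof (rule Lim_null_comparison)
      show "\<forall>\<^sub>F h::real in at 0. norm (max 0 h ^ Suc (Suc n) / h) \<le> \<bar>h\<bar> ^ Suc n"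
      proof (intro always_eventually allI)
        fix h :: real
        show "norm (max 0 h ^ Suc (Suc n) / h) \<le> \<bar>h\<bar> ^ Suc n"
        proof (cases "h \<le> 0")
          case True
          then have *: "max 0 h ^ Suc (Suc n) / h = 0" by simp
          show ?thesis unfolding * norm_zero by (rule zero_le_power[OF abs_ge_zero])
        qed (simp add: abs_mult)
      qed
      have "((\<lambda>h::real. \<bar>h\<bar> ^ Suc n) \<longlongrightarrow> \<bar>0\<bar> ^ Suc n) (at 0)" by (intro tendsto_intros)
      then show "((\<lambda>h::real. \<bar>h\<bar> ^ Suc n) \<longlongrightarrow> 0) (at 0)" by simp
    qed
    then show ?thesis unfolding DERIV_def using 3 by simp
  qed
qed

text \<open>Green's identity for test functions without compact support. The cutoff \<open>(1 - r / n)\<^sub>+\<^sup>3\<close> is twice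
  continuously differentiable, and the terms in which it is differentiated carry a factor \<open>1 / n\<close>.\<close>

lemma landau_radial_test_function:
  fixes F :: "complex \<Rightarrow> complex" and g g1 g2 :: "real \<Rightarrow> real" and B :: real
  defines "r \<equiv> \<lambda>u::complex. (norm u)\<^sup>2"
  defines "P \<equiv> \<lambda>x. - g1 x - x * g2 x + B\<^sup>2 * x * g x"
  assumes F: "F \<in> L2" "C_diff 2 F" and eigen: "\<And>z. landau B F z = of_real E * F z"
    and g: "\<And>x. (g has_real_derivative g1 x) (at x)" and g1: "\<And>x. (g1 has_real_derivative g2 x) (at x)"
    and g2: "continuous_on UNIV g2"
    and int: "integrable lborel (\<lambda>u. F u * of_real (g (r u)))"
      "integrable lborel (\<lambda>u. F u * of_real (r u * g (r u)))"
      "integrable lborel (\<lambda>u. F u * of_real (r u * g1 (r u)))"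
      "integrable lborel (\<lambda>u. F u * of_real (P (r u)))"
  shows "of_real E * (LBINT u. F u * of_real (g (r u))) = (LBINT u. F u * of_real (P (r u)))"
proof -
  have gc: "continuous_on UNIV g" "continuous_on UNIV g1"
    using g g1 by (auto intro!: continuous_at_imp_continuous_on DERIV_isCont)
  note [measurable] = L2_measurable[OF F(1)] borel_measurable_continuous_onI[OF gc(1)]
    borel_measurable_continuous_onI[OF gc(2)] borel_measurable_continuous_onI[OF g2]
  have r: "0 \<le> r u" for u by (simp add: r_def)
  have [measurable]: "r \<in> borel_measurable borel" unfolding r_def by measurable
  define t where "t n x = max 0 (1 - x / real (Suc n))" for n x
  have t: "((\<lambda>x. t n x ^ Suc (Suc m)) has_real_derivative - (real (Suc (Suc m)) / real (Suc n)) * t n x ^ Suc m) (at x)" for n m x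
  proof -
    have "((\<lambda>x. 1 - x / real (Suc n)) has_real_derivative - (1 / real (Suc n))) (at x)"
      by (auto intro!: derivative_eq_intros)
    from DERIV_chain2[OF DERIV_positive_part_power this] show ?thesis
      unfolding t_def by simp
  qed
  have t3: "((\<lambda>x. t n x ^ 3) has_real_derivative - (3 / real (Suc n)) * t n x ^ 2) (at x)"
    and t2: "((\<lambda>x. t n x ^ 2) has_real_derivative - (2 / real (Suc n)) * t n x) (at x)" for n x
    using t[of n "Suc 0" x] t[of n 0 x] by (simp_all add: numeral_3_eq_3 numeral_2_eq_2)
  have t01: "0 \<le> t n (r u)" "t n (r u) \<le> 1" for n u using r[of u] by (auto simp: t_def)
  have tlim: "(\<lambda>n. t n x) \<longlonglongrightarrow> 1" for x
  proof -
    have "(\<lambda>n. x / real (Suc n)) \<longlonglongrightarrow> 0" using LIMSEQ_Suc[OF lim_const_over_n[of x]] by simp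
    then have "(\<lambda>n. t n x) \<longlonglongrightarrow> max 0 (1 - 0)" unfolding t_def by (intro tendsto_intros)
    then show ?thesis by simp
  qed
  define h where "h n x = t n x ^ 3 * g x" for n x
  define h1 where "h1 n x = - (3 / real (Suc n)) * t n x ^ 2 * g x + t n x ^ 3 * g1 x" for n x
  define h2 where "h2 n x = (6 / (real (Suc n))\<^sup>2) * t n x * g x - (6 / real (Suc n)) * t n x ^ 2 * g1 x + t n x ^ 3 * g2 x" for n x
  have h: "(h n has_real_derivative h1 n x) (at x)" for n x
    unfolding h_def[abs_def] h1_def by (rule DERIV_cong[OF DERIV_mult[OF t3 g]]) (simp add: algebra_simps)
  have h1: "(h1 n has_real_derivative h2 n x) (at x)" for n x
    unfolding h1_def[abs_def] h2_def
    by (rule DERIV_cong[OF DERIV_add[OF DERIV_mult[OF DERIV_cmult[OF t2] g] DERIV_mult[OF t3 g1]]])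
      (simp add: algebra_simps power2_eq_square)
  have h2: "continuous_on UNIV (h2 n)" for n
    unfolding h2_def[abs_def] t_def by (intro continuous_intros gc g2) auto
  have supp: "h n x = 0" if "(sqrt (real (Suc n)))\<^sup>2 < x" for n x
    using that by (simp add: h_def t_def field_simps)
  define p where "p = P"
  define q where "q x = g x + 2 * (x * g1 x)" for x
  define Lh where "Lh n x = - h1 n x - x * h2 n x + B\<^sup>2 * x * h n x" for n x
  have Lh: "Lh n x = t n x ^ 3 * p x + (3 / real (Suc n)) * t n x ^ 2 * q x - (6 / (real (Suc n))\<^sup>2) * t n x * (x * g x)" for n x
    unfolding Lh_def h_def h1_def h2_def p_def P_def q_def by (simp add: algebra_simps add_divide_distrib)
  have bound: "\<bar>Lh n (r u)\<bar> \<le> \<bar>p (r u)\<bar> + 3 * \<bar>q (r u)\<bar> + 6 * \<bar>r u * g (r u)\<bar>" for n u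
  proof -
    have N: "3 / real (Suc n) \<le> 3" "6 / (real (Suc n))\<^sup>2 \<le> 6"
      by (auto simp: divide_le_eq power2_eq_square algebra_simps)
    have "\<bar>t n (r u) ^ 3 * p (r u)\<bar> \<le> 1 * \<bar>p (r u)\<bar>"
      unfolding abs_mult using t01 by (intro mult_right_mono) (auto simp: power_le_one)
    moreover have "\<bar>(3 / real (Suc n)) * t n (r u) ^ 2 * q (r u)\<bar> \<le> 3 * 1 * \<bar>q (r u)\<bar>"
      unfolding abs_mult using t01 N by (intro mult_right_mono mult_mono) (auto simp: power_le_one)
    moreover have "\<bar>(6 / (real (Suc n))\<^sup>2) * t n (r u) * (r u * g (r u))\<bar> \<le> 6 * 1 * \<bar>r u * g (r u)\<bar>"
      unfolding abs_mult using t01 N by (intro mult_right_mono mult_mono) auto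
    ultimately show ?thesis unfolding Lh by linarith
  qed
  have "(\<lambda>n. LBINT u. F u * of_real (h n (r u))) \<longlonglongrightarrow> (LBINT u. F u * of_real (g (r u)))"
  proof (rule integral_dominated_convergence[OF _ _ integrable_norm[OF int(1)]])
    show "AE u in lborel. (\<lambda>n. F u * of_real (h n (r u))) \<longlonglongrightarrow> F u * of_real (g (r u))"
    proof (rule AE_I2)
      fix u
      have "(\<lambda>n. F u * of_real (t n (r u) ^ 3 * g (r u))) \<longlonglongrightarrow> F u * of_real (1 ^ 3 * g (r u))"
        by (intro tendsto_mult tendsto_of_real tendsto_power tlim tendsto_const)
      then show "(\<lambda>n. F u * of_real (h n (r u))) \<longlonglongrightarrow> F u * of_real (g (r u))" by (simp add: h_def)
    qed
    have "\<bar>h n (r u)\<bar> \<le> 1 * \<bar>g (r u)\<bar>" for n u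
      unfolding h_def abs_mult using t01 by (intro mult_right_mono) (auto simp: power_le_one)
    then show "AE u in lborel. norm (F u * of_real (h n (r u))) \<le> norm (F u * of_real (g (r u)))" for n
      unfolding norm_mult norm_of_real by (intro AE_I2 mult_left_mono) auto
    show "(\<lambda>u. F u * of_real (h n (r u))) \<in> borel_measurable lborel" for n
      unfolding h_def t_def by measurable
  qed measurable
  from tendsto_mult_left[OF this, of "of_real E"]
  have lim1: "(\<lambda>n. LBINT u. landau B F u * of_real (h n (r u))) \<longlonglongrightarrow> of_real E * (LBINT u. F u * of_real (g (r u)))"
    unfolding eigen by (simp add: mult.assoc)
  have green: "(LBINT u. landau B F u * of_real (h n (r u))) = (LBINT u. F u * of_real (Lh n (r u)))" for n
    unfolding r_def Lh_def
    by (rule landau_radial_green[where R = "sqrt (real (Suc n))"], rule F(2), rule h, rule h1, rule h2, rule supp)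
      simp_all
  have "(\<lambda>n. LBINT u. F u * of_real (Lh n (r u))) \<longlonglongrightarrow> (LBINT u. F u * of_real (p (r u)))"
  proof (rule integral_dominated_convergence)
    have q: "integrable lborel (\<lambda>u. F u * of_real (q (r u)))"
    proof -
      have "F u * of_real (q (r u)) = F u * of_real (g (r u)) + 2 * (F u * of_real (r u * g1 (r u)))" for u
        by (simp add: q_def algebra_simps)
      then show ?thesis using int(1,3) by simp
    qed
    show "integrable lborel (\<lambda>u. norm (F u * of_real (p (r u))) + 3 * norm (F u * of_real (q (r u)))
        + 6 * norm (F u * of_real (r u * g (r u))))"
      unfolding p_def
      by (intro Bochner_Integration.integrable_add integrable_mult_right integrable_norm int q)
    show "AE u in lborel. (\<lambda>n. F u * of_real (Lh n (r u))) \<longlonglongrightarrow> F u * of_real (p (r u))"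
    proof (rule AE_I2)
      fix u
      have N: "(\<lambda>n. a / real (Suc n)) \<longlonglongrightarrow> 0" "(\<lambda>n. a / (real (Suc n))\<^sup>2) \<longlonglongrightarrow> 0" for a
        by real_asymp+
      have "(\<lambda>n. F u * of_real (Lh n (r u))) \<longlonglongrightarrow>
          F u * of_real (1 ^ 3 * p (r u) + 0 * 1 ^ 2 * q (r u) - 0 * 1 * (r u * g (r u)))"
        unfolding Lh
        by (intro tendsto_mult tendsto_of_real tendsto_power tlim tendsto_const tendsto_add tendsto_diff N)
      then show "(\<lambda>n. F u * of_real (Lh n (r u))) \<longlonglongrightarrow> F u * of_real (p (r u))" by simp
    qed
    show "AE u in lborel. norm (F u * of_real (Lh n (r u))) \<le> norm (F u * of_real (p (r u)))
        + 3 * norm (F u * of_real (q (r u))) + 6 * norm (F u * of_real (r u * g (r u)))" for n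
    proof (rule AE_I2)
      fix u
      show "norm (F u * of_real (Lh n (r u))) \<le> norm (F u * of_real (p (r u)))
        + 3 * norm (F u * of_real (q (r u))) + 6 * norm (F u * of_real (r u * g (r u)))"
        using mult_left_mono[OF bound norm_ge_zero[of "F u"]] unfolding norm_mult norm_of_real
        by (simp add: algebra_simps)
    qed
    show "(\<lambda>u. F u * of_real (Lh n (r u))) \<in> borel_measurable lborel" for n
      unfolding Lh p_def P_def q_def t_def by measurable
    show "(\<lambda>u. F u * of_real (p (r u))) \<in> borel_measurable lborel"
      unfolding p_def P_def by measurable
  qed
  then show ?thesis using LIMSEQ_unique[OF lim1] unfolding green p_def by blast
qed

text \<open>The test function \<open>r\<^sup>i exp (- B r)\<close> is mapped by \<open>- h' - r h'' + B\<^sup>2 r h\<close> to a combination of itself and of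
  its predecessor; the terms with \<open>r\<^bsup>i + 1\<^esup>\<close> cancel because the exponent is \<open>B\<close>.\<close>

lemma radial_moment_recursion:
  assumes F: "F \<in> L2" "C_diff 2 F" and eigen: "\<And>z. landau B F z = of_real E * F z" and B: "0 < B"
  shows "of_real E * radial_moment B i F = of_real ((2 * real i + 1) * B) * radial_moment B i F
    - of_real ((real i)\<^sup>2) * radial_moment B (i - 1) F"
proof -
  define m where "m j x = x ^ j * exp (- B * x)" for j and x :: real
  define g1 where "g1 x = real i * m (i - 1) x - B * m i x" for x
  define g2 where "g2 x = real i * (real (i - 1) * m (i - 2) x) - 2 * B * (real i * m (i - 1) x) + B\<^sup>2 * m i x" for x
  have g: "(m i has_real_derivative g1 x) (at x)" for x
    unfolding g1_def m_def[abs_def] by (auto intro!: derivative_eq_intros simp: algebra_simps)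
  have g1: "(g1 has_real_derivative g2 x) (at x)" for x
    unfolding g1_def[abs_def] g2_def m_def[abs_def]
    by (auto intro!: derivative_eq_intros simp: algebra_simps power2_eq_square numeral_2_eq_2)
  have g2: "continuous_on UNIV g2"
    unfolding g2_def[abs_def] m_def by (intro continuous_intros)
  have xm: "x * m j x = m (Suc j) x" for j x by (simp add: m_def)
  have xg1: "x * g1 x = real i * m i x - B * m (Suc i) x" for x
    unfolding g1_def by (cases i) (simp_all add: right_diff_distrib mult.left_commute xm)
  have Lg: "- g1 x - x * g2 x + B\<^sup>2 * x * m i x = (2 * real i + 1) * B * m i x - (real i)\<^sup>2 * m (i - 1) x" for x
  proof (cases i)
    case (Suc j)
    then show ?thesis
      unfolding g1_def g2_def m_def by (cases j) (auto simp: algebra_simps power2_eq_square)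
  qed (simp add: g1_def g2_def m_def algebra_simps power2_eq_square)
  let ?m = "\<lambda>j u. F u * of_real (m j ((norm u)\<^sup>2))"
  have m: "m j ((norm u)\<^sup>2) = gaussian_monomial B (2 * j) u" for j and u :: complex
    unfolding m_def gaussian_monomial_def power_mult by (rule mult.commute)
  have int: "integrable lborel (?m j)" for j
    using radial_moment_integrable(1)[OF B F(1), of "2 * j"] unfolding m by (simp only: mult.commute)
  have mom: "radial_moment B j F = (LBINT u. ?m j u)" for j
    unfolding m radial_moment_def by (simp only: mult.commute)
  have split: "F u * of_real (r * m i r) = ?m (Suc i) u"
      "F u * of_real (r * g1 r) = of_real (real i) * ?m i u - of_real B * ?m (Suc i) u"
      "F u * of_real (- g1 r - r * g2 r + B\<^sup>2 * r * m i r)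
        = of_real ((2 * real i + 1) * B) * ?m i u - of_real ((real i)\<^sup>2) * ?m (i - 1) u"
    if "r = (norm u)\<^sup>2" for r u
    unfolding xm xg1 Lg that by (simp_all add: algebra_simps)
  have "of_real E * (LBINT u. ?m i u)
      = (LBINT u. of_real ((2 * real i + 1) * B) * ?m i u - of_real ((real i)\<^sup>2) * ?m (i - 1) u)"
    unfolding split(3)[OF refl, symmetric]
    by (rule landau_radial_test_function[OF F eigen g g1 g2 int]; unfold split[OF refl])
      (intro Bochner_Integration.integrable_diff integrable_mult_right int)+
  then show ?thesis
    unfolding mom
    by (simp only: Bochner_Integration.integral_diff integrable_mult_right int integral_mult_right_zero)
qed

section \<open>Moments of eigenfunctions\<close>

lemma radial_moments_vanish_iterate:
  assumes B: "0 < B" and F: "F \<in> L2" and zero: "\<And>i. radial_moment B i F = 0"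
  shows "radial_moment (B * (3 / 2) ^ n) i F = 0"
proof (induction n arbitrary: i)
  case (Suc n)
  have "radial_moment (3 / 2 * (B * (3 / 2) ^ n)) i F = 0"
    by (rule radial_moments_vanish_extend[OF _ F Suc]) (use B in simp)
  then show ?case by (simp add: mult.commute mult.left_commute)
qed (simp add: zero)

lemma filterlim_exponents:
  fixes B :: real
  assumes B: "0 < B"
  shows "filterlim (\<lambda>n. B * (3 / 2) ^ n) at_top sequentially"
  by (rule filterlim_tendsto_pos_mult_at_top[OF tendsto_const B]) real_asymp

text \<open>The zeroth moments then vanish for arbitrarily large exponents, and suitably normalised they
  converge to \<open>F 0\<close>.\<close>

lemma zero_if_radial_moments_vanish:
  assumes B: "0 < B" and F: "F \<in> L2" and cont: "isCont F 0" and zero: "\<And>i. radial_moment B i F = 0"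
  shows "F 0 = 0"
proof -
  from filterlim_compose[OF radial_moment_approximate_identity[OF F cont] filterlim_exponents[OF B]]
  have "(\<lambda>n. 0) \<longlonglongrightarrow> F 0" by (simp add: radial_moments_vanish_iterate[OF B F zero])
  then show ?thesis by (simp add: LIMSEQ_const_iff)
qed

text \<open>The \<open>k\<close>-th finite difference of \<open>n choose i\<close>, computed by Pascal's rule. The special case \<open>n = 0\<close> is the
  orthogonality of the two triangles of binomial coefficients.\<close>

lemma alternating_binomial_sum:
  "(\<Sum>j\<le>k. (- 1) ^ j * real (k choose j) * real ((n + j) choose i))
    = (- 1) ^ k * (if k \<le> i then real (n choose (i - k)) else 0)"
proof (induction k arbitrary: n)
  case (Suc k)
  let ?f = "\<lambda>n j. (- 1) ^ j * real (k choose j) * real ((n + j) choose i)"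
  have "(- 1) ^ Suc j * real (Suc k choose Suc j) * real ((n + Suc j) choose i) = ?f n (Suc j) - ?f (Suc n) j" for j
    by (simp add: algebra_simps)
  then have "(\<Sum>j\<le>Suc k. (- 1) ^ j * real (Suc k choose j) * real ((n + j) choose i))
      = real (n choose i) + (\<Sum>j\<le>k. ?f n (Suc j) - ?f (Suc n) j)"
    unfolding sum.atMost_Suc_shift by simp
  also have "\<dots> = (\<Sum>j\<le>Suc k. ?f n j) - (\<Sum>j\<le>k. ?f (Suc n) j)"
    by (simp add: sum.atMost_Suc_shift sum_subtractf del: sum.atMost_Suc)
  also have "\<dots> = (\<Sum>j\<le>k. ?f n j) - (\<Sum>j\<le>k. ?f (Suc n) j)" by simp
  also have "\<dots> = (- 1) ^ Suc k * (if Suc k \<le> i then real (n choose (i - Suc k)) else 0)"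
  proof (cases "Suc k \<le> i")
    case True
    then have "i - k = Suc (i - Suc k)" by simp
    then show ?thesis unfolding Suc using True by (simp add: algebra_simps)
  next
    case False
    then show ?thesis unfolding Suc by auto
  qed
  finally show ?case .
qed simp

text \<open>The coefficient of \<open>r\<^sup>j\<close> in \<open>L\<^sub>m (2 B r)\<close>.\<close>

definition laguerre_coeff :: "real \<Rightarrow> nat \<Rightarrow> nat \<Rightarrow> real"
  where "laguerre_coeff B m j = (- 1) ^ j * real (m choose j) / fact j * (2 * B) ^ j"

text \<open>This recursion is Laguerre's differential equation on the level of coefficients.\<close>

lemma laguerre_coeff_Suc:
  "j < k \<Longrightarrow> laguerre_coeff B k (Suc j) * (real (Suc j))\<^sup>2 = - (2 * B) * (real k - real j) * laguerre_coeff B k j"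
proof -
  assume j: "j < k"
  have "Suc j * (k choose Suc j) = (k - j) * (k choose j)" by (simp only: binomial_absorption binomial_absorb_comp)
  then have "real (Suc j) * real (k choose Suc j) = (real k - real j) * real (k choose j)"
    using j by (metis of_nat_mult of_nat_diff less_imp_le)
  moreover have "laguerre_coeff B k (Suc j) * (real (Suc j))\<^sup>2
      = - (2 * B) * ((- 1) ^ j * (2 * B) ^ j / fact j) * (real (Suc j) * real (k choose Suc j))"
    unfolding laguerre_coeff_def fact_Suc power_Suc power2_eq_square
    by (simp add: divide_simps del: of_nat_Suc)
  ultimately show ?thesis
    unfolding laguerre_coeff_def by simp
qed

text \<open>The radial eigenfunction of level \<open>k\<close> with value \<open>1\<close> at the origin.\<close>

definition laguerre_gaussian :: "real \<Rightarrow> nat \<Rightarrow> complex \<Rightarrow> real"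
  where "laguerre_gaussian B k u = (\<Sum>j\<le>k. laguerre_coeff B k j * gaussian_monomial B (2 * j) u)"

text \<open>An eigenfunction of level \<open>k\<close>. The aim is to compute its Gaussian moments with exponent \<open>B\<close> from its value
  at the origin.\<close>

locale landau_eigenfunction =
  fixes B :: real and k :: nat and F :: "complex \<Rightarrow> complex"
  assumes B: "0 < B" and F: "F \<in> L2" "C_diff 2 F"
    and eigen: "\<And>z. landau B F z = of_real (B * (2 * real k + 1)) * F z"

begin

text \<open>The recursion has only two terms, and it decouples at \<open>i = k\<close>.\<close>

lemma recursion:
  "of_real (2 * B * (real i - real k)) * radial_moment B i F = of_real ((real i)\<^sup>2) * radial_moment B (i - 1) F"
  using radial_moment_recursion[OF F eigen B, of i] by (simp add: algebra_simps)

lemma moments: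
  "\<exists>Q. \<forall>i. radial_moment B i F = of_real (real (i choose k) * fact i / (2 * B) ^ i) * Q"
proof (intro exI allI)
  fix i
  let ?Q = "of_real ((2 * B) ^ k / fact k) * radial_moment B k F"
  let ?c = "\<lambda>i. real (i choose k) * fact i / (2 * B) ^ i"
  show "radial_moment B i F = of_real (?c i) * ?Q"
  proof (induction i)
    case 0
    show ?case
    proof (cases "k = 0")
      case False
      have "of_real (2 * B * (real 0 - real k)) * radial_moment B 0 F = 0" using recursion[of 0] by simp
      moreover have "2 * B * (real 0 - real k) \<noteq> 0" using False B by simp
      ultimately have "radial_moment B 0 F = 0" by (simp only: mult_eq_0_iff of_real_eq_0_iff simp_thms)
      then show ?thesis using False by simp
    qed simp
  next
    case (Suc i)
    show ?case
    proof (cases "Suc i = k")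
      case True
      then have "?c (Suc i) * ((2 * B) ^ k / fact k) = 1" using B by simp
      then show ?thesis using True by (simp only: mult.assoc[symmetric] of_real_mult[symmetric]) simp
    next
      case False
      have binom: "real (Suc i choose k) * (real (Suc i) - real k) = real (Suc i) * real (i choose k)"
      proof (cases "k \<le> Suc i")
        case True
        have "real (Suc i - k) * real (Suc i choose k) = real (Suc i) * real (i choose k)"
          using arg_cong[OF binomial_absorb_comp[of "Suc i" k], of real] by (simp only: of_nat_mult diff_Suc_1)
        then show ?thesis unfolding of_nat_diff[OF True] by (simp only: mult.commute)
      qed (simp add: binomial_eq_0)
      have "2 * B * (real (Suc i) - real k) * ?c (Suc i)
          = (real (Suc i choose k) * (real (Suc i) - real k)) * (real (Suc i) * fact i / (2 * B) ^ i)"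
        using B by (simp add: field_simps del: of_nat_Suc)
      also have "\<dots> = (real (Suc i))\<^sup>2 * ?c i"
        unfolding binom by (simp add: power2_eq_square del: of_nat_Suc)
      finally have "of_real (2 * B * (real (Suc i) - real k)) * radial_moment B (Suc i) F
          = of_real (2 * B * (real (Suc i) - real k)) * (of_real (?c (Suc i)) * ?Q)"
        unfolding recursion diff_Suc_1 Suc by (simp only: mult.assoc[symmetric] of_real_mult[symmetric])
      moreover have "2 * B * (real (Suc i) - real k) \<noteq> 0" using False B by simp
      ultimately show ?thesis by (simp only: mult_cancel_left of_real_eq_0_iff simp_thms)
    qed
  qed
qed

end

lemma gaussian_eigenfunction:
  assumes B: "0 < B"
  shows "landau_eigenfunction B 0 (\<lambda>u. of_real (gaussian_monomial B 0 u))"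
proof
  let ?F = "\<lambda>u. complex_of_real (gaussian_monomial B 0 u)"
  have "?F u = exp (of_real (- B) * (u * cnj u))" for u
    unfolding complex_norm_square[symmetric] by (simp add: gaussian_monomial_def exp_of_real[symmetric])
  then show C: "C_diff 2 ?F"
    by (simp only:) (intro C_diff_exp C_diff_mult C_diff_const C_diff_id C_diff_cnj)
  have "((\<lambda>x. exp (- B * x)) has_real_derivative - B * exp (- B * r)) (at r)" for r
    by (auto intro!: derivative_eq_intros)
  from dz_eqI(2)[OF radial_has_derivative[OF this]]
  have "landau_lower B ?F = (\<lambda>u. 0)"
    by (simp add: fun_eq_iff landau_lower_def gaussian_monomial_def)
  then show "landau B ?F z = of_real (B * (2 * real 0 + 1)) * ?F z" for z
    unfolding landau_factor[OF C] by (simp add: dz_const)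
qed (use B gaussian_monomial_L2 in auto)

text \<open>The Gaussian moments of the Gaussian itself, obtained from the recursion at level \<open>0\<close>.\<close>

lemma gaussian_power_integral:
  assumes B: "0 < B"
  shows "(LBINT u. gaussian_monomial (2 * B) (2 * i) u) = pi * fact i / (2 * B) ^ Suc i"
proof -
  let ?F = "\<lambda>u. complex_of_real (gaussian_monomial B 0 u)"
  interpret landau_eigenfunction B 0 ?F by (rule gaussian_eigenfunction[OF B])
  obtain Q where Q: "\<And>i. radial_moment B i ?F = of_real (real (i choose 0) * fact i / (2 * B) ^ i) * Q"
    using moments by blast
  have mom: "radial_moment B i ?F = of_real (LBINT u. gaussian_monomial (2 * B) (2 * i) u)" for i
    unfolding radial_moment_def of_real_mult[symmetric] gaussian_monomial_mult integral_complex_of_real by simp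
  have "(LBINT u. gaussian_monomial (2 * B) (2 * 0) u) = pi / (2 * B)"
    using complex_gaussian_scaled(2)[of "2 * B"] B by (simp add: gaussian_monomial_def[abs_def])
  then have "Q = of_real (pi / (2 * B))" using Q[of 0] unfolding mom by simp
  then have "(LBINT u. gaussian_monomial (2 * B) (2 * i) u) = real (i choose 0) * fact i / (2 * B) ^ i * (pi / (2 * B))"
    using Q[of i] unfolding mom by (simp only: of_real_mult[symmetric] of_real_eq_iff)
  then show ?thesis by (simp add: ac_simps)
qed

lemma laguerre_gaussian_L2: "0 < B \<Longrightarrow> (\<lambda>u. complex_of_real (laguerre_gaussian B k u)) \<in> L2"
  unfolding laguerre_gaussian_def of_real_sum of_real_mult by (intro L2_sum L2_scale gaussian_monomial_L2)

lemma laguerre_gaussian_0: "laguerre_gaussian B k 0 = 1"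
proof -
  have "laguerre_gaussian B k 0 = (\<Sum>j\<in>{0}. laguerre_coeff B k j * gaussian_monomial B (2 * j) 0)"
    unfolding laguerre_gaussian_def by (rule sum.mono_neutral_right) (auto simp: gaussian_monomial_def)
  then show ?thesis by (simp add: laguerre_coeff_def gaussian_monomial_def)
qed

text \<open>Up to the factor \<open>\<pi> (- 1)\<^sup>k / (2 B)\<close>, these are the coefficients in the lemma \<open>moments\<close>.\<close>

lemma laguerre_gaussian_moment:
  assumes B: "0 < B"
  shows "radial_moment B i (\<lambda>u. of_real (laguerre_gaussian B k u))
    = of_real (real (i choose k) * fact i / (2 * B) ^ i) * of_real (pi / (2 * B) * (- 1) ^ k)"
proof -
  have "radial_moment B i (\<lambda>u. of_real (laguerre_gaussian B k u))
      = (LBINT u. (\<Sum>j\<le>k. of_real (laguerre_coeff B k j) * complex_of_real (gaussian_monomial (2 * B) (2 * (i + j)) u)))"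
    unfolding radial_moment_def
  proof (rule Bochner_Integration.integral_cong[OF refl])
    fix u :: complex
    have "gaussian_monomial B (2 * i) u * gaussian_monomial B (2 * j) u = gaussian_monomial (2 * B) (2 * (i + j)) u" for j
      unfolding gaussian_monomial_mult by (simp add: distrib_left)
    then have "gaussian_monomial B (2 * i) u * laguerre_gaussian B k u
        = (\<Sum>j\<le>k. laguerre_coeff B k j * gaussian_monomial (2 * B) (2 * (i + j)) u)"
      unfolding laguerre_gaussian_def sum_distrib_left by (simp only: mult.left_commute)
    then show "of_real (gaussian_monomial B (2 * i) u) * of_real (laguerre_gaussian B k u)
        = (\<Sum>j\<le>k. of_real (laguerre_coeff B k j) * complex_of_real (gaussian_monomial (2 * B) (2 * (i + j)) u))"
      by (simp only: of_real_mult[symmetric] of_real_sum[symmetric])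
  qed
  also have "\<dots> = (\<Sum>j\<le>k. of_real (laguerre_coeff B k j) * of_real (pi * fact (i + j) / (2 * B) ^ Suc (i + j)))"
  proof -
    have "integrable lborel (\<lambda>u. complex_of_real (gaussian_monomial (2 * B) n u))" for n
      using gaussian_monomial_integrable[of "2 * B" n] B by simp
    then show ?thesis
      by (simp only: Bochner_Integration.integral_sum integrable_mult_right integral_mult_right_zero
          integral_complex_of_real gaussian_power_integral[OF B])
  qed
  also have "\<dots> = of_real (\<Sum>j\<le>k. pi * fact i / (2 * B) ^ Suc i * ((- 1) ^ j * real (k choose j) * real ((i + j) choose i)))"
    unfolding of_real_mult[symmetric] of_real_sum[symmetric]
  proof (rule arg_cong[where f = of_real], rule sum.cong[OF refl])
    fix j
    have "real ((i + j) choose i) = fact (i + j) / (fact i * fact j)"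
      using binomial_fact[of i "i + j", where 'a = real] by simp
    then show "laguerre_coeff B k j * (pi * fact (i + j) / (2 * B) ^ Suc (i + j))
        = pi * fact i / (2 * B) ^ Suc i * ((- 1) ^ j * real (k choose j) * real ((i + j) choose i))"
      using B by (simp add: laguerre_coeff_def power_add field_simps)
  qed
  also have "\<dots> = of_real (pi * fact i / (2 * B) ^ Suc i * ((- 1) ^ k * real (i choose k)))"
    unfolding sum_distrib_left[symmetric] alternating_binomial_sum by (simp add: binomial_symmetric[of k i])
  also have "\<dots> = of_real (real (i choose k) * fact i / (2 * B) ^ i) * of_real (pi / (2 * B) * (- 1) ^ k)"
    unfolding of_real_mult[symmetric] by (rule arg_cong[where f = of_real]) (simp add: ac_simps)
  finally show ?thesis .
qed

context landau_eigenfunction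
begin

text \<open>All moments of \<open>F\<close> are proportional to those of the radial eigenfunction \<open>R\<close> with \<open>R 0 = 1\<close>. The difference of
  \<open>F\<close> and the corresponding multiple of \<open>R\<close> has vanishing moments, hence vanishes at the origin, which
  determines the factor.\<close>

lemma moments_at_origin:
  "radial_moment B i F = of_real (real (i choose k) * fact i / (2 * B) ^ i) * (of_real (pi / (2 * B) * (- 1) ^ k) * F 0)"
proof -
  let ?c = "\<lambda>i. complex_of_real (real (i choose k) * fact i / (2 * B) ^ i)"
  let ?s = "complex_of_real (pi / (2 * B) * (- 1) ^ k)"
  let ?R = "\<lambda>u. complex_of_real (laguerre_gaussian B k u)"
  obtain Q where Q: "\<And>i. radial_moment B i F = ?c i * Q" using moments by blast
  have s: "?s \<noteq> 0" using B by simp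
  have R: "(\<lambda>u. Q / ?s * ?R u) \<in> L2" by (rule L2_scale[OF laguerre_gaussian_L2[OF B]])
  have "F 0 - Q / ?s * ?R 0 = 0"
  proof (rule zero_if_radial_moments_vanish[OF B L2_diff[OF F(1) R]])
    have "continuous_on UNIV ?R"
      unfolding laguerre_gaussian_def gaussian_monomial_def by (intro continuous_intros)
    then have "isCont ?R 0" by (simp add: continuous_on_eq_continuous_at)
    moreover have "isCont F 0" using C_diff_continuous[OF F(2)] by (simp add: continuous_on_eq_continuous_at)
    ultimately show "isCont (\<lambda>u. F u - Q / ?s * ?R u) 0" by (rule isCont_diff[OF _ isCont_mult[OF continuous_const], rotated])
    fix i
    have "radial_moment B i (\<lambda>u. F u - Q / ?s * ?R u) = radial_moment B i F - Q / ?s * radial_moment B i ?R"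
      using radial_moment_integrable(1)[OF B F(1), of "2 * i"] radial_moment_integrable(1)[OF B laguerre_gaussian_L2[OF B], of "2 * i" k]
      by (simp add: radial_moment_def right_diff_distrib mult.left_commute)
    then show "radial_moment B i (\<lambda>u. F u - Q / ?s * ?R u) = 0"
      unfolding Q laguerre_gaussian_moment[OF B] using s by simp
  qed
  then have "Q = ?s * F 0" using s by (simp add: laguerre_gaussian_0 field_simps)
  then show ?thesis using Q[of i] by simp
qed

text \<open>The factors \<open>j! / (2 B)\<^sup>j\<close> of the moments cancel against the Laguerre coefficients, which leaves
  \<open>\<Sum> (- 1)\<^sup>j (m choose j) (j choose k)\<close>.\<close>

lemma laguerre_moments:
  "of_real (2 * B / pi) * (\<Sum>j\<le>m. of_real (laguerre_coeff B m j) * radial_moment B j F) = (if m = k then F 0 else 0)"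
proof -
  have "laguerre_coeff B m j * (real (j choose k) * fact j / (2 * B) ^ j) = (- 1) ^ j * real (m choose j) * real (j choose k)" for j
    using B by (simp add: laguerre_coeff_def)
  then have "(\<Sum>j\<le>m. of_real (laguerre_coeff B m j) * radial_moment B j F)
      = of_real (\<Sum>j\<le>m. (- 1) ^ j * real (m choose j) * real ((0 + j) choose k)) * (of_real (pi / (2 * B) * (- 1) ^ k) * F 0)"
    unfolding moments_at_origin mult.assoc[symmetric] of_real_mult[symmetric] of_real_sum sum_distrib_right
    by (simp only: add_0)
  also have "(\<Sum>j\<le>m. (- 1) ^ j * real (m choose j) * real ((0 + j) choose k)) = (if m = k then (- 1) ^ k else 0)"
    unfolding alternating_binomial_sum by auto
  finally have sum: "(\<Sum>j\<le>m. of_real (laguerre_coeff B m j) * radial_moment B j F)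
      = of_real (if m = k then (- 1) ^ k else 0) * (of_real (pi / (2 * B) * (- 1) ^ k) * F 0)" .
  have "2 * B / pi * (- 1) ^ k * (pi / (2 * B) * (- 1) ^ k) = 1"
    using B by (simp add: power_mult_distrib[symmetric])
  then show ?thesis
    unfolding sum mult.assoc[symmetric] of_real_mult[symmetric] by (cases "m = k") simp_all
qed

end

section \<open>The Landau projections\<close>

text \<open>Here \<open>B (z cnj w - cnj z w) = 2 \<i> B Im (z cnj w)\<close>.\<close>

definition landau_kernel :: "real \<Rightarrow> nat \<Rightarrow> complex \<Rightarrow> complex \<Rightarrow> complex"
  where "landau_kernel B k z w = of_real (2 * B / pi) * exp (of_real B * (z * cnj w - cnj z * w))
    * of_real (exp (- B * (norm (z - w))\<^sup>2) * laguerre k (2 * B * (norm (z - w))\<^sup>2))"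

definition landau_projection :: "real \<Rightarrow> nat \<Rightarrow> (complex \<Rightarrow> complex) \<Rightarrow> complex \<Rightarrow> complex"
  where "landau_projection B k f z = (LBINT w. landau_kernel B k z w * f w)"

lemma gaussian_laguerre:
  "exp (- B * (norm u)\<^sup>2) * laguerre k (2 * B * (norm u)\<^sup>2) = (\<Sum>j\<le>k. laguerre_coeff B k j * gaussian_monomial B (2 * j) u)"
  unfolding laguerre_def sum_distrib_left
proof (rule sum.cong[OF refl])
  fix j
  have "(2 * B * (norm u)\<^sup>2) ^ j = (2 * B) ^ j * norm u ^ (2 * j)"
    unfolding power_mult_distrib power_mult ..
  then show "exp (- B * (norm u)\<^sup>2) * ((- 1) ^ j * real (k choose j) / fact j * (2 * B * (norm u)\<^sup>2) ^ j)
      = laguerre_coeff B k j * gaussian_monomial B (2 * j) u"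
    by (simp add: laguerre_coeff_def gaussian_monomial_def)
qed

lemma landau_kernel_continuous: "continuous_on UNIV (\<lambda>(z, w). landau_kernel B k z w)"
  unfolding landau_kernel_def laguerre_def split_beta by (intro continuous_intros)

lemma landau_kernel_cnj: "landau_kernel B k z w = cnj (landau_kernel B k w z)"
  by (simp add: landau_kernel_def exp_cnj norm_minus_commute algebra_simps)

definition landau_majorant :: "real \<Rightarrow> nat \<Rightarrow> complex \<Rightarrow> real"
  where "landau_majorant B k u = 2 * B / pi * (\<Sum>j\<le>k. \<bar>laguerre_coeff B k j\<bar> * gaussian_monomial B (2 * j) u)"

lemma landau_majorant_bounded:
  assumes B: "0 < B"
  shows "\<exists>C. \<forall>u. landau_majorant B k u \<le> C"
proof -
  obtain C where C: "\<And>n u. gaussian_monomial B n u \<le> C n" using gaussian_monomial_bounded[OF B] by metis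
  have "landau_majorant B k u \<le> 2 * B / pi * (\<Sum>j\<le>k. \<bar>laguerre_coeff B k j\<bar> * C (2 * j))" for u
    unfolding landau_majorant_def using B by (intro mult_left_mono sum_mono C) auto
  then show ?thesis by blast
qed

lemma convolution_bounded_landau_kernel:
  assumes B: "0 < B"
  shows "\<exists>C. convolution_bounded_kernel (landau_kernel B k) (landau_majorant B k) C"
proof -
  obtain C where C: "\<And>u. landau_majorant B k u \<le> C" using landau_majorant_bounded[OF B] by blast
  have "convolution_bounded_kernel (landau_kernel B k) (landau_majorant B k) C"
  proof
    show "(\<lambda>(z, w). landau_kernel B k z w) \<in> borel_measurable (borel \<Otimes>\<^sub>M borel)"
      using borel_measurable_continuous_onI[OF landau_kernel_continuous] by (simp add: borel_prod)
    show "integrable lborel (landau_majorant B k)"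
      unfolding landau_majorant_def[abs_def]
      by (intro integrable_mult_right Bochner_Integration.integrable_sum gaussian_monomial_integrable B)
    show "landau_majorant B k (- u) = landau_majorant B k u" for u
      by (simp add: landau_majorant_def gaussian_monomial_def)
    show "norm (landau_kernel B k z w) \<le> landau_majorant B k (z - w)" for z w
    proof -
      have "norm (landau_kernel B k z w) = 2 * B / pi * \<bar>\<Sum>j\<le>k. laguerre_coeff B k j * gaussian_monomial B (2 * j) (z - w)\<bar>"
        unfolding landau_kernel_def gaussian_laguerre norm_mult norm_of_real norm_magnetic_phase using B by simp
      also have "\<dots> \<le> landau_majorant B k (z - w)"
        unfolding landau_majorant_def using B
        by (intro mult_left_mono order_trans[OF sum_abs] sum_mono) (auto simp: abs_mult gaussian_monomial_nonneg)
      finally show ?thesis .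
    qed
  qed (rule C)
  then show ?thesis by blast
qed

context
  fixes B :: real
  assumes B: "0 < B"
begin

lemma landau_kernel_L2: "landau_kernel B k z \<in> L2"
  using convolution_bounded_landau_kernel[OF B] convolution_bounded_kernel.kernel_L2 by blast

lemma landau_kernel_integrable: "f \<in> L2 \<Longrightarrow> integrable lborel (\<lambda>w. landau_kernel B k z w * f w)"
  by (rule L2_mult_integrable(2)[OF landau_kernel_L2])

lemma landau_projection_L2: "f \<in> L2 \<Longrightarrow> landau_projection B k f \<in> L2"
  using convolution_bounded_landau_kernel[OF B] convolution_bounded_kernel.kernel_integral_L2
  unfolding landau_projection_def[abs_def] by blast

lemma landau_projection_diff:
  "f \<in> L2 \<Longrightarrow> g \<in> L2 \<Longrightarrow> landau_projection B k (\<lambda>z. f z - g z) = (\<lambda>z. landau_projection B k f z - landau_projection B k g z)"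
  by (rule ext) (simp add: landau_projection_def right_diff_distrib landau_kernel_integrable)

lemma landau_projection_symmetric:
  assumes f: "f \<in> L2" and g: "g \<in> L2"
  shows "L2_inner (landau_projection B k f) g = L2_inner f (landau_projection B k g)"
proof -
  note [measurable] = L2_measurable[OF g]
  have g': "(\<lambda>z. cnj (g z)) \<in> L2"
    by (rule L2_bound[OF g borel_measurable_cnj[OF L2_measurable[OF g]]]) simp
  obtain C where "convolution_bounded_kernel (landau_kernel B k) (landau_majorant B k) C"
    using convolution_bounded_landau_kernel[OF B] by blast
  from convolution_bounded_kernel.kernel_integral_swap[OF this f g']
  have swap: "L2_inner (landau_projection B k f) g = (LBINT w. f w * (LBINT z. landau_kernel B k z w * cnj (g z)))"
    by (simp add: L2_inner_def landau_projection_def)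
  have "(LBINT z. landau_kernel B k z w * cnj (g z)) = cnj (landau_projection B k g w)" for w
  proof -
    have "(LBINT z. landau_kernel B k z w * cnj (g z)) = (LBINT z. cnj (landau_kernel B k w z * g z))"
      by (simp add: landau_kernel_cnj[of B k _ w])
    then show ?thesis unfolding landau_projection_def by (simp only: Bochner_Integration.integral_cnj)
  qed
  then show ?thesis unfolding swap by (simp add: L2_inner_def)
qed

lemma landau_projection_bounded: "\<exists>C. \<forall>f\<in>L2. \<forall>z. norm (landau_projection B k f z) \<le> C * L2_norm f"
proof -
  obtain C where cb: "convolution_bounded_kernel (landau_kernel B k) (landau_majorant B k) C"
    using convolution_bounded_landau_kernel[OF B] by blast
  interpret convolution_bounded_kernel "landau_kernel B k" "landau_majorant B k" C by (rule cb)
  let ?M = "sqrt (LBINT w. C * landau_majorant B k w)"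
  have norm_le: "L2_norm (landau_kernel B k z) \<le> ?M" for z
  proof -
    have C: "0 \<le> C" using H_nonneg[of 0] H_bounded[of 0] by simp
    have "(LBINT w. (norm (landau_kernel B k z w))\<^sup>2) \<le> (LBINT w. C * landau_majorant B k (z - w))"
    proof (rule integral_mono[OF L2_square_integrable[OF kernel_L2]])
      show "integrable lborel (\<lambda>w. C * landau_majorant B k (z - w))" using H_shift by simp
      show "(norm (landau_kernel B k z w))\<^sup>2 \<le> C * landau_majorant B k (z - w)" for w
        unfolding power2_eq_square
        by (rule mult_mono) (use kernel_bound[of z w] order_trans[OF kernel_bound H_bounded] C in auto)
    qed
    also have "\<dots> = (LBINT w. C * landau_majorant B k w)" using H_shift(2)[of z] by simp
    finally show ?thesis unfolding L2_norm_def by (rule real_sqrt_le_mono)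
  qed
  have "norm (landau_projection B k f z) \<le> ?M * L2_norm f" if f: "f \<in> L2" for f z
    unfolding landau_projection_def
    by (rule order_trans[OF norm_integral_mult_le[OF kernel_L2 f] mult_right_mono[OF norm_le L2_norm_nonneg]])
  then show ?thesis by blast
qed

lemma landau_projection_moments:
  assumes f: "f \<in> L2"
  shows "landau_projection B k f z
    = of_real (2 * B / pi) * (\<Sum>j\<le>k. of_real (laguerre_coeff B k j) * radial_moment B j (magnetic_translation B z f))"
proof -
  note [measurable] = L2_measurable[OF f] L2_measurable[OF landau_kernel_L2]
  have "landau_projection B k f z = (LBINT u. landau_kernel B k z (z + u) * f (z + u))"
    unfolding landau_projection_def by (rule lborel_integral_translate[symmetric]) measurable
  also have "\<dots> = (LBINT u. of_real (2 * B / pi) * (\<Sum>j\<le>k. of_real (laguerre_coeff B k j)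
      * (of_real (gaussian_monomial B (2 * j) u) * magnetic_translation B z f u)))"
  proof (rule Bochner_Integration.integral_cong[OF refl])
    fix u
    have 1: "z * cnj (z + u) - cnj z * (z + u) = z * cnj u - cnj z * u" by (simp add: algebra_simps)
    have 2: "norm (z - (z + u)) = norm u" by simp
    have "landau_kernel B k z (z + u) * f (z + u)
        = of_real (2 * B / pi) * (of_real (\<Sum>j\<le>k. laguerre_coeff B k j * gaussian_monomial B (2 * j) u) * magnetic_translation B z f u)"
      unfolding landau_kernel_def magnetic_translation_def 1 2 gaussian_laguerre by (simp only: mult.assoc)
        (simp only: ac_simps)
    then show "landau_kernel B k z (z + u) * f (z + u) = of_real (2 * B / pi) * (\<Sum>j\<le>k. of_real (laguerre_coeff B k j)
      * (of_real (gaussian_monomial B (2 * j) u) * magnetic_translation B z f u))"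
      by (simp only: of_real_sum of_real_mult sum_distrib_right mult.assoc)
  qed
  also have "\<dots> = of_real (2 * B / pi) * (\<Sum>j\<le>k. of_real (laguerre_coeff B k j) * radial_moment B j (magnetic_translation B z f))"
    unfolding radial_moment_def
    by (simp only: integral_mult_right_zero Bochner_Integration.integral_sum integrable_mult_right
        radial_moment_integrable(1)[OF B L2_magnetic_translation[OF f]])
  finally show ?thesis .
qed

definition landau_level :: "nat \<Rightarrow> (complex \<Rightarrow> complex) set"
  where "landau_level k = {F \<in> L2. C_diff 2 F \<and> (\<forall>z. landau B F z = of_real (B * (2 * real k + 1)) * F z)}"

text \<open>Move the point \<open>z\<close> to the origin by a magnetic translation.\<close>

lemma landau_projection_on_level:
  assumes F: "F \<in> landau_level k"
  shows "landau_projection B m F = (if m = k then F else (\<lambda>z. 0))"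
proof
  fix z
  have F': "F \<in> L2" "C_diff 2 F" "\<And>z. landau B F z = of_real (B * (2 * real k + 1)) * F z"
    using F by (simp_all add: landau_level_def)
  interpret landau_eigenfunction B k "magnetic_translation B z F"
  proof
    show "landau B (magnetic_translation B z F) u = of_real (B * (2 * real k + 1)) * magnetic_translation B z F u" for u
      unfolding landau_magnetic_translation[OF F'(2)] unfolding magnetic_translation_def F'(3) by (simp only: ac_simps)
  qed (use B F' L2_magnetic_translation C_diff_magnetic_translation in auto)
  show "landau_projection B m F z = (if m = k then F else (\<lambda>z. 0)) z"
    unfolding landau_projection_moments[OF F'(1)] laguerre_moments by (simp add: magnetic_translation_0)
qed

text \<open>The Laguerre polynomials of degree at most \<open>j\<close> span the polynomials of degree at most \<open>j\<close>.\<close>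

lemma radial_moments_vanish:
  assumes f: "f \<in> L2" and zero: "\<And>k. landau_projection B k f z = 0"
  shows "radial_moment B j (magnetic_translation B z f) = 0"
proof (induction j rule: less_induct)
  case (less j)
  let ?m = "\<lambda>i. radial_moment B i (magnetic_translation B z f)"
  have "(\<Sum>i\<le>j. of_real (laguerre_coeff B j i) * ?m i) = 0"
    using zero[of j] B unfolding landau_projection_moments[OF f] by simp
  moreover have "(\<Sum>i\<le>j. of_real (laguerre_coeff B j i) * ?m i) = of_real (laguerre_coeff B j j) * ?m j"
    unfolding lessThan_Suc_atMost[symmetric] sum.lessThan_Suc using less by simp
  ultimately show ?case using B by (simp add: laguerre_coeff_def)
qed

text \<open>The Gaussian operators \<open>K n\<close> with the exponents \<open>c n = B (3 / 2)\<^sup>n\<close> annihilate \<open>f\<close>, since all Gaussian moments of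
  all magnetic translates of \<open>f\<close> vanish. Pairing with the indicator function \<open>g\<close> of a box and moving the operator
  to \<open>g\<close>, where it converges to the identity, shows that \<open>f\<close> has integral \<open>0\<close> over the box.\<close>

lemma landau_projection_total:
  assumes f: "f \<in> L2" and zero: "\<And>k. landau_projection B k f = (\<lambda>z. 0)"
  shows "AE z in lborel. f z = 0"
proof (rule AE_zero_if_integral_box_zero)
  note [measurable] = L2_measurable[OF f]
  fix a b :: complex
  define g where "g z = complex_of_real (indicator (box a b) z)" for z
  have g_L2: "g \<in> L2" unfolding g_def[abs_def] by (rule L2_indicator_box)
  note [measurable] = L2_measurable[OF g_L2]
  show "set_integrable lborel (box a b) f"
    using L2_mult_integrable(2)[OF g_L2 f] by (simp add: set_integrable_def g_def scaleR_conv_of_real)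
  define c where "c n = B * (3 / 2) ^ n" for n
  have c: "0 < c n" "B \<le> c n" for n using B by (auto simp: c_def mult_le_cancel_left1)
  have c_top: "filterlim c at_top sequentially" unfolding c_def[abs_def] by (rule filterlim_exponents[OF B])
  have moment: "radial_moment (c n) i (magnetic_translation B z f) = 0" for n i z
    unfolding c_def
    by (rule radial_moments_vanish_iterate[OF B L2_magnetic_translation[OF f] radial_moments_vanish[OF f]]) (simp add: zero)
  define K where "K n z w = exp (of_real B * (z * cnj w - cnj z * w)) * of_real (gaussian_monomial (c n) 0 (z - w))" for n z w
  have cb: "convolution_bounded_kernel (K n) (gaussian_monomial (c n) 0) 1" for n
  proof
    have "continuous_on UNIV (\<lambda>(z, w). K n z w)"
      unfolding K_def gaussian_monomial_def split_beta by (intro continuous_intros)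
    then show "(\<lambda>(z, w). K n z w) \<in> borel_measurable (borel \<Otimes>\<^sub>M borel)"
      using borel_measurable_continuous_onI by (simp add: borel_prod)
    show "norm (K n z w) \<le> gaussian_monomial (c n) 0 (z - w)" for z w
      unfolding K_def norm_mult norm_magnetic_phase by (simp add: gaussian_monomial_def)
  qed (use c(1)[of n] in \<open>auto simp: gaussian_monomial_integrable gaussian_monomial_def\<close>)
  have inner_f: "(LBINT w. K n z w * f w) = 0" for n z
  proof -
    have [measurable]: "K n z \<in> borel_measurable borel" using convolution_bounded_kernel.kernel_measurable'(1)[OF cb] .
    have "(LBINT w. K n z w * f w) = (LBINT u. K n z (z + u) * f (z + u))"
      by (rule lborel_integral_translate[symmetric]) measurable
    also have "\<dots> = (LBINT u. of_real (gaussian_monomial (c n) (2 * 0) u) * magnetic_translation B z f u)"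
    proof (rule Bochner_Integration.integral_cong[OF refl])
      fix u
      have "z * cnj (z + u) - cnj z * (z + u) = z * cnj u - cnj z * u" by (simp add: algebra_simps)
      moreover have "gaussian_monomial (c n) 0 (z - (z + u)) = gaussian_monomial (c n) (2 * 0) u"
        by (simp add: gaussian_monomial_def)
      ultimately show "K n z (z + u) * f (z + u) = of_real (gaussian_monomial (c n) (2 * 0) u) * magnetic_translation B z f u"
        unfolding K_def magnetic_translation_def by (simp only: ac_simps)
    qed
    also have "\<dots> = 0" using moment[of n 0 z] by (simp add: radial_moment_def)
    finally show ?thesis .
  qed
  have swap: "(LBINT w. f w * (LBINT z. K n z w * g z)) = 0" for n
    using convolution_bounded_kernel.kernel_integral_swap[OF cb f g_L2, of n] by (simp add: inner_f)
  define \<Phi> where "\<Phi> n w = of_real (c n / pi) * (LBINT z. K n z w * g z)" for n w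
  \<comment> \<open>in the second variable the kernel is the one for the opposite field\<close>
  have \<Phi>_eq: "\<Phi> n w = of_real (c n / pi) * radial_moment (c n) 0 (magnetic_translation (- B) w g)" for n w
  proof -
    have [measurable]: "(\<lambda>z. K n z w) \<in> borel_measurable borel" using convolution_bounded_kernel.kernel_measurable'(2)[OF cb] .
    have "(LBINT z. K n z w * g z) = (LBINT u. K n (w + u) w * g (w + u))"
      by (rule lborel_integral_translate[symmetric]) measurable
    also have "\<dots> = (LBINT u. of_real (gaussian_monomial (c n) (2 * 0) u) * magnetic_translation (- B) w g u)"
    proof (rule Bochner_Integration.integral_cong[OF refl])
      fix u
      have "of_real B * ((w + u) * cnj w - cnj (w + u) * w) = of_real (- B) * (w * cnj u - cnj w * u)" by (simp add: algebra_simps)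
      moreover have "gaussian_monomial (c n) 0 (w + u - w) = gaussian_monomial (c n) (2 * 0) u" by simp
      ultimately show "K n (w + u) w * g (w + u) = of_real (gaussian_monomial (c n) (2 * 0) u) * magnetic_translation (- B) w g u"
        unfolding K_def magnetic_translation_def by (simp only: ac_simps)
    qed
    finally show ?thesis by (simp add: \<Phi>_def radial_moment_def)
  qed
  have \<Phi>_lim: "(\<lambda>n. \<Phi> n w) \<longlonglongrightarrow> g w" if w: "w \<notin> cbox a b - box a b" for w
  proof -
    have "isCont g w"
    proof -
      have "w \<in> box a b \<union> - cbox a b" using w by blast
      moreover have "continuous_on (box a b \<union> - cbox a b) g"
      proof (rule continuous_on_open_Un)
        show "continuous_on (box a b) g" by (rule continuous_on_eq[OF continuous_on_const[of _ 1]]) (simp add: g_def)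
        show "continuous_on (- cbox a b) g"
          by (rule continuous_on_eq[OF continuous_on_const[of _ 0]]) (use box_subset_cbox[of a b] in \<open>auto simp: g_def indicator_def\<close>)
      qed (auto intro: open_box)
      moreover have "open (box a b \<union> - cbox a b)" by (intro open_Un open_box open_Compl closed_cbox)
      ultimately show ?thesis using continuous_on_eq_continuous_at by blast
    qed
    then have "isCont (magnetic_translation (- B) w g) 0"
      unfolding magnetic_translation_def[abs_def]
      by (intro continuous_intros isCont_o2[where f = "\<lambda>u. w + u" and g = g]) simp_all
    from radial_moment_approximate_identity[OF L2_magnetic_translation[OF g_L2] this]
    have "((\<lambda>c. of_real (c / pi) * radial_moment c 0 (magnetic_translation (- B) w g)) \<longlongrightarrow> g w) at_top"
      by (simp add: magnetic_translation_0)
    from filterlim_compose[OF this c_top] show ?thesis unfolding \<Phi>_eq .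
  qed
  obtain R where R: "\<And>z. z \<in> box a b \<Longrightarrow> norm z \<le> R"
    using bounded_box[of a b] unfolding bounded_iff by auto
  let ?D = "\<lambda>w. 2 * exp (B / 2 * R\<^sup>2) * exp (- (B / 4) * (norm w)\<^sup>2)"
  have \<Phi>_bound: "norm (\<Phi> n w) \<le> ?D w" for n w
  proof -
    have pt: "norm (K n z w * g z) \<le> exp (B / 2 * R\<^sup>2) * exp (- (B / 4) * (norm w)\<^sup>2) * gaussian_monomial (c n / 2) 0 (- w + z)" for z
    proof (cases "z \<in> box a b")
      case True
      have "norm w \<le> norm (z - w) + norm z" using norm_triangle_ineq4[of z "z - w"] by simp
      then have "(norm w)\<^sup>2 \<le> (norm (z - w) + norm z)\<^sup>2" by (rule power_mono) simp
      also have "\<dots> \<le> 2 * (norm (z - w))\<^sup>2 + 2 * (norm z)\<^sup>2"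
        using sum_squares_bound[of "norm (z - w)" "norm z"] by (simp add: power2_sum)
      also have "\<dots> \<le> 2 * (norm (z - w))\<^sup>2 + 2 * R\<^sup>2" using R[OF True] by (simp add: power_mono)
      finally have "B / 4 * (norm w)\<^sup>2 \<le> B / 4 * (2 * (norm (z - w))\<^sup>2 + 2 * R\<^sup>2)" using B by (intro mult_left_mono) auto
      moreover have "B / 2 * (norm (z - w))\<^sup>2 \<le> c n / 2 * (norm (z - w))\<^sup>2" using c(2)[of n] by (intro mult_right_mono) auto
      ultimately have "- c n * (norm (z - w))\<^sup>2 \<le> B / 2 * R\<^sup>2 + - (B / 4) * (norm w)\<^sup>2 + - (c n / 2) * (norm (z - w))\<^sup>2"
        by (simp add: algebra_simps)
      then have "gaussian_monomial (c n) 0 (z - w) \<le> exp (B / 2 * R\<^sup>2) * exp (- (B / 4) * (norm w)\<^sup>2) * gaussian_monomial (c n / 2) 0 (z - w)"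
        unfolding gaussian_monomial_def by (simp only: exp_add[symmetric] power_0 mult_1_right exp_le_cancel_iff)
      then show ?thesis
        using convolution_bounded_kernel.kernel_bound[OF cb, of n z w] True by (simp add: g_def)
    qed (simp add: g_def gaussian_monomial_nonneg)
    have "norm (LBINT z. K n z w * g z)
        \<le> (LBINT z. exp (B / 2 * R\<^sup>2) * exp (- (B / 4) * (norm w)\<^sup>2) * gaussian_monomial (c n / 2) 0 (- w + z))"
    proof (rule Bochner_Integration.integral_norm_bound_integral)
      have Kg: "(\<lambda>z. K n z w) \<in> L2"
      proof -
        have "norm (K n z w) = norm (K n w z)" for z
          unfolding K_def norm_mult norm_magnetic_phase by (simp add: gaussian_monomial_def norm_minus_commute)
        then show ?thesis
          using convolution_bounded_kernel.kernel_measurable'(2)[OF cb, of n w]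
          by (intro L2_bound[OF convolution_bounded_kernel.kernel_L2[OF cb, of n w]]) auto
      qed
      show "integrable lborel (\<lambda>z. K n z w * g z)" by (rule L2_mult_integrable(2)[OF Kg g_L2])
      show "integrable lborel (\<lambda>z. exp (B / 2 * R\<^sup>2) * exp (- (B / 4) * (norm w)\<^sup>2) * gaussian_monomial (c n / 2) 0 (- w + z))"
        using c(1)[of n] by (intro integrable_mult_right lborel_integrable_translate gaussian_monomial_integrable) simp
    qed (rule pt)
    also have "\<dots> = exp (B / 2 * R\<^sup>2) * exp (- (B / 4) * (norm w)\<^sup>2) * (2 * pi / c n)"
      using lborel_integral_translate[of "gaussian_monomial (c n / 2) 0" "- w"] complex_gaussian_scaled(2)[of "c n / 2"] c(1)[of n]
      by (simp add: gaussian_monomial_def)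
    finally have "c n / pi * norm (LBINT z. K n z w * g z)
        \<le> c n / pi * (exp (B / 2 * R\<^sup>2) * exp (- (B / 4) * (norm w)\<^sup>2) * (2 * pi / c n))"
      using c(1)[of n] by (intro mult_left_mono) auto
    moreover have "norm (\<Phi> n w) = c n / pi * norm (LBINT z. K n z w * g z)"
      unfolding \<Phi>_def norm_mult norm_of_real using c(1)[of n] by simp
    ultimately show ?thesis using c(1)[of n] by simp
  qed
  have "(\<lambda>n. LBINT w. f w * \<Phi> n w) \<longlonglongrightarrow> (LBINT w. f w * g w)"
  proof (rule integral_dominated_convergence)
    have "complex_of_real (?D w) = of_real (2 * exp (B / 2 * R\<^sup>2)) * of_real (gaussian_monomial (B / 4) 0 w)" for w
      by (simp add: gaussian_monomial_def)
    then have D: "(\<lambda>w. complex_of_real (?D w)) \<in> L2"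
      using L2_scale[OF gaussian_monomial_L2[of "B / 4" 0], of "of_real (2 * exp (B / 2 * R\<^sup>2))"] B by simp
    show "integrable lborel (\<lambda>w. norm (f w) * ?D w)"
      using L2_mult_integrable(1)[OF f D] unfolding norm_of_real by (simp add: abs_mult)
    show "AE w in lborel. (\<lambda>n. f w * \<Phi> n w) \<longlonglongrightarrow> f w * g w"
      using AE_not_in[OF null_sets_cbox_Diff_box[of a b]]
      by eventually_elim (intro tendsto_mult_left \<Phi>_lim)
    show "AE w in lborel. norm (f w * \<Phi> n w) \<le> norm (f w) * ?D w" for n
      unfolding norm_mult by (intro AE_I2 mult_left_mono \<Phi>_bound) simp
    show "(\<lambda>w. f w * \<Phi> n w) \<in> borel_measurable lborel" for n
    proof -
      have "(\<lambda>w. LBINT z. K n z w * g z) \<in> borel_measurable borel"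
      proof -
        have K': "K n z w = cnj (K n w z)" for z w
          by (simp add: K_def exp_cnj gaussian_monomial_def norm_minus_commute algebra_simps)
        have g': "(\<lambda>z. cnj (g z)) = g" by (simp add: g_def fun_eq_iff)
        have "(LBINT z. K n z w * g z) = (LBINT z. cnj (K n w z * g z))" for w
          using fun_cong[OF g'] by (subst K') simp
        then have "(LBINT z. K n z w * g z) = cnj (LBINT z. K n w z * g z)" for w
          by (simp only: Bochner_Integration.integral_cnj)
        then show ?thesis
          using convolution_bounded_kernel.kernel_integral_measurable[OF cb g_L2, of n] by simp
      qed
      then show ?thesis unfolding \<Phi>_def by measurable
    qed
  qed measurable
  moreover have "(LBINT w. f w * \<Phi> n w) = 0" for n
  proof -
    have "(LBINT w. f w * \<Phi> n w) = (LBINT w. of_real (c n / pi) * (f w * (LBINT z. K n z w * g z)))"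
      unfolding \<Phi>_def by (simp only: ac_simps)
    then show ?thesis using swap[of n] by (simp only: integral_mult_right_zero) simp
  qed
  ultimately have "(LBINT w. f w * g w) = 0" using LIMSEQ_const_iff by (simp add: LIMSEQ_const_iff)
  then show "(LINT w:box a b|lborel. f w) = 0"
    by (simp add: set_lebesgue_integral_def g_def scaleR_conv_of_real mult.commute)
qed

end

section \<open>The range of the Landau projections\<close>

text \<open>The exponential is the kernel of the lowest level, which is annihilated by \<open>\<partial>bar + B z\<close> in the
  variable \<open>z\<close>. The kernels of all levels are combinations of the cases \<open>a = b\<close>.\<close>

definition ladder_kernel :: "real \<Rightarrow> nat \<Rightarrow> nat \<Rightarrow> complex \<Rightarrow> complex \<Rightarrow> complex"
  where "ladder_kernel B a b z w =
    exp (of_real B * (2 * z * cnj w - z * cnj z - w * cnj w)) * (z - w) ^ a * cnj (z - w) ^ b"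

lemma norm_ladder_kernel: "norm (ladder_kernel B a b z w) = gaussian_monomial B (a + b) (z - w)"
proof -
  have "Re (of_real B * (2 * z * cnj w - z * cnj z - w * cnj w)) = - B * (norm (z - w))\<^sup>2"
    unfolding cmod_power2 by (simp add: algebra_simps power2_eq_square)
  then show ?thesis
    by (simp add: ladder_kernel_def gaussian_monomial_def norm_mult norm_power power_add norm_exp_eq_Re
        complex_mod_cnj[of "z - w", simplified] del: complex_cnj_diff)
qed

lemma ladder_kernel_measurable [measurable]: "ladder_kernel B a b z \<in> borel_measurable borel"
  unfolding ladder_kernel_def by (intro borel_measurable_continuous_onI continuous_intros)

text \<open>The first order terms are arranged so that \<open>\<partial>bar + B z\<close> lowers \<open>b\<close>, while \<open>- \<partial> + B cnj z\<close> raises \<open>b\<close> and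
  lowers \<open>a\<close>. For \<open>a = 0\<close> or \<open>b = 0\<close> the truncated index has coefficient \<open>0\<close>.\<close>

lemma ladder_kernel_has_derivative:
  "((\<lambda>z. ladder_kernel B a b z w) has_derivative
    (\<lambda>v. (B * cnj z * ladder_kernel B a b z w - 2 * complex_of_real B * ladder_kernel B a (Suc b) z w + a * ladder_kernel B (a - 1) b z w) * v
      + (- complex_of_real B * z * ladder_kernel B a b z w + b * ladder_kernel B a (b - 1) z w) * cnj v)) (at z)"
proof -
  let ?e = "\<lambda>z. exp (of_real B * (2 * z * cnj w - z * cnj z - w * cnj w))"
  have shift: "((\<lambda>z. z - w) has_derivative (\<lambda>v. v)) (at z)" by (auto intro!: derivative_eq_intros)
  have "((\<lambda>z. of_real B * (2 * z * cnj w - z * cnj z - w * cnj w)) has_derivative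
      (\<lambda>v. of_real B * (2 * v * cnj w - (z * cnj v + v * cnj z) - 0))) (at z)"
    by (intro has_derivative_mult_right has_derivative_diff has_derivative_mult_left has_derivative_mult
        has_derivative_ident has_derivative_cnj has_derivative_const)
  from has_derivative_compose[OF this DERIV_exp[unfolded has_field_derivative_def]]
  have e: "(?e has_derivative (\<lambda>v. ?e z * (of_real B * (2 * v * cnj w - (z * cnj v + v * cnj z) - 0)))) (at z)" .
  have p: "((\<lambda>z. (z - w) ^ n) has_derivative (\<lambda>v. n * v * (z - w) ^ (n - 1))) (at z)" for n
    by (rule has_derivative_power[OF shift])
  have q: "((\<lambda>z. cnj (z - w) ^ b) has_derivative (\<lambda>v. cnj (b * v * (z - w) ^ (b - 1)))) (at z)"
    using has_derivative_cnj[OF p[of b]] by simp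
  show ?thesis
    unfolding ladder_kernel_def
    by (rule has_derivative_eq_rhs[OF has_derivative_mult[OF has_derivative_mult[OF e p] q]])
      (simp add: fun_eq_iff algebra_simps)
qed

text \<open>A majorant that is uniform for \<open>z\<close> near \<open>z0\<close>, as needed for differentiation under the integral sign.\<close>

lemma ladder_kernel_local_bound:
  assumes B: "0 < B"
  shows "\<exists>C\<ge>0. \<forall>z\<in>ball z0 1. \<forall>w. norm (ladder_kernel B a b z w) \<le> C * exp (- (B / 4) * (norm (z0 - w))\<^sup>2)"
proof -
  obtain C where C: "C > 0" "\<And>x. x \<ge> 0 \<Longrightarrow> x ^ (a + b) * exp (- B * x\<^sup>2) \<le> C * exp (- (B / 2) * x\<^sup>2)"
    using power_gaussian_bound[OF B, of "a + b"] by blast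
  have "norm (ladder_kernel B a b z w) \<le> C * exp (B / 2) * exp (- (B / 4) * (norm (z0 - w))\<^sup>2)"
    if z: "z \<in> ball z0 1" for z w
  proof -
    have "norm (z0 - w) \<le> norm (z - w) + 1"
      using z norm_triangle_ineq[of "z0 - z" "z - w"] by (simp add: dist_norm)
    then have "(norm (z0 - w))\<^sup>2 \<le> (norm (z - w) + 1)\<^sup>2" by (rule power_mono) simp
    also have "\<dots> \<le> 2 * (norm (z - w))\<^sup>2 + 2"
      using sum_squares_bound[of "norm (z - w)" 1] by (simp add: power2_sum)
    finally have "B * (norm (z0 - w))\<^sup>2 \<le> B * (2 * (norm (z - w))\<^sup>2 + 2)" using B by (intro mult_left_mono) auto
    then have le: "- (B / 2) * (norm (z - w))\<^sup>2 \<le> B / 2 + - (B / 4) * (norm (z0 - w))\<^sup>2" by (simp add: algebra_simps)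
    have "norm (ladder_kernel B a b z w) \<le> C * exp (- (B / 2) * (norm (z - w))\<^sup>2)"
      using C(2)[OF norm_ge_zero, of "z - w"] unfolding norm_ladder_kernel gaussian_monomial_def by (simp add: mult.commute)
    also have "\<dots> \<le> C * (exp (B / 2) * exp (- (B / 4) * (norm (z0 - w))\<^sup>2))"
      unfolding exp_add[symmetric] using C(1) le by (intro mult_left_mono) auto
    finally show ?thesis by (simp add: mult.assoc)
  qed
  then show ?thesis using C(1) by (intro exI[of _ "C * exp (B / 2)"]) auto
qed

context
  fixes B :: real and f :: "complex \<Rightarrow> complex"
  assumes B: "0 < B" and f: "f \<in> L2"
begin

definition ladder_integral :: "nat \<Rightarrow> nat \<Rightarrow> complex \<Rightarrow> complex"
  where "ladder_integral a b z = (LBINT w. ladder_kernel B a b z w * f w)"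

lemma gaussian_times_integrable:
  "integrable lborel (\<lambda>w. M * (exp (- (B / 4) * (norm (z0 - w))\<^sup>2) * norm (f w)))"
  using L2_mult_integrable(1)[OF gaussian_shift_L2[of "B / 4" z0] f] B by simp

lemma ladder_kernel_integrable: "integrable lborel (\<lambda>w. ladder_kernel B a b z w * f w)"
proof -
  obtain C where C: "C \<ge> 0" "\<And>w. norm (ladder_kernel B a b z w) \<le> C * exp (- (B / 4) * (norm (z - w))\<^sup>2)"
    using ladder_kernel_local_bound[OF B, of z a b] by (auto simp: Ball_def)
  note [measurable] = L2_measurable[OF f]
  show ?thesis
  proof (rule Bochner_Integration.integrable_bound[OF gaussian_times_integrable[of C z]])
    show "AE w in lborel. norm (ladder_kernel B a b z w * f w) \<le> norm (C * (exp (- (B / 4) * (norm (z - w))\<^sup>2) * norm (f w)))"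
    proof (rule AE_I2)
      fix w
      have "norm (ladder_kernel B a b z w) * norm (f w) \<le> C * exp (- (B / 4) * (norm (z - w))\<^sup>2) * norm (f w)"
        by (intro mult_right_mono C) simp
      then show "norm (ladder_kernel B a b z w * f w) \<le> norm (C * (exp (- (B / 4) * (norm (z - w))\<^sup>2) * norm (f w)))"
        using C(1) by (simp add: norm_mult mult.assoc)
    qed
  qed measurable
qed

lemma ladder_integral_has_derivative:
  "(ladder_integral a b has_derivative
    (\<lambda>v. (B * cnj z * ladder_integral a b z - 2 * complex_of_real B * ladder_integral a (Suc b) z + a * ladder_integral (a - 1) b z) * v
      + (- complex_of_real B * z * ladder_integral a b z + b * ladder_integral a (b - 1) z) * cnj v)) (at z)"
proof -
  let ?k = "ladder_kernel B"
  let ?d = "\<lambda>z w v. ((B * cnj z * ?k a b z w - 2 * complex_of_real B * ?k a (Suc b) z w + a * ?k (a - 1) b z w) * v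
      + (- complex_of_real B * z * ?k a b z w + b * ?k a (b - 1) z w) * cnj v) * f w"
  have "\<exists>C\<ge>0. \<forall>z'\<in>ball z 1. \<forall>w::complex. norm (?k a b z' w) \<le> C * exp (- (B / 4) * (norm (z - w))\<^sup>2)" for a b
    by (rule ladder_kernel_local_bound[OF B])
  then obtain C where C: "\<And>a b. C a b \<ge> 0"
    "\<And>a b z' (w::complex). z' \<in> ball z 1 \<Longrightarrow> norm (?k a b z' w) \<le> C a b * exp (- (B / 4) * (norm (z - w))\<^sup>2)"
    by metis
  let ?M = "2 * (B * (norm z + 1)) * C a b + 2 * B * C a (Suc b) + a * C (a - 1) b + b * C a (b - 1)"
  have M: "0 \<le> ?M" using B C(1) by (intro add_nonneg_nonneg mult_nonneg_nonneg) auto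
  note [measurable] = L2_measurable[OF f]
  have "((\<lambda>z. LBINT w. ?k a b z w * f w) has_derivative (\<lambda>v. LBINT w. ?d z w v)) (at z)"
  proof (rule has_derivative_integral_dominated[where \<delta> = 1 and D = "\<lambda>w. ?M * (exp (- (B / 4) * (norm (z - w))\<^sup>2) * norm (f w))"])
    fix z' w v assume z': "z' \<in> ball z 1"
    show "((\<lambda>z. ?k a b z w * f w) has_derivative ?d z' w) (at z')"
      by (rule bounded_linear.has_derivative[OF bounded_linear_mult_left ladder_kernel_has_derivative])
    show "integrable lborel (\<lambda>w. ?k a b z' w * f w)" by (rule ladder_kernel_integrable)
    let ?e = "exp (- (B / 4) * (norm (z - w))\<^sup>2)"
    have nz: "norm z' \<le> norm z + 1"
      using z' norm_triangle_ineq2[of z' z] by (simp add: dist_norm norm_minus_commute)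
    have "norm (B * cnj z' * ?k a b z' w - 2 * complex_of_real B * ?k a (Suc b) z' w + a * ?k (a - 1) b z' w)
        \<le> norm (B * cnj z' * ?k a b z' w) + norm (2 * complex_of_real B * ?k a (Suc b) z' w) + norm (a * ?k (a - 1) b z' w)"
      by (intro order_trans[OF norm_triangle_ineq] add_right_mono norm_triangle_ineq4)
    also have "\<dots> \<le> B * (norm z + 1) * (C a b * ?e) + 2 * B * (C a (Suc b) * ?e) + a * (C (a - 1) b * ?e)"
      unfolding norm_mult using B nz C(1) z'
      by (intro add_mono mult_mono C(2)) (auto intro!: mult_nonneg_nonneg)
    finally have 1: "norm (B * cnj z' * ?k a b z' w - 2 * complex_of_real B * ?k a (Suc b) z' w + a * ?k (a - 1) b z' w)
        \<le> B * (norm z + 1) * (C a b * ?e) + 2 * B * (C a (Suc b) * ?e) + a * (C (a - 1) b * ?e)" .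
    have "norm (- complex_of_real B * z' * ?k a b z' w + b * ?k a (b - 1) z' w)
        \<le> norm (- complex_of_real B * z' * ?k a b z' w) + norm (b * ?k a (b - 1) z' w)"
      by (rule norm_triangle_ineq)
    also have "\<dots> \<le> B * (norm z + 1) * (C a b * ?e) + b * (C a (b - 1) * ?e)"
      unfolding norm_mult using B nz C(1) z'
      by (intro add_mono mult_mono C(2)) (auto intro!: mult_nonneg_nonneg)
    finally have 2: "norm (- complex_of_real B * z' * ?k a b z' w + b * ?k a (b - 1) z' w)
        \<le> B * (norm z + 1) * (C a b * ?e) + b * (C a (b - 1) * ?e)" .
    let ?p = "B * cnj z' * ?k a b z' w - 2 * complex_of_real B * ?k a (Suc b) z' w + a * ?k (a - 1) b z' w"
    let ?q = "- complex_of_real B * z' * ?k a b z' w + b * ?k a (b - 1) z' w"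
    have "norm (?p * v + ?q * cnj v) \<le> norm ?p * norm v + norm ?q * norm v"
      using norm_triangle_ineq[of "?p * v" "?q * cnj v"] by (simp only: norm_mult complex_mod_cnj)
    also have "\<dots> = (norm ?p + norm ?q) * norm v" by (simp only: distrib_right)
    also have "\<dots> \<le> (?M * ?e) * norm v"
      using add_mono[OF 1 2] by (intro mult_right_mono) (simp_all add: algebra_simps)
    finally have "norm (?p * v + ?q * cnj v) * norm (f w) \<le> (?M * ?e) * norm v * norm (f w)"
      by (rule mult_right_mono) simp
    then show "norm (?d z' w v) \<le> ?M * (?e * norm (f w)) * norm v"
      unfolding norm_mult[of _ "f w"] by (simp only: ac_simps)
  next
    show "integrable lborel (\<lambda>w. ?M * (exp (- (B / 4) * (norm (z - w))\<^sup>2) * norm (f w)))"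
      by (rule gaussian_times_integrable)
    show "\<And>w. 0 \<le> ?M * (exp (- (B / 4) * (norm (z - w))\<^sup>2) * norm (f w))"
      using M by (intro mult_nonneg_nonneg) auto
    show "(\<lambda>w. ?d z w v) \<in> borel_measurable lborel" for v by measurable
  qed simp
  moreover have "(LBINT w. ?d z w v)
      = (B * cnj z * ladder_integral a b z - 2 * complex_of_real B * ladder_integral a (Suc b) z + a * ladder_integral (a - 1) b z) * v
      + (- complex_of_real B * z * ladder_integral a b z + b * ladder_integral a (b - 1) z) * cnj v" for v
  proof -
    have "?d z w v = (B * cnj z * v) * (?k a b z w * f w) - (2 * complex_of_real B * v) * (?k a (Suc b) z w * f w) + (a * v) * (?k (a - 1) b z w * f w)
      + (- complex_of_real B * z * cnj v) * (?k a b z w * f w) + (b * cnj v) * (?k a (b - 1) z w * f w)" for w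
      by (simp add: algebra_simps)
    then have "(LBINT w. ?d z w v)
      = (B * cnj z * v) * ladder_integral a b z - (2 * complex_of_real B * v) * ladder_integral a (Suc b) z + (a * v) * ladder_integral (a - 1) b z
      + (- complex_of_real B * z * cnj v) * ladder_integral a b z + (b * cnj v) * ladder_integral a (b - 1) z"
      unfolding ladder_integral_def
      by (simp only: Bochner_Integration.integral_add Bochner_Integration.integral_diff integral_mult_right_zero
          integrable_mult_right Bochner_Integration.integrable_add Bochner_Integration.integrable_diff ladder_kernel_integrable)
    then show ?thesis by (simp add: algebra_simps)
  qed
  ultimately show ?thesis unfolding ladder_integral_def[abs_def] by simp
qed

text \<open>The derivatives are combinations of functions of the same kind with polynomial coefficients.\<close>

lemma C_diff_ladder_integral: "C_diff n (ladder_integral a b)"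
proof (induction n arbitrary: a b)
  case 0
  show ?case using has_derivative_imp_continuous_on[OF ladder_integral_has_derivative] by simp
next
  case (Suc n)
  have cnj: "C_diff n (\<lambda>z. cnj z)" by (rule C_diff_bounded_linear[OF bounded_linear_cnj C_diff_id])
  show ?case
  proof (rule C_diff_SucI[OF ladder_integral_has_derivative])
    fix v
    have "C_diff n (\<lambda>z. (B * cnj z * ladder_integral a b z + (- 2 * complex_of_real B) * ladder_integral a (Suc b) z + a * ladder_integral (a - 1) b z) * v
      + (- complex_of_real B * z * ladder_integral a b z + b * ladder_integral a (b - 1) z) * cnj v)"
      by (intro C_diff_add C_diff_mult C_diff_const C_diff_id cnj Suc)
    then show "C_diff n (\<lambda>z. (B * cnj z * ladder_integral a b z - 2 * complex_of_real B * ladder_integral a (Suc b) z + a * ladder_integral (a - 1) b z) * v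
      + (- complex_of_real B * z * ladder_integral a b z + b * ladder_integral a (b - 1) z) * cnj v)" by simp
  qed
qed

lemma dz_ladder_sum:
  fixes c :: "nat \<Rightarrow> complex"
  shows "dz (\<lambda>z. \<Sum>j\<in>I. c j * ladder_integral (p j) (q j) z) z
      = (\<Sum>j\<in>I. c j * (B * cnj z * ladder_integral (p j) (q j) z - 2 * complex_of_real B * ladder_integral (p j) (Suc (q j)) z
        + p j * ladder_integral (p j - 1) (q j) z))"
    "dzbar (\<lambda>z. \<Sum>j\<in>I. c j * ladder_integral (p j) (q j) z) z
      = (\<Sum>j\<in>I. c j * (- complex_of_real B * z * ladder_integral (p j) (q j) z + q j * ladder_integral (p j) (q j - 1) z))"
proof -
  have "((\<lambda>z. \<Sum>j\<in>I. c j * ladder_integral (p j) (q j) z) has_derivative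
    (\<lambda>v. \<Sum>j\<in>I. c j * ((B * cnj z * ladder_integral (p j) (q j) z - 2 * complex_of_real B * ladder_integral (p j) (Suc (q j)) z
        + p j * ladder_integral (p j - 1) (q j) z) * v
      + (- complex_of_real B * z * ladder_integral (p j) (q j) z + q j * ladder_integral (p j) (q j - 1) z) * cnj v))) (at z)"
    by (intro has_derivative_sum has_derivative_mult_right ladder_integral_has_derivative)
  then have "((\<lambda>z. \<Sum>j\<in>I. c j * ladder_integral (p j) (q j) z) has_derivative
    (\<lambda>v. (\<Sum>j\<in>I. c j * (B * cnj z * ladder_integral (p j) (q j) z - 2 * complex_of_real B * ladder_integral (p j) (Suc (q j)) z
        + p j * ladder_integral (p j - 1) (q j) z)) * v
      + (\<Sum>j\<in>I. c j * (- complex_of_real B * z * ladder_integral (p j) (q j) z + q j * ladder_integral (p j) (q j - 1) z)) * cnj v)) (at z)"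
    by (rule has_derivative_eq_rhs)
      (intro ext, unfold sum_distrib_right sum.distrib[symmetric], rule sum.cong[OF refl], simp add: algebra_simps)
  from dz_eqI[OF this] show "dz (\<lambda>z. \<Sum>j\<in>I. c j * ladder_integral (p j) (q j) z) z
      = (\<Sum>j\<in>I. c j * (B * cnj z * ladder_integral (p j) (q j) z - 2 * complex_of_real B * ladder_integral (p j) (Suc (q j)) z
        + p j * ladder_integral (p j - 1) (q j) z))"
    "dzbar (\<lambda>z. \<Sum>j\<in>I. c j * ladder_integral (p j) (q j) z) z
      = (\<Sum>j\<in>I. c j * (- complex_of_real B * z * ladder_integral (p j) (q j) z + q j * ladder_integral (p j) (q j - 1) z))" .
qed

lemma landau_ladder_sum:
  fixes k :: nat
  defines "S \<equiv> \<lambda>z. \<Sum>j\<le>k. of_real (laguerre_coeff B k j) * ladder_integral j j z"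
  shows "C_diff 2 S" "landau B S z = of_real (B * (2 * real k + 1)) * S z"
proof -
  let ?c = "\<lambda>j. complex_of_real (laguerre_coeff B k j)"
  let ?T = ladder_integral
  show S: "C_diff 2 S"
    unfolding S_def by (intro C_diff_sum C_diff_mult C_diff_const C_diff_ladder_integral)
  have lower: "landau_lower B S = (\<lambda>z. \<Sum>j\<le>k. (?c j * j) * ?T j (j - 1) z)"
  proof
    fix z :: complex
    have "landau_lower B S z = (\<Sum>j\<le>k. ?c j * (- complex_of_real B * z * ?T j j z + j * ?T j (j - 1) z)) + complex_of_real B * z * (\<Sum>j\<le>k. ?c j * ?T j j z)"
      unfolding landau_lower_def S_def dz_ladder_sum(2) ..
    also have "\<dots> = (\<Sum>j\<le>k. (?c j * j) * ?T j (j - 1) z)"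
      unfolding sum_distrib_left sum.distrib[symmetric] by (intro sum.cong refl) (simp add: algebra_simps)
    finally show "landau_lower B S z = (\<Sum>j\<le>k. (?c j * j) * ?T j (j - 1) z)" .
  qed
  have "landau B S z - B * S z = - dz (landau_lower B S) z + B * cnj z * landau_lower B S z"
    unfolding landau_factor[OF S] by simp
  also have "\<dots> = (\<Sum>j\<le>k. (?c j * j) * (2 * complex_of_real B * ?T j (Suc (j - 1)) z - j * ?T (j - 1) (j - 1) z))"
    unfolding lower dz_ladder_sum(1) sum_distrib_left sum_negf[symmetric] sum.distrib[symmetric]
    by (intro sum.cong refl) (simp add: algebra_simps)
  also have "\<dots> = (\<Sum>j\<le>k. ?c j * (2 * B * j) * ?T j j z - ?c j * (real j)\<^sup>2 * ?T (j - 1) (j - 1) z)"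
  proof (rule sum.cong[OF refl])
    fix j
    show "?c j * j * (2 * complex_of_real B * ?T j (Suc (j - 1)) z - j * ?T (j - 1) (j - 1) z)
        = ?c j * (2 * B * j) * ?T j j z - ?c j * (real j)\<^sup>2 * ?T (j - 1) (j - 1) z"
      by (cases j) (simp_all add: algebra_simps power2_eq_square)
  qed
  also have "\<dots> = (\<Sum>j\<le>k. ?c j * (2 * B * j) * ?T j j z) - (\<Sum>j\<le>k. ?c j * (real j)\<^sup>2 * ?T (j - 1) (j - 1) z)"
    by (rule sum_subtractf)
  also have "(\<Sum>j\<le>k. ?c j * (real j)\<^sup>2 * ?T (j - 1) (j - 1) z) = (\<Sum>j<k. ?c (Suc j) * (real (Suc j))\<^sup>2 * ?T j j z)"
    by (simp only: lessThan_Suc_atMost[symmetric] sum.lessThan_Suc_shift) simp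
  also have "\<dots> = (\<Sum>j<k. - (2 * B) * (real k - real j) * ?c j * ?T j j z)"
    using laguerre_coeff_Suc by (intro sum.cong refl) (simp flip: of_real_mult of_real_power)
  also have "\<dots> = (\<Sum>j\<le>k. - (2 * B) * (real k - real j) * ?c j * ?T j j z)"
    by (simp only: lessThan_Suc_atMost[symmetric] sum.lessThan_Suc) simp
  also have "(\<Sum>j\<le>k. ?c j * (2 * B * j) * ?T j j z) - \<dots> = (\<Sum>j\<le>k. (2 * B * k) * (?c j * ?T j j z))"
    unfolding sum_subtractf[symmetric] by (intro sum.cong refl) (simp add: algebra_simps)
  also have "\<dots> = (2 * B * k) * S z"
    unfolding S_def by (simp add: sum_distrib_left)
  finally show "landau B S z = of_real (B * (2 * real k + 1)) * S z" by (simp add: algebra_simps)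
qed

end

lemma landau_kernel_ladder:
  "landau_kernel B k z w = of_real (2 * B / pi) * (\<Sum>j\<le>k. of_real (laguerre_coeff B k j) * ladder_kernel B j j z w)"
proof -
  have e: "exp (of_real B * (z * cnj w - cnj z * w)) * of_real (exp (- B * (norm (z - w))\<^sup>2))
      = exp (of_real B * (2 * z * cnj w - z * cnj z - w * cnj w))"
  proof -
    have "of_real B * (z * cnj w - cnj z * w) + of_real (- B * (norm (z - w))\<^sup>2)
        = of_real B * (2 * z * cnj w - z * cnj z - w * cnj w)"
      unfolding of_real_mult complex_norm_square by (simp add: algebra_simps)
    then show ?thesis unfolding exp_of_real[symmetric] exp_add[symmetric] by simp
  qed
  have p: "complex_of_real (gaussian_monomial B (2 * j) (z - w))
      = of_real (exp (- B * (norm (z - w))\<^sup>2)) * ((z - w) ^ j * cnj (z - w) ^ j)" for j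
  proof -
    have "complex_of_real (norm (z - w) ^ (2 * j)) = (z - w) ^ j * cnj (z - w) ^ j"
      unfolding power_mult of_real_power[of _ j] complex_norm_square by (rule power_mult_distrib)
    then show ?thesis unfolding gaussian_monomial_def by (simp only: of_real_mult)
  qed
  have "landau_kernel B k z w = of_real (2 * B / pi) * (\<Sum>j\<le>k. exp (of_real B * (z * cnj w - cnj z * w))
      * of_real (laguerre_coeff B k j * gaussian_monomial B (2 * j) (z - w)))"
    unfolding landau_kernel_def gaussian_laguerre by (simp only: of_real_sum mult.assoc sum_distrib_left)
  also have "\<dots> = of_real (2 * B / pi) * (\<Sum>j\<le>k. of_real (laguerre_coeff B k j) * ladder_kernel B j j z w)"
    unfolding of_real_mult p ladder_kernel_def e[symmetric] by (simp only: ac_simps)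
  finally show ?thesis .
qed

text \<open>The kernel is a combination of ladder kernels with Laguerre coefficients.\<close>

lemma landau_projection_mem:
  assumes B: "0 < B" and f: "f \<in> L2"
  shows "landau_projection B k f \<in> landau_level B k"
proof -
  define S where "S z = (\<Sum>j\<le>k. of_real (laguerre_coeff B k j) * ladder_integral B f j j z)" for z
  have eq: "landau_projection B k f = (\<lambda>z. of_real (2 * B / pi) * S z)"
    unfolding landau_projection_def[abs_def] landau_kernel_ladder S_def ladder_integral_def[OF B f]
    by (simp only: mult.assoc sum_distrib_right integral_mult_right_zero Bochner_Integration.integral_sum
        integrable_mult_right ladder_kernel_integrable[OF B f])
  have S: "C_diff 2 S" "\<And>z. landau B S z = of_real (B * (2 * real k + 1)) * S z"
    using landau_ladder_sum[OF B f, of k] unfolding S_def by blast+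
  show ?thesis
    unfolding landau_level_def[OF B]
  proof (intro CollectI conjI allI)
    show "landau_projection B k f \<in> L2" by (rule landau_projection_L2[OF B f])
    show "C_diff 2 (landau_projection B k f)" unfolding eq by (intro C_diff_mult C_diff_const S)
    show "landau B (landau_projection B k f) z = of_real (B * (2 * real k + 1)) * landau_projection B k f z" for z
      unfolding eq landau_cmult[OF S(1)] S(2) by (simp only: ac_simps)
  qed
qed

section \<open>Removing the gauge\<close>

lemma inv_motion_group:
  assumes "g \<in> carrier motion_group"
  shows "inv\<^bsub>motion_group\<^esub> g = (cnj (fst g), - cnj (fst g) * snd g)"
proof (rule group.inv_equality[OF group_motion_group _ assms])
  have "cnj (fst g) * fst g = 1"
    using assms by (simp add: motion_group_def complex_norm_square[symmetric] mult.commute)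
  then show "(cnj (fst g), - cnj (fst g) * snd g) \<otimes>\<^bsub>motion_group\<^esub> g = \<one>\<^bsub>motion_group\<^esub>"
    by (simp add: motion_group_def)
  show "(cnj (fst g), - cnj (fst g) * snd g) \<in> carrier motion_group"
    using assms by (simp add: motion_group_def)
qed

text \<open>The remaining part transports the results on the Landau operator to the magnetic Schroedinger operator.\<close>

locale magnetic_gauge =
  fixes \<nu> \<mu> :: real and \<rho> :: "complex \<times> complex \<Rightarrow> complex \<times> complex" and \<tau> :: "complex \<Rightarrow> complex"
  assumes pair: "equivariant_pair \<rho> \<tau>" and B_pos: "0 < magnetic_B \<nu> \<mu> \<tau>"

begin

abbreviation B :: real where "B \<equiv> magnetic_B \<nu> \<mu> \<tau>"

abbreviation S :: "complex \<Rightarrow> complex" where "S \<equiv> magnetic_S \<nu> \<mu> \<tau>"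

definition U :: "complex \<Rightarrow> complex"
  where "U z = exp (- \<i> * of_real (magnetic_phase \<nu> \<mu> \<tau> z))"

lemma phase: "is_magnetic_phase \<nu> \<mu> \<tau> (magnetic_phase \<nu> \<mu> \<tau>)"
  unfolding magnetic_phase_def by (rule theI'[OF ex1_magnetic_phase[OF pair]])

lemma norm_U: "norm (U z) = 1"
  by (simp add: U_def norm_exp_eq_Re)

lemma U_cnj: "U z * cnj (U z) = 1" "cnj (U z) * U z = 1"
  using complex_norm_square[of "U z"] by (simp_all add: norm_U mult.commute)

lemma C_diff_phase: "C_diff n (\<lambda>z. - \<i> * of_real (magnetic_phase \<nu> \<mu> \<tau> z))"
  using phase unfolding is_magnetic_phase_def smooth_def
  by (intro C_diff_mult C_diff_const C_diff_bounded_linear[OF bounded_linear_of_real]) blast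

lemma C_diff_U: "C_diff n U"
  unfolding U_def[abs_def] by (rule C_diff_exp[OF C_diff_phase])

lemma U_measurable [measurable]: "U \<in> borel_measurable borel"
  by (rule borel_measurable_continuous_onI[OF C_diff_continuous[OF C_diff_U]])

text \<open>The gauge function turns \<open>\<partial>bar + S\<close> into \<open>\<partial>bar + B z\<close> and \<open>\<partial> - cnj S\<close> into \<open>\<partial> - B cnj z\<close>.\<close>

lemma U_derivative:
  "dz U z = cnj (S z - complex_of_real B * z) * U z" "dzbar U z = - (S z - complex_of_real B * z) * U z"
proof -
  let ?f = "\<lambda>w. complex_of_real (magnetic_phase \<nu> \<mu> \<tau> w)"
  have f: "C_diff (Suc 0) ?f"
    using phase unfolding is_magnetic_phase_def smooth_def
    by (intro C_diff_bounded_linear[OF bounded_linear_of_real]) blast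
  note d = C_diff_differentiable[OF f, of z]
  have 1: "dzbar ?f z = - \<i> * (S z - complex_of_real B * z)"
    using phase unfolding is_magnetic_phase_def by blast
  have "dz (\<lambda>w. cnj (?f w)) z = cnj (dzbar ?f z)" by (rule dz_cnj(1)[OF d])
  then have 2: "dz ?f z = \<i> * cnj (S z - complex_of_real B * z)" unfolding 1 by simp
  have "((\<lambda>w. - \<i> * ?f w) has_derivative (\<lambda>v. - \<i> * (dz ?f z * v + dzbar ?f z * cnj v))) (at z)"
    by (rule has_derivative_mult_right[OF wirtinger_derivative[OF d]])
  from has_derivative_compose[OF this DERIV_exp[unfolded has_field_derivative_def]]
  have "(U has_derivative (\<lambda>v. (cnj (S z - complex_of_real B * z) * U z) * v + (- (S z - complex_of_real B * z) * U z) * cnj v)) (at z)"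
    unfolding U_def[abs_def] 1 2 by (rule has_derivative_eq_rhs) (simp add: fun_eq_iff algebra_simps)
  from dz_eqI[OF this] show "dz U z = cnj (S z - complex_of_real B * z) * U z" "dzbar U z = - (S z - complex_of_real B * z) * U z" .
qed

lemma smooth_differentiable: "smooth f \<Longrightarrow> f differentiable (at z)" for f :: "complex \<Rightarrow> complex"
  using smooth_has_derivative differentiable_def by blast

lemma smooth_tau: "smooth \<tau>"
  using pair by (simp add: equivariant_pair_def)

lemma S_eq: "S z = complex_of_real \<nu> * z + \<mu> * (\<tau> z * cnj (dz \<tau> z) - cnj (\<tau> z) * dzbar \<tau> z)"
  by (simp add: magnetic_S_def dz_cnj(2)[OF smooth_differentiable[OF smooth_tau]])

lemma smooth_S: "smooth S"
proof -
  have "S = (\<lambda>z. complex_of_real \<nu> * z + \<mu> * (\<tau> z * cnj (dz \<tau> z) - cnj (\<tau> z) * dzbar \<tau> z))" using S_eq by blast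
  moreover have "smooth (\<lambda>z. complex_of_real \<nu> * z + \<mu> * (\<tau> z * cnj (dz \<tau> z) - cnj (\<tau> z) * dzbar \<tau> z))"
    by (intro smooth_intros(1,2,4,5) smooth_diff smooth_cnj smooth_dz smooth_tau)
  ultimately show ?thesis by simp
qed

text \<open>The zeroth order term of the magnetic Schroedinger operator is exactly what makes it factorise: it
  cancels the non-constant part of \<open>\<partial> S\<close>.\<close>

lemma dz_S: "dz S z = B + (\<mu> / 4) * (\<tau> z * laplacian (\<lambda>w. cnj (\<tau> w)) z - cnj (\<tau> z) * laplacian \<tau> z)"
proof -
  note df = smooth_differentiable
  note sm = smooth_tau smooth_dz[OF smooth_tau] smooth_cnj[OF smooth_tau] smooth_cnj[OF smooth_dz(1)[OF smooth_tau]]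
  have p: "smooth (\<lambda>z. \<tau> z * cnj (dz \<tau> z))" "smooth (\<lambda>z. cnj (\<tau> z) * dzbar \<tau> z)"
    by (intro smooth_intros(5) sm)+
  have T: "smooth (\<lambda>z. \<tau> z * cnj (dz \<tau> z) - cnj (\<tau> z) * dzbar \<tau> z)" by (intro smooth_diff p)
  have eT: "dz (\<lambda>z. \<tau> z * cnj (dz \<tau> z) - cnj (\<tau> z) * dzbar \<tau> z) z
      = dz \<tau> z * cnj (dz \<tau> z) - cnj (dzbar \<tau> z) * dzbar \<tau> z
      + (\<tau> z * cnj (dz (dzbar \<tau>) z) - cnj (\<tau> z) * dz (dzbar \<tau>) z)"
    by (simp add: dz_diff[OF p[THEN df]] dz_mult(1)[OF df df] dz_cnj[OF df] sm dz_dzbar_commute[OF smooth_tau] algebra_simps)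
  have eN: "dz \<tau> z * cnj (dz \<tau> z) - cnj (dzbar \<tau> z) * dzbar \<tau> z = of_real ((norm (dz \<tau> z))\<^sup>2 - (norm (dzbar \<tau> z))\<^sup>2)"
    unfolding of_real_diff complex_norm_square by (simp add: mult.commute)
  have eL: "laplacian (\<lambda>w. cnj (\<tau> w)) z = 4 * cnj (dz (dzbar \<tau>) z)"
  proof -
    have "dzbar (\<lambda>w. cnj (\<tau> w)) = (\<lambda>w. cnj (dz \<tau> w))" using dz_cnj(2)[OF df[OF smooth_tau]] by blast
    then show ?thesis unfolding laplacian_def by (simp add: dz_cnj(1)[OF df] sm dz_dzbar_commute[OF smooth_tau])
  qed
  have eS: "dz S z = \<nu> + \<mu> * dz (\<lambda>z. \<tau> z * cnj (dz \<tau> z) - cnj (\<tau> z) * dzbar \<tau> z) z"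
  proof -
    have l: "smooth (\<lambda>z. complex_of_real \<nu> * z)" "smooth (\<lambda>z. complex_of_real \<mu> * (\<tau> z * cnj (dz \<tau> z) - cnj (\<tau> z) * dzbar \<tau> z))"
      by (intro smooth_intros(1,2,5) T)+
    have "S = (\<lambda>z. complex_of_real \<nu> * z + \<mu> * (\<tau> z * cnj (dz \<tau> z) - cnj (\<tau> z) * dzbar \<tau> z))" using S_eq by blast
    then show ?thesis by (simp only: dz_add[OF l[THEN df]] dz_linear dz_cmult(1)[OF df[OF T]])
  qed
  have eB: "complex_of_real B = complex_of_real \<nu> + complex_of_real \<mu> * complex_of_real ((norm (dz \<tau> z))\<^sup>2 - (norm (dzbar \<tau> z))\<^sup>2)"
    unfolding magnetic_field_eq[OF pair, of \<nu> \<mu> z, symmetric] magnetic_field_def of_real_add of_real_mult ..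
  show ?thesis
    unfolding eS eT eN eL eB laplacian_def[of \<tau>] by (simp add: algebra_simps)
qed

lemma magnetic_schroedinger_factor:
  fixes F :: "complex \<Rightarrow> complex"
  assumes F: "C_diff 2 F"
  shows "magnetic_schroedinger \<nu> \<mu> \<tau> F z
    = - dz (\<lambda>w. dzbar F w + S w * F w) z + cnj (S z) * (dzbar F z + S z * F z) + B * F z"
proof -
  have F2: "C_diff (Suc (Suc 0)) F" using F by (simp only: numeral_2_eq_2)
  have d: "F differentiable (at z)" "dzbar F differentiable (at z)" "S differentiable (at z)"
    using C_diff_differentiable[OF F2] C_diff_differentiable[OF C_diff_dz(2)[OF F2]] smooth_differentiable[OF smooth_S] by auto
  have "dz (\<lambda>w. dzbar F w + S w * F w) z = dz (dzbar F) z + (dz S z * F z + S z * dz F z)"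
    using d by (simp add: dz_add dz_mult(1) differentiable_mult)
  moreover have "complex_of_real ((norm (S z))\<^sup>2) = S z * cnj (S z)" by (rule complex_norm_square)
  ultimately show ?thesis
    unfolding magnetic_schroedinger_def dz_S by (simp only:) (simp add: algebra_simps)
qed

lemma magnetic_schroedinger_gauge:
  fixes G :: "complex \<Rightarrow> complex"
  assumes G: "C_diff 2 G"
  shows "magnetic_schroedinger \<nu> \<mu> \<tau> (\<lambda>w. U w * G w) z = U z * landau B G z"
proof -
  have G2: "C_diff (Suc (Suc 0)) G" using G by (simp only: numeral_2_eq_2)
  have dU: "U differentiable (at w)" for w by (rule C_diff_differentiable[OF C_diff_U])
  have lower: "(\<lambda>w. dzbar (\<lambda>w. U w * G w) w + S w * (U w * G w)) = (\<lambda>w. U w * landau_lower B G w)"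
    unfolding dz_mult(2)[OF dU C_diff_differentiable[OF G2]] U_derivative landau_lower_def
    by (simp add: fun_eq_iff algebra_simps)
  have UG: "C_diff 2 (\<lambda>w. U w * G w)" by (intro C_diff_mult C_diff_U G)
  show ?thesis
    unfolding magnetic_schroedinger_factor[OF UG] lower fun_cong[OF lower]
      dz_mult(1)[OF dU C_diff_differentiable[OF C_diff_landau_lower[OF G2]]] U_derivative landau_factor[OF G]
    by (simp add: algebra_simps)
qed

lemma L2_gauge: "f \<in> L2 \<Longrightarrow> (\<lambda>z. U z * f z) \<in> L2" "f \<in> L2 \<Longrightarrow> (\<lambda>z. cnj (U z) * f z) \<in> L2"
proof -
  assume f: "f \<in> L2"
  note [measurable] = L2_measurable[OF f]
  have [measurable]: "(\<lambda>z. cnj (U z)) \<in> borel_measurable borel" by (rule borel_measurable_cnj[OF U_measurable])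
  show "(\<lambda>z. U z * f z) \<in> L2" by (rule L2_bound[OF f]) (measurable, simp add: norm_mult norm_U)
  show "(\<lambda>z. cnj (U z) * f z) \<in> L2" by (rule L2_bound[OF f]) (measurable, simp add: norm_mult norm_U)
qed

lemma eigenspace_gauge: "F \<in> eigenspace \<nu> \<mu> \<tau> k \<longleftrightarrow> (\<lambda>z. cnj (U z) * F z) \<in> landau_level B k"
proof -
  let ?G = "\<lambda>z. cnj (U z) * F z"
  have UG: "(\<lambda>z. U z * ?G z) = F" by (rule ext) (simp add: mult.assoc[symmetric] U_cnj)
  have L2: "F \<in> L2 \<longleftrightarrow> ?G \<in> L2" using L2_gauge(1)[of ?G] L2_gauge(2)[of F] unfolding UG by blast
  have C2: "C_diff 2 F \<longleftrightarrow> C_diff 2 ?G"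
    using C_diff_mult[OF C_diff_U, of 2 ?G] C_diff_mult[OF C_diff_cnj[OF C_diff_U], of 2 F] unfolding UG by blast
  have "magnetic_schroedinger \<nu> \<mu> \<tau> F z = eigenvalue \<nu> \<mu> \<tau> k * F z
      \<longleftrightarrow> landau B ?G z = of_real (B * (2 * real k + 1)) * ?G z" if "C_diff 2 ?G" for z
  proof -
    have 1: "magnetic_schroedinger \<nu> \<mu> \<tau> F z = U z * landau B ?G z"
      using magnetic_schroedinger_gauge[OF that, of z] unfolding UG .
    have 2: "eigenvalue \<nu> \<mu> \<tau> k * F z = U z * (of_real (B * (2 * real k + 1)) * ?G z)"
      using mult.left_commute[of "of_real (B * (2 * real k + 1))" "U z" "?G z"] fun_cong[OF UG, of z]
      unfolding eigenvalue_def by (simp only:)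
    have "U z \<noteq> 0" using norm_U[of z] by auto
    then show ?thesis unfolding 1 2 by (simp only: mult_cancel_left simp_thms)
  qed
  then show ?thesis unfolding eigenspace_def landau_level_def[OF B_pos] using L2 C2 by auto
qed

definition proj :: "nat \<Rightarrow> (complex \<Rightarrow> complex) \<Rightarrow> complex \<Rightarrow> complex"
  where "proj k f z = U z * landau_projection B k (\<lambda>w. cnj (U w) * f w) z"

lemma cnj_U_proj: "(\<lambda>z. cnj (U z) * proj k f z) = landau_projection B k (\<lambda>w. cnj (U w) * f w)"
  by (rule ext) (simp add: proj_def mult.assoc[symmetric] U_cnj)

sublocale total_projections "eigenspace \<nu> \<mu> \<tau>" proj
proof
  fix j k c and F H f g :: "complex \<Rightarrow> complex"
  show "eigenspace \<nu> \<mu> \<tau> k \<subseteq> L2" by (auto simp: eigenspace_def)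
  show "(\<lambda>z. 0) \<in> eigenspace \<nu> \<mu> \<tau> k"
    unfolding eigenspace_gauge landau_level_def[OF B_pos]
    using landau_cmult[OF C_diff_const, of B 0 0] by (simp add: L2_zero C_diff_const)
  show "(\<lambda>z. F z + H z) \<in> eigenspace \<nu> \<mu> \<tau> k" if "F \<in> eigenspace \<nu> \<mu> \<tau> k" "H \<in> eigenspace \<nu> \<mu> \<tau> k"
    using that unfolding eigenspace_gauge distrib_left landau_level_def[OF B_pos]
    by (simp add: L2_add C_diff_add landau_add distrib_left)
  show "(\<lambda>z. c * F z) \<in> eigenspace \<nu> \<mu> \<tau> k" if "F \<in> eigenspace \<nu> \<mu> \<tau> k"
    using that unfolding eigenspace_gauge mult.left_commute[of "cnj _" c] landau_level_def[OF B_pos]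
    by (simp add: L2_scale C_diff_mult C_diff_const landau_cmult mult.left_commute)
  show "proj k f \<in> eigenspace \<nu> \<mu> \<tau> k" if "f \<in> L2"
    unfolding eigenspace_gauge cnj_U_proj by (rule landau_projection_mem[OF B_pos L2_gauge(2)[OF that]])
  show "proj j F = (if j = k then F else (\<lambda>z. 0))" if "F \<in> eigenspace \<nu> \<mu> \<tau> k"
    using landau_projection_on_level[OF B_pos that[unfolded eigenspace_gauge], of j]
    by (auto simp: proj_def fun_eq_iff mult.assoc[symmetric] U_cnj)
  show "proj k (\<lambda>z. f z - g z) = (\<lambda>z. proj k f z - proj k g z)" if "f \<in> L2" "g \<in> L2"
    unfolding proj_def right_diff_distrib landau_projection_diff[OF B_pos L2_gauge(2)[OF that(1)] L2_gauge(2)[OF that(2)]] ..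
  show "L2_inner (proj k f) g = L2_inner f (proj k g)" if "f \<in> L2" "g \<in> L2"
  proof -
    have "L2_inner (proj k f) g = L2_inner (landau_projection B k (\<lambda>w. cnj (U w) * f w)) (\<lambda>w. cnj (U w) * g w)"
      unfolding L2_inner_def proj_def by (simp add: ac_simps)
    also have "\<dots> = L2_inner (\<lambda>w. cnj (U w) * f w) (landau_projection B k (\<lambda>w. cnj (U w) * g w))"
      by (rule landau_projection_symmetric[OF B_pos L2_gauge(2)[OF that(1)] L2_gauge(2)[OF that(2)]])
    also have "\<dots> = L2_inner f (proj k g)"
      unfolding L2_inner_def proj_def by (simp add: ac_simps)
    finally show ?thesis .
  qed
  show "\<exists>C. \<forall>f\<in>L2. \<forall>z. norm (proj k f z) \<le> C * L2_norm f"
  proof -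
    obtain C where C: "\<And>f z. f \<in> L2 \<Longrightarrow> norm (landau_projection B k f z) \<le> C * L2_norm f"
      using landau_projection_bounded[OF B_pos, of k] by blast
    have "norm (proj k f z) \<le> C * L2_norm f" if "f \<in> L2" for f z
      using C[OF L2_gauge(2)[OF that], of z] by (simp add: proj_def norm_mult norm_U L2_norm_def)
    then show ?thesis by blast
  qed
  show "AE z in lborel. f z = 0" if f: "f \<in> L2" and zero: "\<And>k. proj k f = (\<lambda>z. 0)"
  proof -
    have "landau_projection B k (\<lambda>w. cnj (U w) * f w) = (\<lambda>z. 0)" for k
      using cnj_U_proj[of k f] by (simp add: zero)
    then have "AE z in lborel. cnj (U z) * f z = 0" by (rule landau_projection_total[OF B_pos L2_gauge(2)[OF f]])
    moreover have "U z \<noteq> 0" for z using norm_U[of z] by auto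
    ultimately show ?thesis by simp
  qed
qed

definition kernel :: "nat \<Rightarrow> complex \<Rightarrow> complex \<Rightarrow> complex"
  where "kernel k z w = U z * landau_kernel B k z w * cnj (U w)"

lemma kernel_integral:
  assumes f: "f \<in> L2"
  shows "integrable lborel (\<lambda>w. kernel k z w * f w)" "(LBINT w. kernel k z w * f w) = proj k f z"
proof -
  have 1: "kernel k z w * f w = U z * (landau_kernel B k z w * (cnj (U w) * f w))" for w
    by (simp add: kernel_def ac_simps)
  show "integrable lborel (\<lambda>w. kernel k z w * f w)"
    unfolding 1 by (rule integrable_mult_right[OF landau_kernel_integrable[OF B_pos L2_gauge(2)[OF f]]])
  show "(LBINT w. kernel k z w * f w) = proj k f z"
    unfolding 1 proj_def landau_projection_def by (rule integral_mult_right_zero)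
qed

lemma kernel_continuous: "continuous_on UNIV (\<lambda>(z, w). kernel k z w)"
proof -
  have U: "continuous_on UNIV U" by (rule C_diff_continuous[OF C_diff_U])
  show ?thesis
    unfolding kernel_def split_beta
    by (intro continuous_intros continuous_on_compose2[OF U] landau_kernel_continuous[unfolded split_beta]) auto
qed

lemma is_projection_kernel_kernel: "is_projection_kernel (eigenspace \<nu> \<mu> \<tau> k) (kernel k)"
  unfolding is_projection_kernel_def
  using kernel_continuous kernel_integral is_orthogonal_projection_proj by simp

text \<open>Applied to a square integrable function, two projection kernels give continuous functions that agree
  almost everywhere, hence everywhere. For fixed \<open>z\<close> the difference of the kernels then has integral \<open>0\<close> over all boxes.\<close>

lemma projection_kernel_unique:
  assumes K: "is_projection_kernel (eigenspace \<nu> \<mu> \<tau> k) K"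
  shows "K = kernel k"
proof (intro ext)
  fix z w :: complex
  have Kc: "continuous_on UNIV (\<lambda>(z, w). K z w)"
    and Ki: "\<And>f z. f \<in> L2 \<Longrightarrow> integrable lborel (\<lambda>w. K z w * f w)"
    and Kp: "\<And>f. f \<in> L2 \<Longrightarrow> is_orthogonal_projection (eigenspace \<nu> \<mu> \<tau> k) f (\<lambda>z. LBINT w. K z w * f w)"
    using K unfolding is_projection_kernel_def by blast+
  have same: "(LBINT w. K z w * f w) = (LBINT w. kernel k z w * f w)" if f: "f \<in> L2" for f z
  proof -
    let ?h = "\<lambda>z. LBINT w. K z w * f w"
    have h: "?h \<in> eigenspace \<nu> \<mu> \<tau> k" and p: "proj k f \<in> eigenspace \<nu> \<mu> \<tau> k"
      using Kp[OF f] proj_mem[OF f] unfolding is_orthogonal_projection_def by blast+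
    have p': "(\<lambda>z. - 1 * proj k f z) \<in> eigenspace \<nu> \<mu> \<tau> k" by (rule scale_mem[OF p])
    have d: "(\<lambda>z. ?h z - proj k f z) \<in> eigenspace \<nu> \<mu> \<tau> k" using add_mem[OF h p'] by simp
    have L2: "?h \<in> L2" "proj k f \<in> L2" using h p mem_L2 by blast+
    have "L2_inner (\<lambda>z. f z - ?h z) (\<lambda>z. ?h z - proj k f z) = 0" "L2_inner (\<lambda>z. f z - proj k f z) (\<lambda>z. ?h z - proj k f z) = 0"
      using Kp[OF f] is_orthogonal_projection_proj[OF f, of k] d unfolding is_orthogonal_projection_def by blast+
    then have "L2_inner ?h (\<lambda>z. ?h z - proj k f z) = L2_inner (proj k f) (\<lambda>z. ?h z - proj k f z)"
      using L2_inner_diff(1)[OF f L2(1) L2_diff[OF L2]] L2_inner_diff(1)[OF f L2(2) L2_diff[OF L2]] by simp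
    then have "L2_inner (\<lambda>z. ?h z - proj k f z) (\<lambda>z. ?h z - proj k f z) = 0"
      unfolding L2_inner_diff(1)[OF L2 L2_diff[OF L2]] by simp
    then have "L2_norm (\<lambda>z. ?h z - proj k f z) = 0" unfolding L2_inner_self by simp
    then have "AE z in lborel. ?h z = proj k f z" by (rule AE_eq_if_L2_norm_diff_zero[OF L2])
    then have "AE z in lborel. ?h z - proj k f z = 0" by simp
    moreover have "continuous_on UNIV (\<lambda>z. ?h z - proj k f z)"
      using d by (auto simp: eigenspace_def intro: C_diff_continuous)
    ultimately have "?h z - proj k f z = 0" by (intro continuous_AE_zero)
    then show ?thesis using kernel_integral(2)[OF f] by simp
  qed
  have "continuous_on UNIV (Pair z)" by (intro continuous_intros)
  then have sec: "continuous_on UNIV (\<lambda>w. K z w - kernel k z w)"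
    using continuous_on_compose2[OF Kc, of UNIV "Pair z"] continuous_on_compose2[OF kernel_continuous, of UNIV "Pair z" k]
    by (intro continuous_on_diff) simp_all
  have "AE w in lborel. K z w - kernel k z w = 0"
  proof (rule AE_zero_if_integral_box_zero)
    fix a b :: complex
    define g where "g z = complex_of_real (indicator (box a b) z)" for z
    have g: "g \<in> L2" unfolding g_def[abs_def] by (rule L2_indicator_box)
    have eq: "indicator (box a b) w *\<^sub>R (K z w - kernel k z w) = K z w * g w - kernel k z w * g w" for w
      by (simp add: g_def scaleR_conv_of_real algebra_simps)
    show "set_integrable lborel (box a b) (\<lambda>w. K z w - kernel k z w)"
      unfolding set_integrable_def eq by (intro Bochner_Integration.integrable_diff Ki kernel_integral g)
    show "(LINT w:box a b|lborel. K z w - kernel k z w) = 0"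
      unfolding set_lebesgue_integral_def eq using same[OF g, of z] Ki[OF g] kernel_integral(1)[OF g] by simp
  qed
  then have "K z w - kernel k z w = 0" by (rule continuous_AE_zero[OF sec])
  then show "K z w = kernel k z w" by simp
qed

lemma kernel_explicit:
  "kernel k z w = 2 * B / pi * exp (- \<i> * phase_diff \<nu> \<mu> \<tau> z w) * exp (2 * \<i> * B * Im (z * cnj w))
    * exp (- B * (norm (z - w))\<^sup>2) * laguerre k (2 * B * (norm (z - w))\<^sup>2)"
proof -
  have 1: "U z * cnj (U w) = exp (- \<i> * phase_diff \<nu> \<mu> \<tau> z w)"
    unfolding U_def phase_diff_def by (simp add: exp_cnj exp_add[symmetric] algebra_simps)
  have "of_real B * (z * cnj w - cnj z * w) = 2 * \<i> * B * Im (z * cnj w)"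
    by (simp add: complex_eq_iff algebra_simps)
  then show ?thesis
    unfolding kernel_def landau_kernel_def 1[symmetric] by (simp only: of_real_mult) (simp only: ac_simps)
qed

text \<open>A rigid motion preserves \<open>|z - w|\<close>, and it changes \<open>Im (z cnj w)\<close> by a term that depends only on \<open>z - w\<close>.\<close>

lemma kernel_invariant:
  assumes g: "g \<in> carrier motion_group"
  shows "kernel k z w = exp (- \<i> * (phase_diff \<nu> \<mu> \<tau> z w - phase_diff \<nu> \<mu> \<tau> (act g z) (act g w)))
    * exp (2 * \<i> * B * Im ((z - w) * cnj (act (inv\<^bsub>motion_group\<^esub> g) 0))) * kernel k (act g z) (act g w)"
proof -
  obtain a b where ab: "g = (a, b)" by (cases g)
  have a: "norm a = 1" using g by (simp add: ab motion_group_def)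
  then have aa: "a * cnj a = 1" using complex_norm_square[of a] by simp
  have inv0: "act (inv\<^bsub>motion_group\<^esub> g) 0 = - cnj a * b" 
    unfolding inv_motion_group[OF g] by (simp add: act_def ab)
  have "act g z - act g w = a * (z - w)" by (simp add: act_def ab algebra_simps)
  then have dist: "norm (act g z - act g w) = norm (z - w)" using a by (simp add: norm_mult)
  have "act g z * cnj (act g w) = (a * cnj a) * (z * cnj w) + a * z * cnj b + cnj (a * w * cnj b) + b * cnj b"
    by (simp add: act_def ab algebra_simps)
  moreover have "Im (b * cnj b) = 0" by simp
  ultimately have "Im (act g z * cnj (act g w)) = Im (z * cnj w) + Im (a * z * cnj b) - Im (a * w * cnj b)"
    unfolding aa by (simp only: mult_1_left plus_complex.sel cnj.sel)
  moreover have "Im ((z - w) * cnj (- cnj a * b)) = - Im (a * z * cnj b) + Im (a * w * cnj b)"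
    by (simp add: algebra_simps)
  ultimately have "Im (z * cnj w) = Im ((z - w) * cnj (- cnj a * b)) + Im (act g z * cnj (act g w))" by linarith
  then have 1: "exp (2 * \<i> * B * Im (z * cnj w))
      = exp (2 * \<i> * B * Im ((z - w) * cnj (act (inv\<^bsub>motion_group\<^esub> g) 0))) * exp (2 * \<i> * B * Im (act g z * cnj (act g w)))"
    unfolding inv0 by (simp only: of_real_add distrib_left exp_add)
  have 2: "exp (- \<i> * phase_diff \<nu> \<mu> \<tau> z w)
      = exp (- \<i> * (phase_diff \<nu> \<mu> \<tau> z w - phase_diff \<nu> \<mu> \<tau> (act g z) (act g w))) * exp (- \<i> * phase_diff \<nu> \<mu> \<tau> (act g z) (act g w))"
    unfolding exp_add[symmetric] by (rule arg_cong[where f = exp]) (simp add: algebra_simps)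
  show ?thesis unfolding kernel_explicit dist 1 2 by (simp only: ac_simps)
qed

end

theorem proposition4p1:
  fixes \<nu> \<mu> :: real
    and \<rho> :: "complex \<times> complex \<Rightarrow> complex \<times> complex"
    and \<tau> :: "complex \<Rightarrow> complex"
  assumes "\<nu> > 0" and "\<mu> > 0"
    and "equivariant_pair \<rho> \<tau>"
    and "magnetic_B \<nu> \<mu> \<tau> > 0"
  shows "L2_orthogonal_decomposition (eigenspace \<nu> \<mu> \<tau>) \<and>
    (\<forall>k. (\<exists>!K. is_projection_kernel (eigenspace \<nu> \<mu> \<tau> k) K) \<and>
      (\<forall>K. is_projection_kernel (eigenspace \<nu> \<mu> \<tau> k) K \<longrightarrow>
        (\<forall>g\<in>carrier motion_group. \<forall>z w.
          K z w =
            exp (- \<i> * (phase_diff \<nu> \<mu> \<tau> z w - phase_diff \<nu> \<mu> \<tau> (act g z) (act g w))) *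
            exp (2 * \<i> * magnetic_B \<nu> \<mu> \<tau> * Im ((z - w) * cnj (act (inv\<^bsub>motion_group\<^esub> g) 0))) *
            K (act g z) (act g w)) \<and>
        (\<forall>z w.
          K z w =
            2 * magnetic_B \<nu> \<mu> \<tau> / pi *
            exp (- \<i> * phase_diff \<nu> \<mu> \<tau> z w) *
            exp (2 * \<i> * magnetic_B \<nu> \<mu> \<tau> * Im (z * cnj w)) *
            exp (- magnetic_B \<nu> \<mu> \<tau> * (norm (z - w))\<^sup>2) *
            laguerre k (2 * magnetic_B \<nu> \<mu> \<tau> * (norm (z - w))\<^sup>2))))"
proof -
  interpret magnetic_gauge \<nu> \<mu> \<rho> \<tau> by unfold_locales (use assms in auto)
  have "is_projection_kernel (eigenspace \<nu> \<mu> \<tau> k) K \<longleftrightarrow> K = kernel k" for k K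
    using is_projection_kernel_kernel projection_kernel_unique by blast
  then show ?thesis
    using orthogonal_decomposition kernel_invariant kernel_explicit by simp
qed

end
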